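(* The almost complex structure $\mathbf{J}$ on the manifold $\mathcal{A}$, given by $\mathbf{J}_J(A)=A\circ J$ for $J\in\mathcal{A}$, $A\in T_J\mathcal{A}$, is integrable. The corresponding complex structure on $\mathcal{A}$ coincides with the complex structure on $\mathcal{A}$ obtained from the parameterizations $\Phi=\Phi_{J_0}:\mathcal{U}(J_0)\to\mathcal{V}(J_0)\subset \mathrm{End}_{J_0}(TM)$, $J_0\in\mathcal{A}$, where $\mathrm{End}_{J_0}(TM)$ carries the complex structure $A\mapsto A\circ J_0$.
   Context: $M$ is a smooth closed oriented manifold of dimension $2n$. $\mathcal{A}$ is the space of all smooth almost complex structures on $M$, i.e. smooth endomorphism fields $J:TM\to TM$ with $J^2=-\mathrm{Id}$; it is the space of smooth sections of the bundle $A(M)\to M$ whose fiber over $x$ consists of the automorphisms $J_x$ of $T_xM$ with $J_x^2=-I_x$, and it is an infinite-dimensional smooth ILH-manifold (inverse limit of Hilbert manifolds). For $J\in\mathcal{A}$, $\mathrm{End}_J(TM)$ is the space of smooth endomorphisms $K:TM\to TM$ with $JK+KJ=0$; the tangent space is $T_J\mathcal{A}=\mathrm{End}_J(TM)$. The almost complex structure $\mathbf{J}$ on $\mathcal{A}$ is $\mathbf{J}_J:T_J\mathcal{A}\to T_J\mathcal{A}$, $\mathbf{J}_J(A)=A\circ J$. Local charts: for $J_0\in\mathcal{A}$ let $\mathcal{U}(J_0)=\{J\in\mathcal{A}: 1-JJ_0 \text{ is an isomorphism of } TM\}$ (open in $\mathcal{A}$) and $\mathcal{V}(J_0)=\{K\in\mathrm{End}_{J_0}(TM):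 1-K\text{ is invertible}\}$ (open in $\mathrm{End}_{J_0}(TM)$). The chart is $\Phi_{J_0}:\mathcal{U}(J_0)\to\mathcal{V}(J_0)$, $\Phi_{J_0}(J)=(1-JJ_0)^{-1}(1+JJ_0)$, with inverse $K\mapsto J_K=J_0(1+K)(1-K)^{-1}$. The model space $\mathrm{End}_{J_0}(TM)$ has the complex structure $A\mapsto A\circ J_0$. *)

theory Defs
  imports "HOL-Analysis.Analysis" "HOL-Library.Function_Algebras"
begin

section \<open>Functions into a real vector space\<close>

instantiation "fun" :: (type, scaleR) scaleR
begin
definition scaleR_fun :: "real \<Rightarrow> ('a \<Rightarrow> 'b) \<Rightarrow> 'a \<Rightarrow> 'b"
  where "scaleR_fun r f = (\<lambda>x. r *\<^sub>R f x)"
instance ..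
end

instance "fun" :: (type, real_vector) real_vector
  by standard (simp_all add: scaleR_fun_def fun_eq_iff algebra_simps)


section \<open>Calculus and complex charts in topological vector spaces\<close>

text \<open>
  Throughout this section, \<open>T\<close> is a topology whose \<open>topspace\<close> is a linear subspace of the ambient
  type and which makes that subspace a Hausdorff locally convex space. The calculus is the usual one
  for Frechet spaces (Michal--Bastiani, Hamilton): a map is smooth if all iterated directional
  derivatives exist and are jointly continuous in the point and the directions.
\<close>

definition has_dir_deriv ::
  "'v::real_vector topology \<Rightarrow> ('v \<Rightarrow> 'v) \<Rightarrow> 'v \<Rightarrow> 'v \<Rightarrow> 'v \<Rightarrow> bool"
  where "has_dir_deriv T f x h L \<longleftrightarrow>
    limitin T (\<lambda>t. (1 / t) *\<^sub>R (f (x + t *\<^sub>R h) - f x)) L (at (0::real))"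

definition dir_deriv :: "'v::real_vector topology \<Rightarrow> ('v \<Rightarrow> 'v) \<Rightarrow> 'v \<Rightarrow> 'v \<Rightarrow> 'v"
  where "dir_deriv T f x h = (THE L. has_dir_deriv T f x h L)"

primrec iter_dir_deriv ::
  "'v::real_vector topology \<Rightarrow> ('v \<Rightarrow> 'v) \<Rightarrow> 'v list \<Rightarrow> 'v \<Rightarrow> 'v"
  where
    "iter_dir_deriv T f [] = f"
  | "iter_dir_deriv T f (h # hs) = (\<lambda>x. dir_deriv T (iter_dir_deriv T f hs) x h)"

definition smooth_map ::
  "'v::real_vector topology \<Rightarrow> 'v set \<Rightarrow> 'v set \<Rightarrow> ('v \<Rightarrow> 'v) \<Rightarrow> bool"
  where "smooth_map T E V f \<longleftrightarrow>
    openin (subtopology T E) V \<and> f ` V \<subseteq> topspace T \<and>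
    (\<forall>hs. set hs \<subseteq> E \<longrightarrow> (\<forall>h\<in>E. \<forall>x\<in>V. \<exists>L. has_dir_deriv T (iter_dir_deriv T f hs) x h L)) \<and>
    (\<forall>k::nat. continuous_map
      (prod_topology (subtopology T V) (product_topology (\<lambda>_. subtopology T E) {..<k})) T
      (\<lambda>(x, h). iter_dir_deriv T f (map h [0..<k]) x))"

definition complex_model :: "'v::real_vector topology \<Rightarrow> 'v set \<Rightarrow> ('v \<Rightarrow> 'v) \<Rightarrow> bool"
  where "complex_model T E I \<longleftrightarrow>
    subspace E \<and> closedin T E \<and> I ` E \<subseteq> E \<and>
    (\<forall>h\<in>E. \<forall>k\<in>E. \<forall>a b. I (a *\<^sub>R h + b *\<^sub>R k) = a *\<^sub>R I h + b *\<^sub>R I k) \<and>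
    (\<forall>h\<in>E. I (I h) = - h) \<and>
    continuous_map (subtopology T E) (subtopology T E) I"

definition holomorphic_map ::
  "'v::real_vector topology \<Rightarrow> 'v set \<Rightarrow> ('v \<Rightarrow> 'v) \<Rightarrow> 'v set \<Rightarrow> ('v \<Rightarrow> 'v) \<Rightarrow>
    'v set \<Rightarrow> ('v \<Rightarrow> 'v) \<Rightarrow> bool"
  where "holomorphic_map T E I F I' V f \<longleftrightarrow>
    smooth_map T E V f \<and> f ` V \<subseteq> F \<and>
    (\<forall>x\<in>V. \<forall>h\<in>E. dir_deriv T f x (I h) = I' (dir_deriv T f x h))"

text \<open>
  A chart of a subset \<open>S\<close> of the space: its domain, the coordinate map, the model space and the
  complex structure of the model space.
\<close>

datatype 'v cchart =
  CChart (cdom: "'v set") (cmap: "'v \<Rightarrow> 'v") (cmodel: "'v set") (cstr: "'v \<Rightarrow> 'v")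

definition cimg :: "'v cchart \<Rightarrow> 'v set"
  where "cimg c = cmap c ` cdom c"

definition cinv :: "'v cchart \<Rightarrow> 'v \<Rightarrow> 'v"
  where "cinv c = inv_into (cdom c) (cmap c)"

text \<open>
  The smooth structure of \<open>S\<close> is the one it has as a submanifold: a map into \<open>S\<close> is smooth if it is
  smooth as a map into the ambient space, and a map on an open part of \<open>S\<close> is smooth if it extends
  locally to a smooth map on an open subset of the ambient space.
\<close>

definition smooth_chart :: "'v::real_vector topology \<Rightarrow> 'v set \<Rightarrow> 'v cchart \<Rightarrow> bool"
  where "smooth_chart T S c \<longleftrightarrow>
    complex_model T (cmodel c) (cstr c) \<and>
    openin (subtopology T S) (cdom c) \<and>
    openin (subtopology T (cmodel c)) (cimg c) \<and>
    homeomorphic_map (subtopology T (cdom c)) (subtopology T (cimg c)) (cmap c) \<and>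
    smooth_map T (cmodel c) (cimg c) (cinv c) \<and>
    (\<forall>x\<in>cdom c. \<exists>W f. x \<in> W \<and> smooth_map T (topspace T) W f \<and>
      (\<forall>y \<in> W \<inter> cdom c. f y = cmap c y))"

definition holomorphic_transition ::
  "'v::real_vector topology \<Rightarrow> 'v cchart \<Rightarrow> 'v cchart \<Rightarrow> bool"
  where "holomorphic_transition T c d \<longleftrightarrow>
    holomorphic_map T (cmodel c) (cstr c) (cmodel d) (cstr d)
      (cmap c ` (cdom c \<inter> cdom d)) (cmap d \<circ> cinv c)"

definition complex_atlas :: "'v::real_vector topology \<Rightarrow> 'v set \<Rightarrow> 'v cchart set \<Rightarrow> bool"
  where "complex_atlas T S \<C> \<longleftrightarrow>
    (\<forall>c\<in>\<C>. smooth_chart T S c) \<and> (\<Union>c\<in>\<C>. cdom c) = S \<and>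
    (\<forall>c\<in>\<C>. \<forall>d\<in>\<C>. holomorphic_transition T c d)"

definition complex_structure_of ::
  "'v::real_vector topology \<Rightarrow> 'v set \<Rightarrow> 'v cchart set \<Rightarrow> 'v cchart set"
  where "complex_structure_of T S \<C> =
    {c. smooth_chart T S c \<and>
      (\<forall>d\<in>\<C>. holomorphic_transition T c d \<and> holomorphic_transition T d c)}"

definition complex_structure :: "'v::real_vector topology \<Rightarrow> 'v set \<Rightarrow> 'v cchart set \<Rightarrow> bool"
  where "complex_structure T S \<C> \<longleftrightarrow>
    complex_atlas T S \<C> \<and> complex_structure_of T S \<C> \<subseteq> \<C>"

text \<open>
  \<open>TS x\<close> is the tangent space of \<open>S\<close> at \<open>x\<close> and \<open>JJ x\<close> an endomorphism of it. The atlas induces \<open>JJ\<close>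
  if the differential of each parametrization is an isomorphism from the model space onto the
  tangent space and carries the complex structure of the model to \<open>JJ\<close>.
\<close>

definition induces ::
  "'v::real_vector topology \<Rightarrow> ('v \<Rightarrow> 'v set) \<Rightarrow> 'v cchart set \<Rightarrow> ('v \<Rightarrow> 'v \<Rightarrow> 'v) \<Rightarrow> bool"
  where "induces T TS \<C> JJ \<longleftrightarrow>
    (\<forall>c\<in>\<C>. \<forall>v\<in>cimg c.
      bij_betw (dir_deriv T (cinv c) v) (cmodel c) (TS (cinv c v)) \<and>
      (\<forall>h\<in>cmodel c.
        dir_deriv T (cinv c) v (cstr c h) = JJ (cinv c v) (dir_deriv T (cinv c) v h)))"

definition integrable_acs ::
  "'v::real_vector topology \<Rightarrow> 'v set \<Rightarrow> ('v \<Rightarrow> 'v set) \<Rightarrow> ('v \<Rightarrow> 'v \<Rightarrow> 'v) \<Rightarrow> bool"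
  where "integrable_acs T S TS JJ \<longleftrightarrow> (\<exists>\<C>. complex_atlas T S \<C> \<and> induces T TS \<C> JJ)"


section \<open>Closed oriented manifolds and their tangent spaces\<close>

text \<open>\<open>iter_deriv vs f\<close> is only meaningful in the interior of the set where \<open>f\<close> is smooth.\<close>

primrec iter_deriv ::
  "'a list \<Rightarrow> ('a::real_normed_vector \<Rightarrow> 'b::real_normed_vector) \<Rightarrow> 'a \<Rightarrow> 'b"
  where
    "iter_deriv [] f = f"
  | "iter_deriv (v # vs) f = (\<lambda>x. frechet_derivative (iter_deriv vs f) (at x) v)"

definition smooth_on ::
  "'a::real_normed_vector set \<Rightarrow> ('a \<Rightarrow> 'b::real_normed_vector) \<Rightarrow> bool"
  where "smooth_on S f \<longleftrightarrow> open S \<and> (\<forall>vs. \<forall>x\<in>S. iter_deriv vs f differentiable (at x))"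

type_synonym ('m, 'd) chart = "'m set \<times> ('m \<Rightarrow> real ^ 'd)"

definition chart_inv :: "('m, 'd::finite) chart \<Rightarrow> real ^ 'd \<Rightarrow> 'm"
  where "chart_inv c = inv_into (fst c) (snd c)"

definition transition ::
  "('m, 'd::finite) chart \<Rightarrow> ('m, 'd) chart \<Rightarrow> real ^ 'd \<Rightarrow> real ^ 'd"
  where "transition c d = snd d \<circ> chart_inv c"

definition closed_oriented_manifold :: "('m::t2_space, 'd::finite) chart set \<Rightarrow> bool"
  where "closed_oriented_manifold \<M> \<longleftrightarrow>
    compact (UNIV :: 'm set) \<and> (\<Union>c\<in>\<M>. fst c) = UNIV \<and>
    (\<forall>c\<in>\<M>. open (fst c) \<and> open (snd c ` fst c) \<and>
      homeomorphism (fst c) (snd c ` fst c) (snd c) (chart_inv c)) \<and>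
    (\<forall>c\<in>\<M>. \<forall>d\<in>\<M>. smooth_on (snd c ` (fst c \<inter> fst d)) (transition c d) \<and>
      (\<forall>y \<in> snd c ` (fst c \<inter> fst d).
        det (matrix (frechet_derivative (transition c d) (at y))) > 0))"

text \<open>
  A tangent vector at \<open>p\<close> is the family of its components in the charts around \<open>p\<close>; it is extended by
  \<open>0\<close> to the other arguments, so that equality of tangent vectors is equality of functions.
\<close>

type_synonym ('m, 'd) tvec = "('m, 'd) chart \<Rightarrow> real ^ 'd"

definition tangent_space :: "('m, 'd::finite) chart set \<Rightarrow> 'm \<Rightarrow> ('m, 'd) tvec set"
  where "tangent_space \<M> p = {v.
    (\<forall>c\<in>\<M>. \<forall>d\<in>\<M>. p \<in> fst c \<and> p \<in> fst d \<longrightarrow>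
      v d = frechet_derivative (transition c d) (at (snd c p)) (v c)) \<and>
    (\<forall>c. \<not> (c \<in> \<M> \<and> p \<in> fst c) \<longrightarrow> v c = 0)}"

definition tvec_of ::
  "('m, 'd::finite) chart set \<Rightarrow> ('m, 'd) chart \<Rightarrow> 'm \<Rightarrow> real ^ 'd \<Rightarrow> ('m, 'd) tvec"
  where "tvec_of \<M> c p w = (\<lambda>d. if d \<in> \<M> \<and> p \<in> fst d
    then frechet_derivative (transition c d) (at (snd c p)) w else 0)"


section \<open>Endomorphism fields\<close>

text \<open>An endomorphism of \<open>tangent_space \<M> p\<close> is extended by \<open>0\<close> outside that space.\<close>

type_synonym ('m, 'd) field = "'m \<Rightarrow> ('m, 'd) tvec \<Rightarrow> ('m, 'd) tvec"

definition local_matrix ::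
  "('m, 'd::finite) chart set \<Rightarrow> ('m, 'd) chart \<Rightarrow> ('m, 'd) field \<Rightarrow> real ^ 'd \<Rightarrow> real ^ 'd ^ 'd"
  where "local_matrix \<M> c K = (\<lambda>y. let p = chart_inv c y in
    matrix (\<lambda>w. K p (tvec_of \<M> c p w) c))"

definition smooth_fields :: "('m, 'd::finite) chart set \<Rightarrow> ('m, 'd) field set"
  where "smooth_fields \<M> = {K.
    (\<forall>p. K p ` tangent_space \<M> p \<subseteq> tangent_space \<M> p \<and>
      (\<forall>v\<in>tangent_space \<M> p. \<forall>w\<in>tangent_space \<M> p. \<forall>a b.
        K p (a *\<^sub>R v + b *\<^sub>R w) = a *\<^sub>R K p v + b *\<^sub>R K p w) \<and>
      (\<forall>v. v \<notin> tangent_space \<M> p \<longrightarrow> K p v = 0)) \<and>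
    (\<forall>c\<in>\<M>. smooth_on (snd c ` fst c) (local_matrix \<M> c K))}"

text \<open>
  The \<open>C\<^sup>\<infinity>\<close> topology: uniform convergence of all partial derivatives of the local matrices on
  compact subsets of the chart images.
\<close>

definition Cinf_topology :: "('m, 'd::finite) chart set \<Rightarrow> ('m, 'd) field topology"
  where "Cinf_topology \<M> = topology_generated_by
    {{L \<in> smooth_fields \<M>.
        \<forall>y\<in>C. norm (iter_deriv vs (local_matrix \<M> c (L - K)) y) < \<epsilon>}
     | K c C vs \<epsilon>. K \<in> smooth_fields \<M> \<and> c \<in> \<M> \<and> compact C \<and> C \<subseteq> snd c ` fst c \<and> (\<epsilon>::real) > 0}"

definition id_field :: "('m, 'd::finite) chart set \<Rightarrow> ('m, 'd) field"
  where "id_field \<M> = (\<lambda>p v. if v \<in> tangent_space \<M> p then v else 0)"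

definition field_comp :: "('m, 'd) field \<Rightarrow> ('m, 'd) field \<Rightarrow> ('m, 'd) field"  (infixl \<open>\<odot>\<close> 70)
  where "K \<odot> L = (\<lambda>p. K p \<circ> L p)"

definition inverse_fields ::
  "('m, 'd::finite) chart set \<Rightarrow> ('m, 'd) field \<Rightarrow> ('m, 'd) field \<Rightarrow> bool"
  where "inverse_fields \<M> K L \<longleftrightarrow> K \<in> smooth_fields \<M> \<and> L \<in> smooth_fields \<M> \<and>
    K \<odot> L = id_field \<M> \<and> L \<odot> K = id_field \<M>"

definition invertible_field :: "('m, 'd::finite) chart set \<Rightarrow> ('m, 'd) field \<Rightarrow> bool"
  where "invertible_field \<M> K \<longleftrightarrow> (\<exists>L. inverse_fields \<M> K L)"

definition field_inv :: "('m, 'd::finite) chart set \<Rightarrow> ('m, 'd) field \<Rightarrow> ('m, 'd) field"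
  where "field_inv \<M> K = (THE L. inverse_fields \<M> K L)"


section \<open>The space of almost complex structures\<close>

definition acs_space :: "('m, 'd::finite) chart set \<Rightarrow> ('m, 'd) field set"
  where "acs_space \<M> = {J \<in> smooth_fields \<M>. J \<odot> J = - id_field \<M>}"

definition End_anti :: "('m, 'd::finite) chart set \<Rightarrow> ('m, 'd) field \<Rightarrow> ('m, 'd) field set"
  where "End_anti \<M> J = {K \<in> smooth_fields \<M>. J \<odot> K + K \<odot> J = 0}"

definition acs_J :: "('m, 'd) field \<Rightarrow> ('m, 'd) field \<Rightarrow> ('m, 'd) field"
  where "acs_J J A = A \<odot> J"

definition acs_U :: "('m, 'd::finite) chart set \<Rightarrow> ('m, 'd) field \<Rightarrow> ('m, 'd) field set"
  where "acs_U \<M> J0 = {J \<in> acs_space \<M>. invertible_field \<M> (id_field \<M> - J \<odot> J0)}"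

definition acs_V :: "('m, 'd::finite) chart set \<Rightarrow> ('m, 'd) field \<Rightarrow> ('m, 'd) field set"
  where "acs_V \<M> J0 = {K \<in> End_anti \<M> J0. invertible_field \<M> (id_field \<M> - K)}"

definition acs_Phi ::
  "('m, 'd::finite) chart set \<Rightarrow> ('m, 'd) field \<Rightarrow> ('m, 'd) field \<Rightarrow> ('m, 'd) field"
  where "acs_Phi \<M> J0 J = field_inv \<M> (id_field \<M> - J \<odot> J0) \<odot> (id_field \<M> + J \<odot> J0)"

definition Phi_atlas :: "('m, 'd::finite) chart set \<Rightarrow> ('m, 'd) field cchart set"
  where "Phi_atlas \<M> =
    {CChart (acs_U \<M> J0) (acs_Phi \<M> J0) (End_anti \<M> J0) (\<lambda>A. A \<odot> J0) | J0. J0 \<in> acs_space \<M>}"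

end

theory Submission
  imports Defs
begin

text \<open>
  The smooth endomorphism fields form a locally convex algebra in which the invertible elements are an
  open set with continuous inversion (compactness of the manifold gives openness), and nothing else
  about them is needed. For such an algebra the chart is a Cayley transform: its inverse is
  \<open>J\<^sub>K = (1 - K) J\<^sub>0 (1 - K)\<^sup>-\<^sup>1\<close>, with differential \<open>h \<mapsto> (J\<^sub>0 + J\<^sub>K) h (1 - K)\<^sup>-\<^sup>1\<close>. Since
  \<open>(1 - K)\<^sup>-\<^sup>1 J\<^sub>K = J\<^sub>0 (1 - K)\<^sup>-\<^sup>1\<close>, the differential turns \<open>h \<mapsto> h J\<^sub>0\<close> into \<open>A \<mapsto> A J\<^sub>K\<close>, and it is an
  isomorphism onto the fields anticommuting with \<open>J\<^sub>K\<close> because \<open>J\<^sub>0 + J\<^sub>K = (1 - J\<^sub>K J\<^sub>0) J\<^sub>0\<close> is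
  invertible. Two smooth charts which induce the same almost complex structure are holomorphically
  compatible, and a chart compatible with an inducing atlas induces the structure too; hence the
  complex structure generated by the Cayley charts consists exactly of the inducing charts and is the
  only one inducing the given almost complex structure.
\<close>

section \<open>Limits in a topological vector space given by seminorms\<close>

text \<open>The obstacle is the calculus. The fields form only a locally convex space: no single
  norm controls all derivatives, and directional derivatives taken one point at a time need not be
  additive in the direction nor obey a chain rule. The substitute for Banach space estimates is the
  joint continuity required by \<open>smooth_map\<close>, combined with a mean value inequality for
  each seminorm separately: difference quotients then converge even when base point, direction and
  step all move. This gives the chain rule in all orders. It is needed for arbitrary smooth charts
  and not just for Cayley charts, since a \<open>complex_structure\<close> is maximal and its charts
  are known only through their smoothness and their differentials. No inverse function theorem
  enters, because every differential that has to be bijective comes with an explicit inverse.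
  Writing the inverse chart as a conjugate of \<open>J0\<close> makes its square \<open>-1\<close>
  at once, and the relation \<open>z J0 = J_K z\<close> with \<open>z = 1 - K\<close> carries all
  later identities.\<close>

locale seminormed_space =
  fixes T :: "'v::real_vector topology" and P :: "('v \<Rightarrow> real) set"
  assumes subspace_topspace: "subspace (topspace T)"
    and sn_add: "\<lbrakk>p \<in> P; x \<in> topspace T; y \<in> topspace T\<rbrakk> \<Longrightarrow> p (x + y) \<le> p x + p y"
    and sn_scale: "\<lbrakk>p \<in> P; x \<in> topspace T\<rbrakk> \<Longrightarrow> p (a *\<^sub>R x) = \<bar>a\<bar> * p x"
    and sn_separates: "\<lbrakk>x \<in> topspace T; \<And>p. p \<in> P \<Longrightarrow> p x = 0\<rbrakk> \<Longrightarrow> x = 0"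
    and openin_iff: "openin T U \<longleftrightarrow> U \<subseteq> topspace T \<and>
      (\<forall>x\<in>U. \<exists>F \<epsilon>. finite F \<and> F \<subseteq> P \<and> \<epsilon> > 0 \<and> {y \<in> topspace T. \<forall>p\<in>F. p (y - x) < \<epsilon>} \<subseteq> U)"
begin

abbreviation X where "X \<equiv> topspace T"

lemma in_X [simp, intro]:
  "0 \<in> X" "\<lbrakk>x \<in> X; y \<in> X\<rbrakk> \<Longrightarrow> x + y \<in> X" "\<lbrakk>x \<in> X; y \<in> X\<rbrakk> \<Longrightarrow> x - y \<in> X"
  "x \<in> X \<Longrightarrow> a *\<^sub>R x \<in> X" "x \<in> X \<Longrightarrow> - x \<in> X"
  using subspace_topspace
  by (auto simp: subspace_0 subspace_add subspace_diff subspace_scale subspace_neg)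

lemma sn_zero: "p \<in> P \<Longrightarrow> p 0 = 0"
  using sn_scale[of p 0 0] by simp

lemma sn_minus: "\<lbrakk>p \<in> P; x \<in> X\<rbrakk> \<Longrightarrow> p (- x) = p x"
  using sn_scale[of p x "-1"] by simp

lemma sn_nonneg: "\<lbrakk>p \<in> P; x \<in> X\<rbrakk> \<Longrightarrow> 0 \<le> p x"
  using sn_add[of p x "- x"] sn_minus[of p x] sn_zero[of p] by simp

lemma sn_diff_commute: "\<lbrakk>p \<in> P; x \<in> X; y \<in> X\<rbrakk> \<Longrightarrow> p (x - y) = p (y - x)"
  using sn_minus[of p "x - y"] by simp

lemma sn_triangle: "\<lbrakk>p \<in> P; x \<in> X; y \<in> X; z \<in> X\<rbrakk> \<Longrightarrow> p (x - z) \<le> p (x - y) + p (y - z)"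
  using sn_add[of p "x - y" "y - z"] by simp

lemma openin_ball:
  assumes "finite F" "F \<subseteq> P" "x \<in> X"
  shows "openin T {y \<in> X. \<forall>p\<in>F. p (y - x) < \<epsilon>}"
  unfolding openin_iff
proof (intro conjI ballI)
  fix y assume y: "y \<in> {y \<in> X. \<forall>p\<in>F. p (y - x) < \<epsilon>}"
  \<comment> \<open>The distance from \<open>y\<close> to the boundary of the ball, measured in all
    seminorms of \<open>F\<close>; the inserted \<open>1\<close> keeps \<open>Min\<close> meaningful
    for empty \<open>F\<close>.\<close>
  define \<delta> where "\<delta> = Min (insert 1 ((\<lambda>p. \<epsilon> - p (y - x)) ` F))"
  have "\<delta> > 0" unfolding \<delta>_def using assms y by (subst Min_gr_iff) auto
  moreover have "{z \<in> X. \<forall>p\<in>F. p (z - y) < \<delta>} \<subseteq> {y \<in> X. \<forall>p\<in>F. p (y - x) < \<epsilon>}"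
  proof safe
    fix z p assume z: "z \<in> X" "\<forall>p\<in>F. p (z - y) < \<delta>" "p \<in> F"
    then have "p (z - y) < \<delta>" "\<delta> \<le> \<epsilon> - p (y - x)"
      using assms by (auto simp: \<delta>_def intro!: Min_le)
    moreover have "p (z - x) \<le> p (z - y) + p (y - x)"
      using sn_triangle[of p z y x] assms z y by auto
    ultimately show "p (z - x) < \<epsilon>" by simp
  qed
  ultimately show "\<exists>F' \<epsilon>'. finite F' \<and> F' \<subseteq> P \<and> \<epsilon>' > 0 \<and>
      {z \<in> X. \<forall>p\<in>F'. p (z - y) < \<epsilon>'} \<subseteq> {y \<in> X. \<forall>p\<in>F. p (y - x) < \<epsilon>}"
    using assms by blast
qed auto

text \<open>Reduces topological limits to real limits, so that later arguments are estimates for one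
  seminorm at a time. Membership in \<open>X\<close> is a separate clause because nothing is known
  about a seminorm outside \<open>X\<close>.\<close>

lemma limitin_iff:
  "limitin T f l F \<longleftrightarrow> l \<in> X \<and> (\<forall>\<^sub>F i in F. f i \<in> X) \<and> (\<forall>p\<in>P. ((\<lambda>i. p (f i - l)) \<longlongrightarrow> 0) F)"
proof (intro iffI conjI ballI)
  assume L: "limitin T f l F"
  then show l: "l \<in> X" by (rule limitin_topspace)
  show ev: "\<forall>\<^sub>F i in F. f i \<in> X" using L limitinD[OF L openin_topspace] l by auto
  fix p assume p: "p \<in> P"
  show "((\<lambda>i. p (f i - l)) \<longlongrightarrow> 0) F"
  proof (rule tendstoI)
    fix e :: real assume "e > 0"
    have "\<forall>\<^sub>F i in F. f i \<in> {y \<in> X. \<forall>q\<in>{p}. q (y - l) < e}"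
      using p l \<open>e > 0\<close> by (intro limitinD[OF L] openin_ball) (auto simp: sn_zero)
    then show "\<forall>\<^sub>F i in F. dist (p (f i - l)) 0 < e"
      by eventually_elim (use p l in \<open>auto simp: sn_nonneg\<close>)
  qed
next
  assume A: "l \<in> X \<and> (\<forall>\<^sub>F i in F. f i \<in> X) \<and> (\<forall>p\<in>P. ((\<lambda>i. p (f i - l)) \<longlongrightarrow> 0) F)"
  show "limitin T f l F"
    unfolding limitin_def
  proof (intro conjI allI impI)
    fix U assume U: "openin T U \<and> l \<in> U"
    then obtain Q \<epsilon> where Q: "finite Q" "Q \<subseteq> P" "\<epsilon> > 0" "{y \<in> X. \<forall>p\<in>Q. p (y - l) < \<epsilon>} \<subseteq> U"
      unfolding openin_iff by blast
    have "\<forall>\<^sub>F i in F. \<forall>p\<in>Q. p (f i - l) < \<epsilon>"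
    proof (rule eventually_ball_finite[OF Q(1)], rule ballI)
      fix p assume "p \<in> Q"
      with A Q have "((\<lambda>i. p (f i - l)) \<longlongrightarrow> 0) F" by blast
      then show "\<forall>\<^sub>F i in F. p (f i - l) < \<epsilon>" using Q(3) by (rule order_tendstoD)
    qed
    moreover have "\<forall>\<^sub>F i in F. f i \<in> X" using A by blast
    ultimately show "\<forall>\<^sub>F i in F. f i \<in> U" by eventually_elim (use Q in auto)
  qed (use A in auto)
qed

lemma limitin_null_I:
  assumes "l \<in> X" "\<forall>\<^sub>F i in F. f i \<in> X" "\<And>p. p \<in> P \<Longrightarrow> ((\<lambda>i. g p i) \<longlongrightarrow> 0) F"
    "\<And>p. p \<in> P \<Longrightarrow> \<forall>\<^sub>F i in F. p (f i - l) \<le> g p i"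
  shows "limitin T f l F"
  unfolding limitin_iff
proof (intro conjI ballI assms)
  fix p assume p: "p \<in> P"
  show "((\<lambda>i. p (f i - l)) \<longlongrightarrow> 0) F"
  proof (rule tendsto_sandwich[OF _ assms(4)[OF p] tendsto_const assms(3)[OF p]])
    show "\<forall>\<^sub>F i in F. 0 \<le> p (f i - l)"
      using assms(2) by eventually_elim (use p assms(1) in \<open>auto intro: sn_nonneg\<close>)
  qed
qed

text \<open>Two points at positive distance in one seminorm are separated by balls of half that
  radius. Uniqueness of limits is what makes the definite description in \<open>dir_deriv\<close>
  meaningful.\<close>

lemma Hausdorff: "Hausdorff_space T"
  unfolding Hausdorff_space_def
proof (intro allI impI)
  fix x y assume xy: "x \<in> X \<and> y \<in> X \<and> x \<noteq> y"
  then have "x - y \<in> X" "x - y \<noteq> 0" by auto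
  then obtain p where p: "p \<in> P" "p (x - y) \<noteq> 0" using sn_separates by blast
  define e where "e = p (x - y) / 2"
  have e: "e > 0" using sn_nonneg[OF p(1), of "x - y"] p xy by (auto simp: e_def)
  define U where "U z = {w \<in> X. \<forall>q\<in>{p}. q (w - z) < e}" for z
  have "openin T (U x)" "openin T (U y)" unfolding U_def using xy p by (blast intro: openin_ball)+
  moreover have "x \<in> U x" "y \<in> U y" using e xy p by (auto simp: U_def sn_zero)
  moreover have "disjnt (U x) (U y)"
  proof (clarsimp simp: disjnt_iff U_def)
    fix w assume w: "w \<in> X" "p (w - x) < e" "p (w - y) < e"
    have "p (x - y) \<le> p (x - w) + p (w - y)" using sn_triangle p w xy by blast
    with w sn_diff_commute[of p x w] p xy show False unfolding e_def by simp
  qed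
  ultimately show "\<exists>U V. openin T U \<and> openin T V \<and> x \<in> U \<and> y \<in> V \<and> disjnt U V" by blast
qed

lemma limitin_unique: "\<lbrakk>limitin T f l F; limitin T f l' F; F \<noteq> bot\<rbrakk> \<Longrightarrow> l = l'"
  by (rule limitin_Hausdorff_unique[OF _ _ _ Hausdorff])

lemma limitin_add:
  assumes "limitin T f a F" "limitin T g b F"
  shows "limitin T (\<lambda>i. f i + g i) (a + b) F"
proof -
  have evs: "\<forall>\<^sub>F i in F. f i \<in> X" "\<forall>\<^sub>F i in F. g i \<in> X" and ab: "a \<in> X" "b \<in> X"
    using assms by (auto simp: limitin_iff)
  show ?thesis
  proof (rule limitin_null_I[where g="\<lambda>p i. p (f i - a) + p (g i - b)"])
    show "\<forall>\<^sub>F i in F. f i + g i \<in> X" using evs by eventually_elim simp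
    fix p assume p: "p \<in> P"
    show "((\<lambda>i. p (f i - a) + p (g i - b)) \<longlongrightarrow> 0) F"
      using assms p by (auto simp: limitin_iff intro!: tendsto_add_zero)
    show "\<forall>\<^sub>F i in F. p (f i + g i - (a + b)) \<le> p (f i - a) + p (g i - b)"
      using evs
    proof eventually_elim
      case (elim i)
      then show ?case using sn_add[OF p, of "f i - a" "g i - b"] ab by (simp add: algebra_simps)
    qed
  qed (use ab in auto)
qed

lemma limitin_scale:
  assumes "limitin T f a F" "(c \<longlongrightarrow> r) F"
  shows "limitin T (\<lambda>i. c i *\<^sub>R f i) (r *\<^sub>R a) F"
proof -
  have evs: "\<forall>\<^sub>F i in F. f i \<in> X" and ab: "a \<in> X"
    using assms by (auto simp: limitin_iff)
  show ?thesis
  proof (rule limitin_null_I[where g="\<lambda>p i. \<bar>c i\<bar> * p (f i - a) + \<bar>c i - r\<bar> * p a"])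
    show "\<forall>\<^sub>F i in F. c i *\<^sub>R f i \<in> X" using evs by eventually_elim simp
    fix p assume p: "p \<in> P"
    have "((\<lambda>i. p (f i - a)) \<longlongrightarrow> 0) F" using assms p by (auto simp: limitin_iff)
    then have "((\<lambda>i. \<bar>c i\<bar> * p (f i - a) + \<bar>c i - r\<bar> * p a) \<longlongrightarrow> \<bar>r\<bar> * 0 + \<bar>r - r\<bar> * p a) F"
      by (intro tendsto_intros assms)
    then show "((\<lambda>i. \<bar>c i\<bar> * p (f i - a) + \<bar>c i - r\<bar> * p a) \<longlongrightarrow> 0) F" by simp
    show "\<forall>\<^sub>F i in F. p (c i *\<^sub>R f i - r *\<^sub>R a) \<le> \<bar>c i\<bar> * p (f i - a) + \<bar>c i - r\<bar> * p a"
      using evs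
    proof eventually_elim
      case (elim i)
      have "c i *\<^sub>R f i - r *\<^sub>R a = c i *\<^sub>R (f i - a) + (c i - r) *\<^sub>R a" by (simp add: algebra_simps)
      then show ?case
        using sn_add[OF p, of "c i *\<^sub>R (f i - a)" "(c i - r) *\<^sub>R a"] elim ab
        by (simp add: sn_scale[OF p])
    qed
  qed (use ab in auto)
qed

lemma limitin_scale_const: "limitin T f a F \<Longrightarrow> limitin T (\<lambda>i. r *\<^sub>R f i) (r *\<^sub>R a) F"
  by (rule limitin_scale) auto

lemma limitin_minus: "limitin T f a F \<Longrightarrow> limitin T (\<lambda>i. - f i) (- a) F"
  using limitin_scale_const[of f a F "-1"] by simp

lemma limitin_diff:
  "\<lbrakk>limitin T f a F; limitin T g b F\<rbrakk> \<Longrightarrow> limitin T (\<lambda>i. f i - g i) (a - b) F"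
  using limitin_add[OF _ limitin_minus, of f a F g b] by simp

lemma limitin_filter_compose:
  "\<lbrakk>limitin S f a F; filterlim g F G\<rbrakk> \<Longrightarrow> limitin S (\<lambda>i. f (g i)) a G"
  by (auto simp: limitin_def filterlim_iff)

lemma continuous_add:
  "\<lbrakk>continuous_map Y T f; continuous_map Y T g\<rbrakk> \<Longrightarrow> continuous_map Y T (\<lambda>z. f z + g z)"
  unfolding continuous_map_atin by (auto intro: limitin_add)

lemma continuous_scale:
  "continuous_map Y T f \<Longrightarrow> continuous_map Y T (\<lambda>z. r *\<^sub>R f z)"
  unfolding continuous_map_atin by (auto intro: limitin_scale_const)

lemma continuous_diff:
  "\<lbrakk>continuous_map Y T f; continuous_map Y T g\<rbrakk> \<Longrightarrow> continuous_map Y T (\<lambda>z. f z - g z)"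
  unfolding continuous_map_atin by (auto intro: limitin_diff)

text \<open>Additivity over adjacent intervals and bisection reduce the bound to a single point.\<close>

lemma mean_value_seminorm:
  fixes \<gamma> :: "real \<Rightarrow> 'v"
  assumes p: "p \<in> P" and inX: "\<And>t. \<lbrakk>a \<le> t; t \<le> b\<rbrakk> \<Longrightarrow> \<gamma> t \<in> X" and "a \<le> b"
    and der: "\<And>t. \<lbrakk>a \<le> t; t \<le> b\<rbrakk> \<Longrightarrow> limitin T (\<lambda>s. (1 / s) *\<^sub>R (\<gamma> (t + s) - \<gamma> t)) (D t) (at 0)"
    and bound: "\<And>t. \<lbrakk>a \<le> t; t \<le> b\<rbrakk> \<Longrightarrow> p (D t) \<le> M"
  shows "p (\<gamma> b - \<gamma> a) \<le> M * (b - a)"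
proof (rule field_le_epsilon)
  fix e0 :: real assume "e0 > 0"
  \<comment> \<open>The summand \<open>1\<close> avoids division by zero when \<open>a = b\<close>
    and still gives \<open>e * (b - a) \<le> e0\<close>.\<close>
  define e where "e = e0 / (b - a + 1)"
  have e: "e > 0" using \<open>e0 > 0\<close> \<open>a \<le> b\<close> by (simp add: e_def)
  have "a \<le> a \<and> b \<le> b \<longrightarrow> p (\<gamma> b - \<gamma> a) \<le> (M + e) * (b - a)"
  proof (rule Bolzano[OF \<open>a \<le> b\<close>, of "\<lambda>c d. a \<le> c \<and> d \<le> b \<longrightarrow> p (\<gamma> d - \<gamma> c) \<le> (M + e) * (d - c)"], intro impI)
    fix c d f assume 1: "a \<le> c \<and> d \<le> b \<longrightarrow> p (\<gamma> d - \<gamma> c) \<le> (M + e) * (d - c)"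
      "a \<le> d \<and> f \<le> b \<longrightarrow> p (\<gamma> f - \<gamma> d) \<le> (M + e) * (f - d)" "c \<le> d" "d \<le> f" "a \<le> c \<and> f \<le> b"
    then have "p (\<gamma> f - \<gamma> c) \<le> p (\<gamma> f - \<gamma> d) + p (\<gamma> d - \<gamma> c)"
      by (intro sn_triangle p inX) auto
    with 1 show "p (\<gamma> f - \<gamma> c) \<le> (M + e) * (f - c)" by (auto simp: algebra_simps)
  next
    fix x assume x: "a \<le> x" "x \<le> b"
    have lim: "limitin T (\<lambda>s. (1 / s) *\<^sub>R (\<gamma> (x + s) - \<gamma> x)) (D x) (at 0)" by (rule der[OF x])
    then have DX: "D x \<in> X" by (rule limitin_topspace)
    have "\<forall>\<^sub>F s in at 0. p ((1 / s) *\<^sub>R (\<gamma> (x + s) - \<gamma> x) - D x) < e"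
      using lim p e by (auto simp: limitin_iff intro: order_tendstoD)
    then obtain d where d: "d > 0" and dd: "\<And>s. \<lbrakk>s \<noteq> 0; dist s 0 < d\<rbrakk> \<Longrightarrow>
        p ((1 / s) *\<^sub>R (\<gamma> (x + s) - \<gamma> x) - D x) < e"
      unfolding eventually_at by auto
    have key: "p (\<gamma> y - \<gamma> x) \<le> (M + e) * \<bar>y - x\<bar>" if y: "a \<le> y" "y \<le> b" "\<bar>y - x\<bar> < d" for y
    proof (cases "y = x")
      case False
      define s where "s = y - x"
      have s: "s \<noteq> 0" "\<bar>s\<bar> < d" "y = x + s" using False y by (auto simp: s_def)
      have X2: "(1 / s) *\<^sub>R (\<gamma> y - \<gamma> x) \<in> X" "\<gamma> y - \<gamma> x \<in> X" using inX x y by auto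
      have "p ((1 / s) *\<^sub>R (\<gamma> y - \<gamma> x)) \<le> p ((1 / s) *\<^sub>R (\<gamma> y - \<gamma> x) - D x) + p (D x)"
        using sn_add[OF p, of "(1 / s) *\<^sub>R (\<gamma> y - \<gamma> x) - D x" "D x"] X2 DX by auto
      also have "\<dots> \<le> e + M" using dd[of s] s bound[OF x] by auto
      finally have "p (\<gamma> y - \<gamma> x) / \<bar>s\<bar> \<le> M + e" using X2 by (simp add: sn_scale[OF p])
      then show ?thesis using s by (simp add: field_simps flip: s_def)
    qed (auto simp: sn_zero[OF p])
    show "\<exists>d>0. \<forall>c f. c \<le> x \<and> x \<le> f \<and> f - c < d \<longrightarrow>
        a \<le> c \<and> f \<le> b \<longrightarrow> p (\<gamma> f - \<gamma> c) \<le> (M + e) * (f - c)"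
    \<comment> \<open>An interval around \<open>x\<close> is cut at \<open>x\<close>, so that both
      pieces are increments from the one point where the difference quotient is controlled.\<close>
    proof (intro exI[of _ d] conjI allI impI d)
      fix c f assume 1: "c \<le> x \<and> x \<le> f \<and> f - c < d" "a \<le> c \<and> f \<le> b"
      have "p (\<gamma> f - \<gamma> c) \<le> p (\<gamma> f - \<gamma> x) + p (\<gamma> x - \<gamma> c)"
        using 1 x by (intro sn_triangle p inX) auto
      also have "p (\<gamma> x - \<gamma> c) = p (\<gamma> c - \<gamma> x)"
        using 1 x by (intro sn_diff_commute p inX) auto
      finally show "p (\<gamma> f - \<gamma> c) \<le> (M + e) * (f - c)"
        using key[of f] key[of c] 1 x by (auto simp: algebra_simps)
    qed
  qed
  moreover have "e * (b - a) \<le> e0" using \<open>a \<le> b\<close> \<open>e0 > 0\<close>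
    by (simp add: e_def field_simps)
  ultimately show "p (\<gamma> b - \<gamma> a) \<le> M * (b - a) + e0" by (simp add: algebra_simps)
qed

section \<open>Directional derivatives and smooth maps\<close>

lemma has_dir_deriv_unique:
  "\<lbrakk>has_dir_deriv T f x h L; has_dir_deriv T f x h L'\<rbrakk> \<Longrightarrow> L = L'"
  unfolding has_dir_deriv_def by (rule limitin_unique) auto

lemma dir_deriv_eq: "has_dir_deriv T f x h L \<Longrightarrow> dir_deriv T f x h = L"
  unfolding dir_deriv_def by (rule the_equality) (auto intro: has_dir_deriv_unique)

lemma has_dir_deriv_const: "has_dir_deriv T (\<lambda>x. c) x h 0"
  by (simp add: has_dir_deriv_def)

lemma eventually_nonzero: "\<forall>\<^sub>F t in at (0::real). t \<noteq> 0"
  by (simp add: eventually_at_filter)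

lemma has_dir_deriv_ident:
  assumes "h \<in> X"
  shows "has_dir_deriv T (\<lambda>x. x) x h h"
  unfolding has_dir_deriv_def
proof (rule limitin_eventually[OF assms])
  show "\<forall>\<^sub>F t in at 0. (1 / t) *\<^sub>R (x + t *\<^sub>R h - x) = h"
    using eventually_nonzero by eventually_elim simp
qed

lemma has_dir_deriv_add:
  assumes "has_dir_deriv T f x h L" "has_dir_deriv T g x h M"
  shows "has_dir_deriv T (\<lambda>x. f x + g x) x h (L + M)"
  using limitin_add[OF assms[unfolded has_dir_deriv_def]]
  unfolding has_dir_deriv_def by (simp add: algebra_simps)

lemma has_dir_deriv_scale:
  assumes "has_dir_deriv T f x h L"
  shows "has_dir_deriv T (\<lambda>x. r *\<^sub>R f x) x h (r *\<^sub>R L)"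
  using limitin_scale_const[OF assms[unfolded has_dir_deriv_def], of r]
  unfolding has_dir_deriv_def by (simp add: algebra_simps)

text \<open>Substitution of \<open>s * t\<close> for \<open>t\<close>, which tends to
  \<open>0\<close> through nonzero values only if \<open>s\<close> is nonzero; hence the separate
  case.\<close>

lemma has_dir_deriv_scale_dir:
  assumes "has_dir_deriv T f x h L"
  shows "has_dir_deriv T f x (s *\<^sub>R h) (s *\<^sub>R L)"
proof (cases "s = 0")
  case True
  then show ?thesis by (simp add: has_dir_deriv_def)
next
  case False
  have "((\<lambda>t. s * t) \<longlongrightarrow> s * 0) (at 0)" by (intro tendsto_intros)
  then have "filterlim (\<lambda>t. s * t) (at 0) (at 0)"
    unfolding filterlim_at using False eventually_nonzero by (auto elim: eventually_mono)
  from limitin_filter_compose[OF assms[unfolded has_dir_deriv_def] this]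
  have "limitin T (\<lambda>t. s *\<^sub>R ((1 / (s * t)) *\<^sub>R (f (x + (s * t) *\<^sub>R h) - f x))) (s *\<^sub>R L) (at 0)"
    by (rule limitin_scale_const)
  moreover have "(\<lambda>t. s *\<^sub>R ((1 / (s * t)) *\<^sub>R (f (x + (s * t) *\<^sub>R h) - f x)))
    = (\<lambda>t. (1 / t) *\<^sub>R (f (x + t *\<^sub>R s *\<^sub>R h) - f x))"
    using False by (auto simp: mult.commute)
  ultimately show ?thesis unfolding has_dir_deriv_def by (simp only:)
qed

lemma limitin_line: "\<lbrakk>x \<in> X; h \<in> X\<rbrakk> \<Longrightarrow> limitin T (\<lambda>t. x + t *\<^sub>R h) x (at 0)"
  using limitin_add[of "\<lambda>_. x" x "at 0" "\<lambda>t. t *\<^sub>R h" "0 *\<^sub>R h"] limitin_scale[of "\<lambda>_. h" h "at 0" "\<lambda>t. t" 0]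
  by simp

lemma limitin_line_subspace:
  "\<lbrakk>subspace E; E \<subseteq> X; x \<in> E; h \<in> E\<rbrakk> \<Longrightarrow> limitin (subtopology T E) (\<lambda>t. x + t *\<^sub>R h) x (at 0)"
  by (auto simp: limitin_subtopology subspace_add subspace_scale intro!: limitin_line)

lemma limitin_open_subtopology:
  assumes "openin (subtopology T E) V" "limitin (subtopology T E) u x F" "x \<in> V"
  shows "limitin (subtopology T V) u x F"
  using assms limitinD[OF assms(2,1)] by (auto simp: limitin_subtopology)

text \<open>\<open>V\<close> is open only relative to \<open>E\<close>. A direction in
  \<open>E\<close> keeps the line inside \<open>E\<close>, and this is why derivatives along
  \<open>E\<close> depend on the values on \<open>V\<close> alone.\<close>

lemma eventually_line:
  assumes "openin (subtopology T E) V" "subspace E" "E \<subseteq> X" "x \<in> V" "h \<in> E"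
  shows "\<forall>\<^sub>F t in at 0. x + t *\<^sub>R h \<in> V"
proof -
  have "x \<in> E" using assms(1,4) openin_subset by fastforce
  then show ?thesis using limitinD[OF limitin_line_subspace assms(1)] assms by blast
qed

lemma open_subtopology_mem: "\<lbrakk>openin (subtopology T E) V; x \<in> V\<rbrakk> \<Longrightarrow> x \<in> E \<and> x \<in> X"
  using openin_subset by fastforce

lemma has_dir_deriv_cong:
  assumes "openin (subtopology T E) V" "subspace E" "E \<subseteq> X" "x \<in> V" "h \<in> E"
    and "\<And>y. y \<in> V \<Longrightarrow> f y = g y"
  shows "has_dir_deriv T f x h = has_dir_deriv T g x h"
proof
  fix L
  have ev: "\<forall>\<^sub>F t in at 0. (1 / t) *\<^sub>R (f (x + t *\<^sub>R h) - f x) = (1 / t) *\<^sub>R (g (x + t *\<^sub>R h) - g x)"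
    using eventually_line[OF assms(1-5)] by eventually_elim (use assms in simp)
  then have ev': "\<forall>\<^sub>F t in at 0. (1 / t) *\<^sub>R (g (x + t *\<^sub>R h) - g x) = (1 / t) *\<^sub>R (f (x + t *\<^sub>R h) - f x)"
    by (rule eventually_mono) (rule sym)
  show "has_dir_deriv T f x h L = has_dir_deriv T g x h L"
    unfolding has_dir_deriv_def
    using limitin_transform_eventually[OF ev] limitin_transform_eventually[OF ev'] by blast
qed

lemma dir_deriv_cong:
  assumes "openin (subtopology T E) V" "subspace E" "E \<subseteq> X" "x \<in> V" "h \<in> E"
    and "\<And>y. y \<in> V \<Longrightarrow> f y = g y"
  shows "dir_deriv T f x h = dir_deriv T g x h"
  unfolding dir_deriv_def by (rule arg_cong[where f=The, OF has_dir_deriv_cong[OF assms]])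

lemma iter_dir_deriv_cong:
  assumes "openin (subtopology T E) V" "subspace E" "E \<subseteq> X"
    and "\<And>y. y \<in> V \<Longrightarrow> f y = g y" "set hs \<subseteq> E" "x \<in> V"
  shows "iter_dir_deriv T f hs x = iter_dir_deriv T g hs x"
  using assms(5,6)
proof (induction hs arbitrary: x)
  case (Cons h hs)
  then show ?case by (simp, intro dir_deriv_cong[OF assms(1-3)]) auto
qed (use assms in simp)

text \<open>
  Families of functions \<open>\<phi> h x\<close> of a point and a sequence of directions which are jointly continuous
  and closed under differentiation in the point consist of smooth maps; such families are closed
  under algebraic operations, whereas \<open>smooth_map\<close> mentions all derivatives of one map.
\<close>

definition param_topology :: "'v set \<Rightarrow> 'v set \<Rightarrow> ('v \<times> (nat \<Rightarrow> 'v)) topology"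
  where "param_topology E V = prod_topology (subtopology T V) (product_topology (\<lambda>_. subtopology T E) UNIV)"

lemma topspace_param: "\<lbrakk>V \<subseteq> X; E \<subseteq> X\<rbrakk> \<Longrightarrow> (x, h) \<in> topspace (param_topology E V) \<longleftrightarrow> x \<in> V \<and> range h \<subseteq> E"
  by (auto simp: param_topology_def)

lemma continuous_param_point: "continuous_map (param_topology E V) (subtopology T V) fst"
  unfolding param_topology_def by (rule continuous_map_fst)

lemma continuous_param_dir: "continuous_map (param_topology E V) (subtopology T E) (\<lambda>z. snd z i)"
proof -
  have "continuous_map (product_topology (\<lambda>_. subtopology T E) UNIV) (subtopology T E) (\<lambda>h. h i)"
    by (rule continuous_map_product_projection) simp
  from continuous_map_compose[OF continuous_map_snd this] show ?thesis
    unfolding param_topology_def o_def .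
qed

lemma smooth_mapI:
  assumes op: "openin (subtopology T E) V" and E: "subspace E" "E \<subseteq> X"
    and f: "(\<lambda>h. f) \<in> \<S>"
    and cont: "\<And>\<phi>. \<phi> \<in> \<S> \<Longrightarrow> continuous_map (param_topology E V) T (\<lambda>z. \<phi> (snd z) (fst z))"
    and der: "\<And>\<phi> m. \<phi> \<in> \<S> \<Longrightarrow> \<exists>\<phi>'\<in>\<S>. \<forall>x\<in>V. \<forall>h. range h \<subseteq> E \<longrightarrow> has_dir_deriv T (\<phi> h) x (h m) (\<phi>' h x)"
  shows "smooth_map T E V f"
proof -
  have VX: "V \<subseteq> X" using op open_subtopology_mem by blast
  have iter: "\<exists>\<phi>\<in>\<S>. \<forall>h. range h \<subseteq> E \<longrightarrow> (\<forall>x\<in>V. iter_dir_deriv T f (map h is) x = \<phi> h x)" for "is"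
  proof (induction "is")
    case Nil
    then show ?case using f by (intro bexI[of _ "\<lambda>h. f"]) auto
  next
    case (Cons m js)
    then obtain \<phi> where \<phi>: "\<phi> \<in> \<S>"
      "\<And>h x. \<lbrakk>range h \<subseteq> E; x \<in> V\<rbrakk> \<Longrightarrow> iter_dir_deriv T f (map h js) x = \<phi> h x" by blast
    obtain \<phi>' where \<phi>': "\<phi>' \<in> \<S>"
      "\<And>h x. \<lbrakk>range h \<subseteq> E; x \<in> V\<rbrakk> \<Longrightarrow> has_dir_deriv T (\<phi> h) x (h m) (\<phi>' h x)"
      using der[OF \<phi>(1), of m] by blast
    have "iter_dir_deriv T f (map h (m # js)) x = \<phi>' h x" if h: "range h \<subseteq> E" and x: "x \<in> V" for h x
    proof -
      have "iter_dir_deriv T f (map h (m # js)) x = dir_deriv T (\<phi> h) x (h m)"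
        using h x \<phi>(2)[OF h] by (simp, intro dir_deriv_cong[OF op E]) auto
      also have "\<dots> = \<phi>' h x" by (rule dir_deriv_eq[OF \<phi>'(2)[OF h x]])
      finally show ?thesis .
    qed
    then show ?case using \<phi>'(1) by blast
  qed
  show ?thesis
    unfolding smooth_map_def
  proof (intro conjI allI impI ballI op)
    show "f ` V \<subseteq> X"
    proof
      fix y assume "y \<in> f ` V"
      then obtain x where x: "x \<in> V" "y = f x" by blast
      have "(x, \<lambda>_. 0) \<in> topspace (param_topology E V)"
        using x E by (subst topspace_param[OF VX]) (auto simp: subspace_0)
      then show "y \<in> X" using continuous_map_image_subset_topspace[OF cont[OF f]] x by force
    qed
  next
    fix hs h x assume hs: "set hs \<subseteq> E" and h: "h \<in> E" and x: "x \<in> V"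
    \<comment> \<open>The list \<open>h # hs\<close> coded as a sequence: index \<open>0\<close> is
      the new direction, the indices from \<open>1\<close> on are \<open>hs\<close>, and the padding
      \<open>0\<close> lies in every subspace.\<close>
    define H where "H i = (if i < length (h # hs) then (h # hs) ! i else 0)" for i
    have H: "range H \<subseteq> E"
    proof -
      have "set (h # hs) \<subseteq> E" using hs h by simp
      then have "(h # hs) ! i \<in> E" if "i < length (h # hs)" for i using that nth_mem by blast
      then show ?thesis using E(1) unfolding H_def by (auto simp only: subspace_0 split: if_splits)
    qed
    have "map H [1..<length (h # hs)] = hs"
      by (rule nth_equalityI) (auto simp: H_def simp del: upt_Suc)
    moreover obtain \<phi> where \<phi>: "\<phi> \<in> \<S>"
      "\<And>h' x. \<lbrakk>range h' \<subseteq> E; x \<in> V\<rbrakk> \<Longrightarrow> iter_dir_deriv T f (map h' [1..<length (h # hs)]) x = \<phi> h' x"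
      using iter[of "[1..<length (h # hs)]"] by metis
    ultimately have *: "iter_dir_deriv T f hs x = \<phi> H x" if "x \<in> V" for x
      using H that by metis
    obtain \<phi>' where "has_dir_deriv T (\<phi> H) x (H 0) (\<phi>' H x)"
      using der[OF \<phi>(1), of 0] H x by blast
    then show "\<exists>L. has_dir_deriv T (iter_dir_deriv T f hs) x h L"
      using has_dir_deriv_cong[OF op E x h, of "iter_dir_deriv T f hs" "\<phi> H"] * by (auto simp: H_def)
  next
    fix k :: nat
    let ?Z = "prod_topology (subtopology T V) (product_topology (\<lambda>_. subtopology T E) {..<k})"
    \<comment> \<open>A \<open>k\<close>-tuple of directions is extended by \<open>0\<close> to a
      sequence, so that continuity on the one space \<open>param_topology E V\<close> serves every
      order \<open>k\<close>.\<close>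
    let ?e = "\<lambda>h i. if i < k then h i else (0::'v)"
    obtain \<phi> where \<phi>: "\<phi> \<in> \<S>"
      "\<And>h x. \<lbrakk>range h \<subseteq> E; x \<in> V\<rbrakk> \<Longrightarrow> iter_dir_deriv T f (map h [0..<k]) x = \<phi> h x"
      using iter[of "[0..<k]"] by metis
    have "continuous_map ?Z (subtopology T E) (\<lambda>z. ?e (snd z) i)" for i
    proof (cases "i < k")
      case True
      then have "continuous_map (product_topology (\<lambda>_. subtopology T E) {..<k}) (subtopology T E) (\<lambda>h. h i)"
        by (intro continuous_map_product_projection) simp
      from continuous_map_compose[OF continuous_map_snd this] True show ?thesis by (simp add: o_def)
    qed (use E in \<open>auto simp: subspace_0\<close>)
    then have "continuous_map ?Z (param_topology E V) (\<lambda>z. (fst z, ?e (snd z)))"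
      unfolding param_topology_def continuous_map_pairwise o_def fst_conv snd_conv
      by (auto simp: continuous_map_componentwise_UNIV intro: continuous_map_fst)
    from continuous_map_compose[OF this cont[OF \<phi>(1)]]
    have "continuous_map ?Z T (\<lambda>z. \<phi> (?e (snd z)) (fst z))" by (simp add: o_def)
    then show "continuous_map ?Z T (\<lambda>(x, h). iter_dir_deriv T f (map h [0..<k]) x)"
    proof (rule continuous_map_eq)
      fix z assume "z \<in> topspace ?Z"
      then have z: "fst z \<in> V" "\<And>i. i < k \<Longrightarrow> snd z i \<in> E" by (auto simp: mem_Times_iff PiE_iff)
      then have "range (?e (snd z)) \<subseteq> E" using subspace_0[OF E(1)] by auto
      from \<phi>(2)[OF this z(1)]
      have "\<phi> (?e (snd z)) (fst z) = iter_dir_deriv T f (map (?e (snd z)) [0..<k]) (fst z)" ..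
      also have "map (?e (snd z)) [0..<k] = map (snd z) [0..<k]" by simp
      finally show "\<phi> (?e (snd z)) (fst z) = (\<lambda>(x, h). iter_dir_deriv T f (map h [0..<k]) x) z"
        by (simp add: case_prod_unfold)
    qed
  qed
qed

section \<open>Limits of iterated derivatives with moving arguments\<close>

lemma smooth_map_open: "smooth_map T E V f \<Longrightarrow> openin (subtopology T E) V"
  by (simp add: smooth_map_def)

lemma smooth_map_has_dir_deriv:
  assumes "smooth_map T E V f" "set hs \<subseteq> E" "h \<in> E" "x \<in> V"
  shows "has_dir_deriv T (iter_dir_deriv T f hs) x h (iter_dir_deriv T f (h # hs) x)"
proof -
  obtain L where "has_dir_deriv T (iter_dir_deriv T f hs) x h L"
    using assms unfolding smooth_map_def by blast
  then show ?thesis using dir_deriv_eq by simp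
qed

lemma smooth_map_has_dir_deriv1:
  "\<lbrakk>smooth_map T E V f; h \<in> E; x \<in> V\<rbrakk> \<Longrightarrow> has_dir_deriv T f x h (dir_deriv T f x h)"
  using smooth_map_has_dir_deriv[of E V f "[]" h x] by simp

lemma eventually_list_mem:
  "list_all2 (\<lambda>\<phi> l. limitin (subtopology T E) \<phi> l F) \<Phi> a \<Longrightarrow> \<forall>\<^sub>F i in F. set (map (\<lambda>\<phi>. \<phi> i) \<Phi>) \<subseteq> E"
proof (induction rule: list_all2_induct)
  case (Cons \<phi> \<Phi> l a)
  have "\<forall>\<^sub>F i in F. \<phi> i \<in> E" using Cons(1) by (simp add: limitin_subtopology)
  with Cons(3) show ?case by eventually_elim auto
qed simp

text \<open>The joint continuity clause of \<open>smooth_map\<close> rephrased for filters, with a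
  list of moving directions in place of a point of a product space. Limits of this kind arise where
  no topology on the index set is at hand, for instance as \<open>t\<close> tends to
  \<open>0\<close>.\<close>

lemma smooth_map_limit:
  assumes sm: "smooth_map T E V g" and u: "limitin (subtopology T V) u y F"
    and l: "list_all2 (\<lambda>\<phi> l. limitin (subtopology T E) \<phi> l F) \<Phi> a"
  shows "limitin T (\<lambda>i. iter_dir_deriv T g (map (\<lambda>\<phi>. \<phi> i) \<Phi>) (u i)) (iter_dir_deriv T g a y) F"
proof -
  define k where "k = length \<Phi>"
  have len: "length a = k" using l by (simp add: list_all2_lengthD k_def)
  let ?Z = "prod_topology (subtopology T V) (product_topology (\<lambda>_. subtopology T E) {..<k})"
  have lj: "limitin (subtopology T E) (\<lambda>i. (\<Phi> ! j) i) (a ! j) F" if "j < k" for j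
    using l that by (simp add: list_all2_conv_all_nth k_def)
  have "limitin (product_topology (\<lambda>_. subtopology T E) {..<k}) (\<lambda>i. \<lambda>j\<in>{..<k}. (\<Phi> ! j) i) (\<lambda>j\<in>{..<k}. a ! j) F"
    unfolding limitin_componentwise
  proof (intro conjI ballI)
    have "\<forall>\<^sub>F i in F. \<forall>j\<in>{..<k}. (\<Phi> ! j) i \<in> topspace (subtopology T E)"
    proof (rule eventually_ball_finite, simp, rule ballI)
      fix j assume "j \<in> {..<k}"
      then have lj': "limitin (subtopology T E) (\<lambda>i. (\<Phi> ! j) i) (a ! j) F" using lj by simp
      show "\<forall>\<^sub>F i in F. (\<Phi> ! j) i \<in> topspace (subtopology T E)"
        by (rule limitinD[OF lj' openin_topspace limitin_topspace[OF lj']])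
    qed
    then show "\<forall>\<^sub>F i in F. (\<lambda>j\<in>{..<k}. (\<Phi> ! j) i) \<in> topspace (product_topology (\<lambda>_. subtopology T E) {..<k})"
      by eventually_elim auto
  qed (auto intro: lj)
  then have "limitin ?Z (\<lambda>i. (u i, \<lambda>j\<in>{..<k}. (\<Phi> ! j) i)) (y, \<lambda>j\<in>{..<k}. a ! j) F"
    using u by (simp add: limitin_pairwise o_def)
  moreover have "continuous_map ?Z T (\<lambda>(x, h). iter_dir_deriv T g (map h [0..<k]) x)"
    using sm unfolding smooth_map_def by blast
  ultimately have "limitin T ((\<lambda>(x, h). iter_dir_deriv T g (map h [0..<k]) x) \<circ> (\<lambda>i. (u i, \<lambda>j\<in>{..<k}. (\<Phi> ! j) i)))
    ((\<lambda>(x, h). iter_dir_deriv T g (map h [0..<k]) x) (y, \<lambda>j\<in>{..<k}. a ! j)) F"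
    by (intro continuous_map_limit)
  moreover have "map (\<lambda>j\<in>{..<k}. a ! j) [0..<k] = a" by (rule nth_equalityI) (auto simp: len)
  moreover have "map (\<lambda>j\<in>{..<k}. (\<Phi> ! j) i) [0..<k] = map (\<lambda>\<phi>. \<phi> i) \<Phi>" for i
    by (rule nth_equalityI) (auto simp: k_def)
  ultimately show ?thesis by (simp add: o_def)
qed

lemma list_all2_limitin_const:
  assumes "set a \<subseteq> E" "E \<subseteq> X"
  shows "list_all2 (\<lambda>\<phi> l. limitin (subtopology T E) \<phi> l F) (map (\<lambda>w _. w) a) a"
  using assms unfolding list_all2_conv_all_nth by (auto simp: limitin_subtopology dest!: nth_mem)

lemma smooth_map_iter_mem:
  assumes "smooth_map T E V g" "E \<subseteq> X" "set a \<subseteq> E" "x \<in> V"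
  shows "iter_dir_deriv T g a x \<in> X"
proof -
  have "x \<in> X" using open_subtopology_mem[OF smooth_map_open[OF assms(1)] assms(4)] by simp
  then have "limitin (subtopology T V) (\<lambda>_. x) x (at (0::real))"
    using assms by (simp add: limitin_subtopology)
  from smooth_map_limit[OF assms(1) this list_all2_limitin_const[OF assms(3,2)]]
  show ?thesis by (rule limitin_topspace)
qed

text \<open>The analytic core of the chain rule. On the segment from \<open>b i\<close> to
  \<open>b i + s i *\<^sub>R k i\<close> the derivative of the map is close to the limit, by joint
  continuity and uniformly along the segment; the mean value inequality turns this into closeness of
  the quotient.\<close>

lemma smooth_map_difference_quotient:
  assumes sm: "smooth_map T E V g" and E: "subspace E" "E \<subseteq> X"
    and b: "limitin (subtopology T V) b y F" and k: "limitin (subtopology T E) k k0 F"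
    and s: "(s \<longlongrightarrow> 0) F" "\<forall>\<^sub>F i in F. s i \<noteq> 0"
    and l: "list_all2 (\<lambda>\<phi> l. limitin (subtopology T E) \<phi> l F) \<Phi> a"
  shows "limitin T (\<lambda>i. (1 / s i) *\<^sub>R (iter_dir_deriv T g (map (\<lambda>\<phi>. \<phi> i) \<Phi>) (b i + s i *\<^sub>R k i)
      - iter_dir_deriv T g (map (\<lambda>\<phi>. \<phi> i) \<Phi>) (b i))) (iter_dir_deriv T g (k0 # a) y) F"
proof -
  define L where "L = iter_dir_deriv T g (k0 # a) y"
  define A where "A i = map (\<lambda>\<phi>. \<phi> i) \<Phi>" for i
  \<comment> \<open>The product with the principal filter of the unit interval encodes uniformity:
    what holds eventually for \<open>F2\<close> holds, eventually in \<open>i\<close>, for all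
    \<open>\<tau>\<close> in the interval at once.\<close>
  define F2 where "F2 = F \<times>\<^sub>F principal {0..1::real}"
  define u where "u z = b (fst z) + (snd z * s (fst z)) *\<^sub>R k (fst z)" for z
  note op = smooth_map_open[OF sm]
  have yV: "y \<in> V" using b by (simp add: limitin_subtopology)
  have fst2: "filterlim fst F F2" unfolding F2_def by (rule filterlim_fst)
  have VE: "V \<subseteq> E" using op open_subtopology_mem by blast
  have evA: "\<forall>\<^sub>F i in F. set (A i) \<subseteq> E" unfolding A_def by (rule eventually_list_mem[OF l])
  have evk: "\<forall>\<^sub>F i in F. k i \<in> E" using k by (simp add: limitin_subtopology)
  have evb: "\<forall>\<^sub>F i in F. b i \<in> V" using b by (simp add: limitin_subtopology)
  have bs: "\<forall>\<^sub>F z in F2. snd z \<in> {0..1}"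
    unfolding F2_def eventually_prod_filter eventually_principal
    by (rule exI[of _ "\<lambda>_. True"], rule exI[of _ "\<lambda>t. t \<in> {0..1}"]) auto
  have ts: "((\<lambda>z. snd z * s (fst z)) \<longlongrightarrow> 0) F2"
  proof (rule Lim_null_comparison)
    show "\<forall>\<^sub>F z in F2. norm (snd z * s (fst z)) \<le> \<bar>s (fst z)\<bar>"
      using bs by eventually_elim (auto simp: abs_mult intro: mult_left_le_one_le)
    show "((\<lambda>z. \<bar>s (fst z)\<bar>) \<longlongrightarrow> 0) F2"
      using filterlim_compose[OF s(1) fst2] by (simp add: tendsto_rabs_zero)
  qed
  have uT: "limitin T u y F2"
  proof -
    have "limitin T (\<lambda>z. b (fst z)) y F2" "limitin T (\<lambda>z. k (fst z)) k0 F2"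
      using b k limitin_filter_compose[OF _ fst2] by (auto simp: limitin_subtopology)
    from limitin_add[OF this(1) limitin_scale[OF this(2) ts]] show ?thesis by (simp add: u_def[abs_def])
  qed
  have ev2: "\<forall>\<^sub>F z in F2. Q (fst z)" if "eventually Q F" for Q
    using fst2 that by (auto simp: filterlim_iff)
  have "\<forall>\<^sub>F z in F2. u z \<in> E"
    using ev2[OF evb] ev2[OF evk]
    by eventually_elim (use E VE in \<open>auto simp: u_def subspace_add subspace_scale\<close>)
  then have "limitin (subtopology T E) u y F2" using uT yV VE by (auto simp: limitin_subtopology)
  then have uV: "limitin (subtopology T V) u y F2" using limitin_open_subtopology[OF op _ yV] by blast
  have "list_all2 (\<lambda>\<phi> l. limitin (subtopology T E) \<phi> l F2) (map (\<lambda>\<phi> z. \<phi> (fst z)) (k # \<Phi>)) (k0 # a)"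
    using limitin_filter_compose[OF k fst2] list_all2_mono[OF l limitin_filter_compose[OF _ fst2]]
    by (simp add: list_all2_map1)
  from smooth_map_limit[OF sm uV this]
  have lim2: "limitin T (\<lambda>z. iter_dir_deriv T g (k (fst z) # A (fst z)) (u z)) L F2"
    by (simp add: L_def A_def o_def)
  have "\<forall>\<^sub>F z in F2. u z \<in> V" using uV by (simp add: limitin_subtopology)
  have LX: "L \<in> X" using lim2 by (rule limitin_topspace)
  show ?thesis
    unfolding limitin_iff A_def[symmetric] L_def[symmetric]
  proof (intro conjI ballI LX)
    have seg: "\<forall>\<^sub>F i in F. \<forall>\<tau>\<in>{0..1}. Q (i, \<tau>)" if ev: "\<forall>\<^sub>F z in F2. Q z" for Q
    proof -
      obtain Pf Pg where "eventually Pf F" "eventually Pg (principal {0..1::real})"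
        "\<And>x y. Pf x \<Longrightarrow> Pg y \<Longrightarrow> Q (x, y)"
        using ev unfolding F2_def eventually_prod_filter by metis
      then show ?thesis by (auto simp: eventually_principal elim: eventually_mono)
    qed
    have evV: "\<forall>\<^sub>F i in F. \<forall>\<tau>\<in>{0..1}. u (i, \<tau>) \<in> V" by (rule seg) fact
    show "\<forall>\<^sub>F i in F. (1 / s i) *\<^sub>R (iter_dir_deriv T g (A i) (b i + s i *\<^sub>R k i) - iter_dir_deriv T g (A i) (b i)) \<in> X"
      using evV evb evA
    proof eventually_elim
      case (elim i)
      have "u (i, 1) \<in> V" using elim(1) by auto
      then show ?case using smooth_map_iter_mem[OF sm E(2) elim(3)] elim(2) by (simp add: u_def)
    qed
    fix p assume p: "p \<in> P"
    show "((\<lambda>i. p ((1 / s i) *\<^sub>R (iter_dir_deriv T g (A i) (b i + s i *\<^sub>R k i) - iter_dir_deriv T g (A i) (b i)) - L)) \<longlongrightarrow> 0) F"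
    proof (rule tendstoI)
      fix e :: real assume e: "e > 0"
      have "((\<lambda>z. p (iter_dir_deriv T g (k (fst z) # A (fst z)) (u z) - L)) \<longlongrightarrow> 0) F2"
        using lim2 p by (simp add: limitin_iff)
      then have "\<forall>\<^sub>F z in F2. p (iter_dir_deriv T g (k (fst z) # A (fst z)) (u z) - L) < e / 2"
        using e by (intro order_tendstoD) auto
      then have close: "\<forall>\<^sub>F i in F. \<forall>\<tau>\<in>{0..1}. p (iter_dir_deriv T g (k i # A i) (u (i, \<tau>)) - L) < e / 2"
        using seg by fastforce
      show "\<forall>\<^sub>F i in F. dist (p ((1 / s i) *\<^sub>R (iter_dir_deriv T g (A i) (b i + s i *\<^sub>R k i) - iter_dir_deriv T g (A i) (b i)) - L)) 0 < e"
        using evV evb evk evA close s(2)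
      proof eventually_elim
        case (elim i)
        let ?G = "iter_dir_deriv T g (A i)"
        \<comment> \<open>Subtracting the expected linear part leaves a curve with derivative
          \<open>s i *\<^sub>R (?D - L)\<close>, so the mean value bound is directly a bound for the
          error. The bound \<open>e / 2\<close> is used because that inequality is not
          strict.\<close>
        define \<gamma> where "\<gamma> \<tau> = ?G (u (i, \<tau>)) - (\<tau> * s i) *\<^sub>R L" for \<tau>
        have uV: "u (i, \<tau>) \<in> V" if "0 \<le> \<tau>" "\<tau> \<le> 1" for \<tau> using elim that by auto
        have GX: "?G (u (i, \<tau>)) \<in> X" if "0 \<le> \<tau>" "\<tau> \<le> 1" for \<tau>
          using smooth_map_iter_mem[OF sm E(2) elim(4) uV[OF that]] .
        have "p (\<gamma> 1 - \<gamma> 0) \<le> (\<bar>s i\<bar> * (e / 2)) * (1 - 0)"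
        proof (rule mean_value_seminorm[OF p])
          fix \<tau> :: real assume \<tau>: "0 \<le> \<tau>" "\<tau> \<le> 1"
          let ?D = "iter_dir_deriv T g (k i # A i) (u (i, \<tau>))"
          show "\<gamma> \<tau> \<in> X" unfolding \<gamma>_def using GX[OF \<tau>] LX by blast
          have DX: "?D \<in> X" using elim uV[OF \<tau>] by (intro smooth_map_iter_mem[OF sm E(2)]) auto
          have "has_dir_deriv T ?G (u (i, \<tau>)) (k i) ?D"
            by (rule smooth_map_has_dir_deriv[OF sm elim(4,3) uV[OF \<tau>]])
          from has_dir_deriv_scale_dir[OF this, of "s i"]
          have "limitin T (\<lambda>t. (1 / t) *\<^sub>R (?G (u (i, \<tau>) + t *\<^sub>R s i *\<^sub>R k i) - ?G (u (i, \<tau>)))) (s i *\<^sub>R ?D) (at 0)"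
            by (simp add: has_dir_deriv_def)
          moreover have "limitin T (\<lambda>t. (1 / t) *\<^sub>R ((t * s i) *\<^sub>R L)) (s i *\<^sub>R L) (at 0)"
          proof (rule limitin_eventually)
            show "\<forall>\<^sub>F t in at 0. (1 / t) *\<^sub>R (t * s i) *\<^sub>R L = s i *\<^sub>R L"
              using eventually_nonzero by eventually_elim simp
          qed (use LX in blast)
          ultimately have "limitin T (\<lambda>t. (1 / t) *\<^sub>R (?G (u (i, \<tau>) + t *\<^sub>R s i *\<^sub>R k i) - ?G (u (i, \<tau>))) - (1 / t) *\<^sub>R ((t * s i) *\<^sub>R L)) (s i *\<^sub>R ?D - s i *\<^sub>R L) (at 0)"
            by (rule limitin_diff)
          moreover have "(1 / t) *\<^sub>R (?G (u (i, \<tau>) + t *\<^sub>R s i *\<^sub>R k i) - ?G (u (i, \<tau>))) - (1 / t) *\<^sub>R ((t * s i) *\<^sub>R L) = (1 / t) *\<^sub>R (\<gamma> (\<tau> + t) - \<gamma> \<tau>)" for t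
            by (simp add: \<gamma>_def u_def algebra_simps)
          ultimately show "limitin T (\<lambda>t. (1 / t) *\<^sub>R (\<gamma> (\<tau> + t) - \<gamma> \<tau>)) (s i *\<^sub>R (?D - L)) (at 0)"
            by (simp add: scaleR_diff_right)
          have "p (?D - L) \<le> e / 2" using elim \<tau> by (auto intro: less_imp_le)
          then show "p (s i *\<^sub>R (?D - L)) \<le> \<bar>s i\<bar> * (e / 2)"
            using sn_scale[OF p in_X(3)[OF DX LX], of "s i"] mult_left_mono[of "p (?D - L)" "e / 2" "\<bar>s i\<bar>"]
            by simp
        qed simp
        moreover have X1: "\<gamma> 1 - \<gamma> 0 \<in> X" unfolding \<gamma>_def using GX LX by auto
        moreover have "\<gamma> 1 - \<gamma> 0 = ?G (b i + s i *\<^sub>R k i) - ?G (b i) - s i *\<^sub>R L"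
          by (simp add: \<gamma>_def u_def)
        moreover have "(1 / s i) *\<^sub>R (?G (b i + s i *\<^sub>R k i) - ?G (b i)) - L = (1 / s i) *\<^sub>R (?G (b i + s i *\<^sub>R k i) - ?G (b i) - s i *\<^sub>R L)"
          using elim by (simp add: algebra_simps)
        ultimately have eq: "(1 / s i) *\<^sub>R (?G (b i + s i *\<^sub>R k i) - ?G (b i)) - L = (1 / s i) *\<^sub>R (\<gamma> 1 - \<gamma> 0)"
          and le: "p (\<gamma> 1 - \<gamma> 0) \<le> \<bar>s i\<bar> * (e / 2)" by simp_all
        have "p ((1 / s i) *\<^sub>R (\<gamma> 1 - \<gamma> 0)) = p (\<gamma> 1 - \<gamma> 0) / \<bar>s i\<bar>"
          unfolding sn_scale[OF p X1] by simp
        also have "\<dots> \<le> e / 2" using le elim by (simp add: field_simps)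
        finally have "p ((1 / s i) *\<^sub>R (?G (b i + s i *\<^sub>R k i) - ?G (b i)) - L) \<le> e / 2"
          and "(1 / s i) *\<^sub>R (?G (b i + s i *\<^sub>R k i) - ?G (b i)) - L \<in> X"
          unfolding eq using X1 by auto
        then show ?case using sn_nonneg[OF p] e by auto
      qed
    qed
  qed
qed

section \<open>The chain rule\<close>

text \<open>The increment along \<open>h + k\<close> is the increment along \<open>h\<close>
  followed by one along \<open>k\<close> from the moving base point
  \<open>x + t *\<^sub>R h\<close>; the second quotient converges by
  \<open>smooth_map_difference_quotient\<close>.\<close>

lemma iter_dir_deriv_add_head:
  assumes sm: "smooth_map T E V g" and E: "subspace E" "E \<subseteq> X"
    and hs: "set hs \<subseteq> E" "h \<in> E" "k \<in> E" "x \<in> V"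
  shows "iter_dir_deriv T g ((h + k) # hs) x = iter_dir_deriv T g (h # hs) x + iter_dir_deriv T g (k # hs) x"
proof -
  let ?G = "iter_dir_deriv T g hs"
  have xE: "x \<in> E" using open_subtopology_mem[OF smooth_map_open[OF sm] hs(4)] by simp
  have "limitin (subtopology T V) (\<lambda>t. x + t *\<^sub>R h) x (at 0)"
    using limitin_open_subtopology[OF smooth_map_open[OF sm] limitin_line_subspace[OF E xE hs(2)] hs(4)] .
  from smooth_map_difference_quotient[OF sm E this _ tendsto_ident_at eventually_nonzero
      list_all2_limitin_const[OF hs(1) E(2)], of "\<lambda>_. k" k]
  have "limitin T (\<lambda>t. (1 / t) *\<^sub>R (?G (x + t *\<^sub>R h + t *\<^sub>R k) - ?G (x + t *\<^sub>R h)))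
      (iter_dir_deriv T g (k # hs) x) (at 0)"
    using hs(3) E(2) by (auto simp: o_def)
  from limitin_add[OF smooth_map_has_dir_deriv[OF sm hs(1,2,4), unfolded has_dir_deriv_def] this]
  have "has_dir_deriv T ?G x (h + k) (iter_dir_deriv T g (h # hs) x + iter_dir_deriv T g (k # hs) x)"
    unfolding has_dir_deriv_def by (simp add: algebra_simps)
  then show ?thesis using dir_deriv_eq by simp
qed

lemma iter_dir_deriv_scale_head:
  assumes sm: "smooth_map T E V g" and hs: "set hs \<subseteq> E" "h \<in> E" "x \<in> V"
  shows "iter_dir_deriv T g ((r *\<^sub>R h) # hs) x = r *\<^sub>R iter_dir_deriv T g (h # hs) x"
  using dir_deriv_eq[OF has_dir_deriv_scale_dir[OF smooth_map_has_dir_deriv[OF sm hs], of r]] by simp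

text \<open>The head of the list is the derivative taken last. The slot after \<open>ks\<close> is
  linear when it is the head, and differentiating that identity along the members of
  \<open>ks\<close> preserves it.\<close>

lemma iter_dir_deriv_linear:
  assumes sm: "smooth_map T E V g" and E: "subspace E" "E \<subseteq> X"
    and hs: "set hs \<subseteq> E" "set ks \<subseteq> E" "h \<in> E" "k \<in> E" "x \<in> V"
  shows "iter_dir_deriv T g (ks @ (\<alpha> *\<^sub>R h + \<beta> *\<^sub>R k) # hs) x =
    \<alpha> *\<^sub>R iter_dir_deriv T g (ks @ h # hs) x + \<beta> *\<^sub>R iter_dir_deriv T g (ks @ k # hs) x"
  using hs(2,5)
proof (induction ks arbitrary: x)
  case Nil
  then show ?case
    using iter_dir_deriv_add_head[OF sm E hs(1), of "\<alpha> *\<^sub>R h" "\<beta> *\<^sub>R k" x] hs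
      iter_dir_deriv_scale_head[OF sm hs(1)] E
    by (simp add: subspace_scale del: iter_dir_deriv.simps)
next
  case (Cons u ks)
  let ?f = "\<lambda>x. \<alpha> *\<^sub>R iter_dir_deriv T g (ks @ h # hs) x + \<beta> *\<^sub>R iter_dir_deriv T g (ks @ k # hs) x"
  have u: "u \<in> E" "set ks \<subseteq> E" using Cons.prems by auto
  have "iter_dir_deriv T g ((u # ks) @ (\<alpha> *\<^sub>R h + \<beta> *\<^sub>R k) # hs) x = dir_deriv T ?f x u"
    using Cons.IH[OF u(2)] Cons.prems(2) u
    by (simp, intro dir_deriv_cong[OF smooth_map_open[OF sm] E]) auto
  also have "\<dots> = \<alpha> *\<^sub>R iter_dir_deriv T g (u # ks @ h # hs) x + \<beta> *\<^sub>R iter_dir_deriv T g (u # ks @ k # hs) x"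
    using hs u Cons.prems
    by (intro dir_deriv_eq has_dir_deriv_add has_dir_deriv_scale smooth_map_has_dir_deriv[OF sm]) auto
  finally show ?case by simp
qed

text \<open>The second components of the pairs are the derivatives of the first ones.\<close>

primrec deriv_sum :: "('v \<Rightarrow> 'v) \<Rightarrow> 'v \<Rightarrow> 'v list \<Rightarrow> ('v \<times> 'v) list \<Rightarrow> 'v" where
  "deriv_sum g y a [] = 0"
| "deriv_sum g y a (w # ws) = iter_dir_deriv T g (a @ snd w # map fst ws) y + deriv_sum g y (a @ [fst w]) ws"

text \<open>Differentiability at \<open>0\<close> of a curve in \<open>E\<close>. Only parameters
  near \<open>0\<close> are constrained, since a line through a point of an open set may leave the
  set.\<close>

definition curve_deriv :: "'v set \<Rightarrow> (real \<Rightarrow> 'v) \<Rightarrow> 'v \<Rightarrow> bool"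
  where "curve_deriv E \<psi> w \<longleftrightarrow> (\<forall>\<^sub>F t in at 0. \<psi> t \<in> E) \<and> \<psi> 0 \<in> E \<and>
    limitin (subtopology T E) (\<lambda>t. (1 / t) *\<^sub>R (\<psi> t - \<psi> 0)) w (at 0)"

lemma curve_deriv_limit:
  assumes "curve_deriv E \<psi> w" "subspace E" "E \<subseteq> X"
  shows "limitin (subtopology T E) \<psi> (\<psi> 0) (at 0)"
proof -
  have "limitin T (\<lambda>t. \<psi> 0 + t *\<^sub>R ((1 / t) *\<^sub>R (\<psi> t - \<psi> 0))) (\<psi> 0 + 0 *\<^sub>R w) (at 0)"
    using assms
    by (intro limitin_add limitin_scale) (auto simp: curve_deriv_def limitin_subtopology)
  moreover have "\<forall>\<^sub>F t in at 0. \<psi> 0 + t *\<^sub>R ((1 / t) *\<^sub>R (\<psi> t - \<psi> 0)) = \<psi> t"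
    using eventually_nonzero by eventually_elim simp
  ultimately have "limitin T \<psi> (\<psi> 0 + 0 *\<^sub>R w) (at 0)" by (rule limitin_transform_eventually[rotated])
  then show ?thesis using assms by (simp add: curve_deriv_def limitin_subtopology)
qed

text \<open>Telescoping: the slots in \<open>\<Psi>\<close> pass from their value at
  \<open>0\<close> to their value at \<open>t\<close> one after the other. A slot already changed
  joins \<open>\<Phi>\<close>, where nothing but its limit matters.\<close>

lemma multilinear_product_rule:
  assumes sm: "smooth_map T E V g" and E: "subspace E" "E \<subseteq> X" and y: "y \<in> V"
    and \<Psi>: "list_all2 (curve_deriv E) \<Psi> ws"
    and l: "list_all2 (\<lambda>\<phi> l. limitin (subtopology T E) \<phi> l (at 0)) \<Phi> a"
  shows "limitin T (\<lambda>t. (1 / t) *\<^sub>R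
      (iter_dir_deriv T g (map (\<lambda>\<phi>. \<phi> t) \<Phi> @ map (\<lambda>\<psi>. \<psi> t) \<Psi>) y -
       iter_dir_deriv T g (map (\<lambda>\<phi>. \<phi> t) \<Phi> @ map (\<lambda>\<psi>. \<psi> 0) \<Psi>) y))
    (deriv_sum g y a (zip (map (\<lambda>\<psi>. \<psi> 0) \<Psi>) ws)) (at 0)"
  using \<Psi> l
proof (induction arbitrary: \<Phi> a rule: list_all2_induct)
  case Nil
  then show ?case by simp
next
  case (Cons \<psi> \<Psi> w ws)
  let ?A = "\<lambda>t. map (\<lambda>\<phi>. \<phi> t) \<Phi>"
  let ?t = "\<lambda>t. map (\<lambda>\<psi>. \<psi> t) \<Psi>" and ?Z0 = "map (\<lambda>\<psi>. \<psi> 0) \<Psi>"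
  have yX: "y \<in> X" using open_subtopology_mem[OF smooth_map_open[OF sm] y] by simp
  have len: "length ?Z0 = length ws" using Cons(2) by (simp add: list_all2_lengthD)
  have zero: "set ?Z0 \<subseteq> E"
    using Cons(2) by (auto simp: list_all2_conv_all_nth in_set_conv_nth curve_deriv_def)
  have "list_all2 (\<lambda>\<phi> l. limitin (subtopology T E) \<phi> l (at 0)) (\<Phi> @ [\<psi>]) (a @ [\<psi> 0])"
    using Cons.prems curve_deriv_limit[OF Cons(1) E] by (simp add: list_all2_appendI)
  from Cons.IH[OF this]
  have 1: "limitin T (\<lambda>t. (1 / t) *\<^sub>R (iter_dir_deriv T g (?A t @ \<psi> t # ?t t) y - iter_dir_deriv T g (?A t @ \<psi> t # ?Z0) y))
    (deriv_sum g y (a @ [\<psi> 0]) (zip ?Z0 ws)) (at 0)"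
    by simp
  have q: "limitin (subtopology T E) (\<lambda>t. (1 / t) *\<^sub>R (\<psi> t - \<psi> 0)) w (at 0)"
    using Cons(1) by (simp add: curve_deriv_def)
  have "list_all2 (\<lambda>\<phi> l. limitin (subtopology T E) \<phi> l (at 0))
      (\<Phi> @ (\<lambda>t. (1 / t) *\<^sub>R (\<psi> t - \<psi> 0)) # map (\<lambda>w _. w) ?Z0) (a @ w # ?Z0)"
    using Cons.prems q list_all2_limitin_const[OF zero E(2)] by (intro list_all2_appendI) simp_all
  from smooth_map_limit[OF sm _ this, of "\<lambda>_. y" y] y yX
  have 2: "limitin T (\<lambda>t. iter_dir_deriv T g (?A t @ ((1 / t) *\<^sub>R (\<psi> t - \<psi> 0)) # ?Z0) y)
      (iter_dir_deriv T g (a @ w # ?Z0) y) (at 0)"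
    by (simp add: o_def)
  \<comment> \<open>Linearity in the slot of \<open>\<psi>\<close> makes the quotient of that slot
    the exact quotient of the whole expression.\<close>
  have "\<forall>\<^sub>F t in at 0. iter_dir_deriv T g (?A t @ ((1 / t) *\<^sub>R (\<psi> t - \<psi> 0)) # ?Z0) y =
     (1 / t) *\<^sub>R (iter_dir_deriv T g (?A t @ \<psi> t # ?Z0) y - iter_dir_deriv T g (?A t @ \<psi> 0 # ?Z0) y)"
  proof -
    have ev: "\<forall>\<^sub>F t in at 0. \<psi> t \<in> E" and 0: "\<psi> 0 \<in> E" using Cons(1) by (auto simp: curve_deriv_def)
    show ?thesis
      using eventually_list_mem[OF Cons.prems] ev
    proof eventually_elim
      case (elim t)
      show ?case
        using iter_dir_deriv_linear[OF sm E zero elim 0 y, of "1 / t" "- 1 / t"]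
        by (simp add: algebra_simps)
    qed
  qed
  from limitin_add[OF limitin_transform_eventually[OF this 2] 1]
  have "limitin T (\<lambda>t. (1 / t) *\<^sub>R (iter_dir_deriv T g (?A t @ \<psi> t # ?t t) y - iter_dir_deriv T g (?A t @ \<psi> 0 # ?Z0) y))
    (iter_dir_deriv T g (a @ w # ?Z0) y + deriv_sum g y (a @ [\<psi> 0]) (zip ?Z0 ws)) (at 0)"
    by (simp add: algebra_simps)
  then show ?case using len by simp
qed

text \<open>The base point is moved first, with directions already at time \<open>t\<close>; then
  the directions are moved at the fixed base point \<open>u 0\<close>. The first part needs the
  difference quotient with moving directions, the second is the product rule.\<close>

lemma chain_rule_multi:
  assumes sm: "smooth_map T E V g" and E: "subspace E" "E \<subseteq> X"
    and u: "\<forall>\<^sub>F t in at 0. u t \<in> V" "u 0 \<in> V" and u': "curve_deriv E u u'"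
    and \<Psi>: "list_all2 (curve_deriv E) \<Psi> ws"
  shows "limitin T (\<lambda>t. (1 / t) *\<^sub>R
      (iter_dir_deriv T g (map (\<lambda>\<psi>. \<psi> t) \<Psi>) (u t) - iter_dir_deriv T g (map (\<lambda>\<psi>. \<psi> 0) \<Psi>) (u 0)))
    (iter_dir_deriv T g (u' # map (\<lambda>\<psi>. \<psi> 0) \<Psi>) (u 0) + deriv_sum g (u 0) [] (zip (map (\<lambda>\<psi>. \<psi> 0) \<Psi>) ws)) (at 0)"
proof -
  \<comment> \<open>With this moving direction \<open>u t\<close> becomes
    \<open>u 0 + t *\<^sub>R ?k t\<close>, a straight step from a fixed point.\<close>
  let ?k = "\<lambda>t. (1 / t) *\<^sub>R (u t - u 0)"
  let ?t = "\<lambda>t. map (\<lambda>\<psi>. \<psi> t) \<Psi>"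
  have u0: "limitin (subtopology T V) (\<lambda>_. u 0) (u 0) (at (0::real))"
    using u(2) open_subtopology_mem[OF smooth_map_open[OF sm] u(2)] by simp
  have "list_all2 (\<lambda>\<phi> l. limitin (subtopology T E) \<phi> l (at 0)) \<Psi> (map (\<lambda>\<psi>. \<psi> 0) \<Psi>)"
    using \<Psi> curve_deriv_limit[OF _ E] by (auto simp: list_all2_conv_all_nth)
  moreover have "limitin (subtopology T E) ?k u' (at 0)" using u' by (simp add: curve_deriv_def)
  ultimately have 1: "limitin T (\<lambda>t. (1 / t) *\<^sub>R (iter_dir_deriv T g (?t t) (u 0 + t *\<^sub>R ?k t) - iter_dir_deriv T g (?t t) (u 0)))
    (iter_dir_deriv T g (u' # ?t 0) (u 0)) (at 0)"
    using smooth_map_difference_quotient[OF sm E u0 _ tendsto_ident_at eventually_nonzero] by blast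
  have 2: "limitin T (\<lambda>t. (1 / t) *\<^sub>R (iter_dir_deriv T g (?t t) (u 0) - iter_dir_deriv T g (?t 0) (u 0)))
    (deriv_sum g (u 0) [] (zip (?t 0) ws)) (at 0)"
    using multilinear_product_rule[OF sm E u(2) \<Psi> list_all2_Nil[THEN iffD2, OF refl]] by simp
  have "\<forall>\<^sub>F t in at 0. (1 / t) *\<^sub>R (iter_dir_deriv T g (?t t) (u 0 + t *\<^sub>R ?k t) - iter_dir_deriv T g (?t t) (u 0))
      + (1 / t) *\<^sub>R (iter_dir_deriv T g (?t t) (u 0) - iter_dir_deriv T g (?t 0) (u 0))
    = (1 / t) *\<^sub>R (iter_dir_deriv T g (?t t) (u t) - iter_dir_deriv T g (?t 0) (u 0))"
    using eventually_nonzero by eventually_elim (simp add: algebra_simps)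
  then show ?thesis by (rule limitin_transform_eventually[OF _ limitin_add[OF 1 2]])
qed

text \<open>Closedness of \<open>F\<close> keeps the limit of the quotients in \<open>F\<close>.
  This is how derivatives of maps into a model space stay in the model space although limits are
  taken in the ambient topology.\<close>

lemma curve_deriv_line:
  assumes op: "openin (subtopology T E) V" and E: "subspace E" "E \<subseteq> X" and x: "x \<in> V" "h \<in> E"
    and d: "has_dir_deriv T f x h L" and F: "subspace F" "closedin T F"
    and fF: "\<And>y. y \<in> V \<Longrightarrow> f y \<in> F"
  shows "curve_deriv F (\<lambda>t. f (x + t *\<^sub>R h)) L"
proof -
  have ev: "\<forall>\<^sub>F t in at 0. f (x + t *\<^sub>R h) \<in> F"
    using eventually_line[OF op E x] by eventually_elim (rule fF)
  have evq: "\<forall>\<^sub>F t in at 0. (1 / t) *\<^sub>R (f (x + t *\<^sub>R h) - f x) \<in> F"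
    using ev by eventually_elim (use F fF[OF x(1)] in \<open>simp add: subspace_scale subspace_diff\<close>)
  moreover have "L \<in> F"
    by (rule limitin_closedin[OF d[unfolded has_dir_deriv_def] F(2) evq]) simp
  ultimately show ?thesis
    using ev d fF[OF x(1)] by (simp add: curve_deriv_def limitin_subtopology has_dir_deriv_def)
qed

lemma smooth_map_iter_mem_closed:
  assumes sm: "smooth_map T E V f" and E: "subspace E" "E \<subseteq> X"
    and F: "subspace F" "closedin T F" and fF: "\<And>y. y \<in> V \<Longrightarrow> f y \<in> F"
    and "set hs \<subseteq> E" "x \<in> V"
  shows "iter_dir_deriv T f hs x \<in> F"
  using assms(7,8)
proof (induction hs arbitrary: x)
  case (Cons h hs)
  then have h: "h \<in> E" "set hs \<subseteq> E" by auto
  have "curve_deriv F (\<lambda>t. iter_dir_deriv T f hs (x + t *\<^sub>R h)) (iter_dir_deriv T f (h # hs) x)"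
    using Cons.IH h Cons.prems
    by (intro curve_deriv_line[OF smooth_map_open[OF sm] E _ _ _ F] smooth_map_has_dir_deriv[OF sm]) auto
  then show ?case by (simp add: curve_deriv_def limitin_subtopology)
qed (use fF in simp)

text \<open>The chain rule of first order, with an empty list of further directions. Of
  \<open>f\<close> only the one directional derivative is required.\<close>

lemma has_dir_deriv_compose:
  assumes op: "openin (subtopology T E) V" and E: "subspace E" "E \<subseteq> X" and x: "x \<in> V" "h \<in> E"
    and d: "has_dir_deriv T f x h L" and F: "subspace F" "closedin T F"
    and sg: "smooth_map T F W g" and fW: "\<And>y. y \<in> V \<Longrightarrow> f y \<in> W"
  shows "has_dir_deriv T (g \<circ> f) x h (dir_deriv T g (f x) L)"
proof -
  have FX: "F \<subseteq> X" using F(2) closedin_subset by blast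
  have fF: "f y \<in> F" if "y \<in> V" for y
    using open_subtopology_mem[OF smooth_map_open[OF sg] fW[OF that]] by simp
  have "\<forall>\<^sub>F t in at 0. f (x + t *\<^sub>R h) \<in> W"
    using eventually_line[OF op E x] by eventually_elim (rule fW)
  from chain_rule_multi[OF sg F(1) FX this _ curve_deriv_line[OF op E x d F fF] list_all2_Nil[THEN iffD2, OF refl]]
  show ?thesis using fW[OF x(1)] by (simp add: has_dir_deriv_def)
qed

text \<open>The terms of the formula of Faa di Bruno: a derivative of \<open>g\<close> at
  \<open>f x\<close> whose directions are iterated derivatives of \<open>f\<close>, one for each
  block \<open>I\<close> of indices. Coefficients are not tracked; repeated sums account for
  them.\<close>

inductive_set comp_terms for g f where
  zero: "(\<lambda>h x. 0) \<in> comp_terms g f"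
| mono: "(\<lambda>h x. iter_dir_deriv T g (map (\<lambda>I. iter_dir_deriv T f (map h I) x) Is) (f x)) \<in> comp_terms g f"
| plus: "\<lbrakk>\<phi> \<in> comp_terms g f; \<psi> \<in> comp_terms g f\<rbrakk> \<Longrightarrow> (\<lambda>h x. \<phi> h x + \<psi> h x) \<in> comp_terms g f"

text \<open>Differentiating a direction turns its block \<open>I\<close> into \<open>m # I\<close>.
  \<open>As\<close> collects the blocks already passed, which stay as they are.\<close>

lemma deriv_sum_in_comp_terms:
  "(\<lambda>h x. deriv_sum g (f x) (map (\<lambda>I. iter_dir_deriv T f (map h I) x) As)
      (map (\<lambda>I. (iter_dir_deriv T f (map h I) x, iter_dir_deriv T f (h m # map h I) x)) Is)) \<in> comp_terms g f"
proof (induction "Is" arbitrary: As)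
  case Nil
  then show ?case by (simp add: comp_terms.zero)
next
  case (Cons I Is)
  have "(\<lambda>h x. iter_dir_deriv T g (map (\<lambda>I. iter_dir_deriv T f (map h I) x) (As @ (m # I) # Is)) (f x)) \<in> comp_terms g f"
    by (rule comp_terms.mono)
  from comp_terms.plus[OF this Cons.IH[of "As @ [I]"]] show ?case
    by (simp add: o_def)
qed

text \<open>\<open>comp_terms g f\<close> is closed under differentiation by the chain rule with
  several slots. Closedness of \<open>F\<close> makes the derivatives of \<open>f\<close> admissible
  directions for \<open>g\<close>, which is differentiated along \<open>F\<close> only.\<close>

theorem smooth_map_compose:
  assumes sf: "smooth_map T E V f" and E: "subspace E" "E \<subseteq> X"
    and sg: "smooth_map T F W g" and F: "subspace F" "closedin T F" and fW: "f ` V \<subseteq> W"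
  shows "smooth_map T E V (g \<circ> f)"
proof (rule smooth_mapI[OF smooth_map_open[OF sf] E, of _ "comp_terms g f"])
  have FX: "F \<subseteq> X" using F(2) closedin_subset by blast
  have VX: "V \<subseteq> X" using open_subtopology_mem[OF smooth_map_open[OF sf]] by blast
  have fF: "f y \<in> F" if "y \<in> V" for y
    using open_subtopology_mem[OF smooth_map_open[OF sg], of "f y"] fW that by auto
  have fWW: "f y \<in> W" if "y \<in> V" for y using fW that by auto
  have memF: "iter_dir_deriv T f hs x \<in> F" if "set hs \<subseteq> E" "x \<in> V" for hs x
    by (rule smooth_map_iter_mem_closed[OF sf E F fF that])
  show "(\<lambda>h. g \<circ> f) \<in> comp_terms g f"
    using comp_terms.mono[of g f "[]"] by (simp add: o_def)
  have lim: "limitin T (\<lambda>z. iter_dir_deriv T f (map (snd z) I) (fst z)) (iter_dir_deriv T f (map (snd z0) I) (fst z0)) (atin (param_topology E V) z0)"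
    if "z0 \<in> topspace (param_topology E V)" for I z0
  proof -
    have 1: "limitin (subtopology T V) fst (fst z0) (atin (param_topology E V) z0)"
      by (rule limitin_continuous_map[OF continuous_param_point that refl])
    have "list_all2 (\<lambda>\<phi> l. limitin (subtopology T E) \<phi> l (atin (param_topology E V) z0)) (map (\<lambda>i z. snd z i) I) (map (snd z0) I)"
      by (auto simp: list_all2_conv_all_nth intro!: limitin_continuous_map[OF continuous_param_dir that refl])
    from smooth_map_limit[OF sf 1 this] show ?thesis by (simp add: o_def)
  qed
  have memZ: "fst z \<in> V \<and> range (snd z) \<subseteq> E" if "z \<in> topspace (param_topology E V)" for z
    using that topspace_param[OF VX E(2), of "fst z" "snd z"] by simp
  have evZ: "\<forall>\<^sub>F z in atin (param_topology E V) z0. z \<in> topspace (param_topology E V)" for z0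
    unfolding eventually_atin by (intro disjCI exI[of _ "topspace (param_topology E V)"]) auto
  have limF: "limitin (subtopology T F) (\<lambda>z. iter_dir_deriv T f (map (snd z) I) (fst z)) (iter_dir_deriv T f (map (snd z0) I) (fst z0)) (atin (param_topology E V) z0)"
    if z0: "z0 \<in> topspace (param_topology E V)" for I z0
    unfolding limitin_subtopology
  proof (intro conjI lim[OF z0])
    show "iter_dir_deriv T f (map (snd z0) I) (fst z0) \<in> F" using memZ[OF z0] by (intro memF) fastforce+
    show "\<forall>\<^sub>F z in atin (param_topology E V) z0. iter_dir_deriv T f (map (snd z) I) (fst z) \<in> F"
      using evZ
    proof eventually_elim
      case (elim z)
      then show ?case using memZ[OF elim] by (intro memF) fastforce+
    qed
  qed
  fix \<phi> :: "(nat \<Rightarrow> 'v) \<Rightarrow> 'v \<Rightarrow> 'v" assume "\<phi> \<in> comp_terms g f"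
  then show "continuous_map (param_topology E V) T (\<lambda>z. \<phi> (snd z) (fst z))"
  proof induction
    case (mono "Is")
    show ?case
      unfolding continuous_map_atin
    proof
      fix z0 assume z0: "z0 \<in> topspace (param_topology E V)"
      have "limitin (subtopology T W) (\<lambda>z. f (fst z)) (f (fst z0)) (atin (param_topology E V) z0)"
        by (rule limitin_open_subtopology[OF smooth_map_open[OF sg]])
          (use limF[OF z0, of "[]"] fWW memZ[OF z0] in simp_all)
      moreover have "list_all2 (\<lambda>\<phi> l. limitin (subtopology T F) \<phi> l (atin (param_topology E V) z0))
          (map (\<lambda>I z. iter_dir_deriv T f (map (snd z) I) (fst z)) Is)
          (map (\<lambda>I. iter_dir_deriv T f (map (snd z0) I) (fst z0)) Is)"
        by (auto simp: list_all2_conv_all_nth intro!: limF[OF z0])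
      ultimately show "limitin T (\<lambda>z. iter_dir_deriv T g (map (\<lambda>I. iter_dir_deriv T f (map (snd z) I) (fst z)) Is) (f (fst z)))
          (iter_dir_deriv T g (map (\<lambda>I. iter_dir_deriv T f (map (snd z0) I) (fst z0)) Is) (f (fst z0)))
          (atin (param_topology E V) z0)"
        using smooth_map_limit[OF sg] by (fastforce simp: o_def)
    qed
  qed (auto intro: continuous_add)
next
  have FX: "F \<subseteq> X" using F(2) closedin_subset by blast
  have fF: "f y \<in> F" if "y \<in> V" for y
    using open_subtopology_mem[OF smooth_map_open[OF sg], of "f y"] fW that by auto
  have fWW: "f y \<in> W" if "y \<in> V" for y using fW that by auto
  have memF: "iter_dir_deriv T f hs x \<in> F" if "set hs \<subseteq> E" "x \<in> V" for hs x
    by (rule smooth_map_iter_mem_closed[OF sf E F fF that])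
  fix \<phi> :: "(nat \<Rightarrow> 'v) \<Rightarrow> 'v \<Rightarrow> 'v" and m :: nat assume "\<phi> \<in> comp_terms g f"
  then show "\<exists>\<phi>'\<in>comp_terms g f. \<forall>x\<in>V. \<forall>h. range h \<subseteq> E \<longrightarrow> has_dir_deriv T (\<phi> h) x (h m) (\<phi>' h x)"
  proof induction
    case zero
    show ?case by (rule bexI[OF _ comp_terms.zero]) (simp add: has_dir_deriv_const)
  next
    case (plus \<phi> \<psi>)
    then obtain \<phi>' \<psi>' where "\<phi>' \<in> comp_terms g f" "\<psi>' \<in> comp_terms g f"
      "\<forall>x\<in>V. \<forall>h. range h \<subseteq> E \<longrightarrow> has_dir_deriv T (\<phi> h) x (h m) (\<phi>' h x)"
      "\<forall>x\<in>V. \<forall>h. range h \<subseteq> E \<longrightarrow> has_dir_deriv T (\<psi> h) x (h m) (\<psi>' h x)" by metis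
    then show ?case
      by (intro bexI[OF _ comp_terms.plus[of \<phi>' g f \<psi>']]) (auto intro: has_dir_deriv_add)
  next
    case (mono "Is")
    \<comment> \<open>The first summand differentiates the base point \<open>f x\<close> and creates
      the new block \<open>[m]\<close>; the sum differentiates the existing blocks in turn.\<close>
    let ?\<phi>' = "\<lambda>h x. iter_dir_deriv T g (map (\<lambda>I. iter_dir_deriv T f (map h I) x) ([m] # Is)) (f x)
      + deriv_sum g (f x) (map (\<lambda>I. iter_dir_deriv T f (map h I) x) [])
      (map (\<lambda>I. (iter_dir_deriv T f (map h I) x, iter_dir_deriv T f (h m # map h I) x)) Is)"
    show ?case
    proof (rule bexI[of _ ?\<phi>'], intro ballI allI impI)
      show "?\<phi>' \<in> comp_terms g f"
        by (rule comp_terms.plus[OF comp_terms.mono deriv_sum_in_comp_terms])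
      fix x and h :: "nat \<Rightarrow> 'v" assume x: "x \<in> V" and h: "range h \<subseteq> E"
      have hE: "h m \<in> E" "set (map h I) \<subseteq> E" for I using h by auto
      note op = smooth_map_open[OF sf]
      have cd: "curve_deriv F (\<lambda>t. iter_dir_deriv T f (map h I) (x + t *\<^sub>R h m)) (iter_dir_deriv T f (h m # map h I) x)" for I
        by (rule curve_deriv_line[OF op E x hE(1) smooth_map_has_dir_deriv[OF sf hE(2,1) x] F memF[OF hE(2)]])
      have "\<forall>\<^sub>F t in at 0. f (x + t *\<^sub>R h m) \<in> W"
        using eventually_line[OF op E x hE(1)] by eventually_elim (rule fWW)
      moreover have "list_all2 (curve_deriv F) (map (\<lambda>I t. iter_dir_deriv T f (map h I) (x + t *\<^sub>R h m)) Is)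
          (map (\<lambda>I. iter_dir_deriv T f (h m # map h I) x) Is)"
        unfolding list_all2_conv_all_nth using cd by simp
      ultimately have "limitin T (\<lambda>t. (1 / t) *\<^sub>R
          (iter_dir_deriv T g (map (\<lambda>\<psi>. \<psi> t) (map (\<lambda>I t. iter_dir_deriv T f (map h I) (x + t *\<^sub>R h m)) Is)) (f (x + t *\<^sub>R h m))
          - iter_dir_deriv T g (map (\<lambda>\<psi>. \<psi> 0) (map (\<lambda>I t. iter_dir_deriv T f (map h I) (x + t *\<^sub>R h m)) Is)) (f (x + 0 *\<^sub>R h m))))
        (iter_dir_deriv T g (iter_dir_deriv T f [h m] x # map (\<lambda>\<psi>. \<psi> 0) (map (\<lambda>I t. iter_dir_deriv T f (map h I) (x + t *\<^sub>R h m)) Is)) (f (x + 0 *\<^sub>R h m))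
         + deriv_sum g (f (x + 0 *\<^sub>R h m)) [] (zip (map (\<lambda>\<psi>. \<psi> 0) (map (\<lambda>I t. iter_dir_deriv T f (map h I) (x + t *\<^sub>R h m)) Is))
            (map (\<lambda>I. iter_dir_deriv T f (h m # map h I) x) Is))) (at 0)"
        using cd[of "[]"] fWW[OF x]
        by (intro chain_rule_multi[OF sg F(1) FX]) (simp_all del: iter_dir_deriv.simps(2))
      then show "has_dir_deriv T (\<lambda>x. iter_dir_deriv T g (map (\<lambda>I. iter_dir_deriv T f (map h I) x) Is) (f x)) x (h m) (?\<phi>' h x)"
        unfolding has_dir_deriv_def by (simp add: o_def zip_map_map zip_same_conv_map del: iter_dir_deriv.simps(2))
    qed
  qed
qed

text \<open>Derivatives at a point see only a neighbourhood, and joint continuity is pasted from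
  neighbourhoods of the base points times the full space of directions. Charts have smooth
  extensions only locally, so smoothness of transitions is obtained in this way.\<close>

lemma smooth_map_local:
  assumes "openin (subtopology T E) V" "subspace E" "E \<subseteq> X"
    and loc: "\<And>x. x \<in> V \<Longrightarrow> \<exists>V' g. x \<in> V' \<and> smooth_map T E V' g \<and> (\<forall>y\<in>V' \<inter> V. f y = g y)"
  shows "smooth_map T E V f"
proof -
  have loc': "\<exists>U g. x \<in> U \<and> U \<subseteq> V \<and> openin (subtopology T E) U \<and> smooth_map T E U g \<and> (\<forall>y\<in>U. f y = g y)" if x: "x \<in> V" for x
  proof -
    obtain V' g where V': "x \<in> V'" "smooth_map T E V' g" "\<forall>y\<in>V' \<inter> V. f y = g y" using loc[OF x] by blast
    let ?U = "V' \<inter> V"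
    have op: "openin (subtopology T E) ?U" using smooth_map_open[OF V'(2)] assms(1) by blast
    have "smooth_map T E ?U g"
      unfolding smooth_map_def
    proof (intro conjI allI op)
      fix k :: nat
      have "continuous_map (prod_topology (subtopology T V') (product_topology (\<lambda>_. subtopology T E) {..<k})) T
          (\<lambda>(x, h). iter_dir_deriv T g (map h [0..<k]) x)"
        using V'(2) unfolding smooth_map_def by blast
      from continuous_map_from_subtopology[OF this, of "?U \<times> UNIV"]
      have "continuous_map (subtopology (prod_topology (subtopology T V') (product_topology (\<lambda>_. subtopology T E) {..<k})) (?U \<times> UNIV)) T
          (\<lambda>(x, h). iter_dir_deriv T g (map h [0..<k]) x)" .
      moreover have "subtopology (prod_topology (subtopology T V') (product_topology (\<lambda>_. subtopology T E) {..<k})) (?U \<times> UNIV)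
        = prod_topology (subtopology T ?U) (product_topology (\<lambda>_. subtopology T E) {..<k})"
        by (simp add: subtopology_Times subtopology_subtopology inf.absorb2 Int_assoc[symmetric])
      ultimately show "continuous_map (prod_topology (subtopology T ?U) (product_topology (\<lambda>_. subtopology T E) {..<k})) T
          (\<lambda>(x, h). iter_dir_deriv T g (map h [0..<k]) x)" by simp
    qed (use V'(2) in \<open>unfold smooth_map_def, blast+\<close>)
    with V' op x show ?thesis by blast
  qed
  show ?thesis
    unfolding smooth_map_def
  proof (intro conjI allI impI ballI assms(1))
    show "f ` V \<subseteq> X"
    proof
      fix y assume "y \<in> f ` V"
      then obtain x where x: "x \<in> V" "y = f x" by blast
      from loc'[OF x(1)] x(2) show "y \<in> X" unfolding smooth_map_def by force
    qed
  next
    fix hs h x assume hs: "set hs \<subseteq> E" "h \<in> E" "x \<in> V"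
    obtain U g where U: "x \<in> U" "openin (subtopology T E) U" "smooth_map T E U g" "\<forall>y\<in>U. f y = g y"
      using loc'[OF hs(3)] by blast
    have "has_dir_deriv T (iter_dir_deriv T f hs) x h = has_dir_deriv T (iter_dir_deriv T g hs) x h"
      by (rule has_dir_deriv_cong[OF U(2) assms(2,3) U(1) hs(2)])
        (rule iter_dir_deriv_cong[OF U(2) assms(2,3)], use U hs in auto)
    then show "\<exists>L. has_dir_deriv T (iter_dir_deriv T f hs) x h L"
      using smooth_map_has_dir_deriv[OF U(3) hs(1,2) U(1)] by auto
  next
    fix k :: nat
    let ?Q = "product_topology (\<lambda>_. subtopology T E) {..<k}"
    let ?Z = "prod_topology (subtopology T V) ?Q"
    let ?f = "\<lambda>f (x, h). iter_dir_deriv T f (map h [0..<k]) x"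
    have VX: "V \<subseteq> X" using assms(1) open_subtopology_mem by blast
    have "\<exists>\<U>. (\<forall>x\<in>V. x \<in> \<U> x \<and> \<U> x \<subseteq> V \<and> openin (subtopology T E) (\<U> x) \<and>
        (\<exists>g. smooth_map T E (\<U> x) g \<and> (\<forall>y\<in>\<U> x. f y = g y)))"
      using loc' by metis
    then obtain \<U> where U: "\<And>x. x \<in> V \<Longrightarrow> x \<in> \<U> x" "\<And>x. x \<in> V \<Longrightarrow> \<U> x \<subseteq> V"
      "\<And>x. x \<in> V \<Longrightarrow> openin (subtopology T E) (\<U> x)"
      "\<And>x. x \<in> V \<Longrightarrow> \<exists>g. smooth_map T E (\<U> x) g \<and> (\<forall>y\<in>\<U> x. f y = g y)"
      by blast
    show "continuous_map ?Z T (?f f)"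
    \<comment> \<open>The points of \<open>V\<close> index their own neighbourhoods, and all
      functions to be pasted are the same one; only its continuity on the pieces is at
      stake.\<close>
    proof (rule pasting_lemma[where I=V and T="\<lambda>x. \<U> x \<times> topspace ?Q" and f="\<lambda>_. ?f f"])
      fix x assume x: "x \<in> V"
      have "openin (subtopology T V) (\<U> x)"
      proof -
        obtain O' where "openin T O'" "\<U> x = O' \<inter> E" using U(3)[OF x] by (auto simp: openin_subtopology)
        moreover have "V \<subseteq> E" using assms(1) open_subtopology_mem by blast
        ultimately show ?thesis using U(2)[OF x] by (auto simp: openin_subtopology)
      qed
      then show "openin ?Z (\<U> x \<times> topspace ?Q)"
        unfolding openin_prod_Times_iff using openin_topspace by blast
      obtain g where g: "smooth_map T E (\<U> x) g" "\<forall>y\<in>\<U> x. f y = g y" using U(4)[OF x] by blast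
      have "subtopology ?Z (\<U> x \<times> topspace ?Q) = prod_topology (subtopology T (\<U> x)) ?Q"
        using U(2)[OF x]
        by (simp add: subtopology_Times subtopology_subtopology inf.absorb2 del: topspace_product_topology)
      moreover have "continuous_map (prod_topology (subtopology T (\<U> x)) ?Q) T (?f f)"
      proof (rule continuous_map_eq)
        show "continuous_map (prod_topology (subtopology T (\<U> x)) ?Q) T (?f g)"
          using g(1) unfolding smooth_map_def by blast
        fix z assume "z \<in> topspace (prod_topology (subtopology T (\<U> x)) ?Q)"
        then have z: "fst z \<in> \<U> x" "set (map (snd z) [0..<k]) \<subseteq> E"
          by (auto simp: mem_Times_iff PiE_iff)
        show "?f g z = ?f f z"
          using iter_dir_deriv_cong[OF U(3)[OF x] assms(2,3) _ z(2,1), of f g] g(2)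
          by (simp add: case_prod_unfold)
      qed
      ultimately show "continuous_map (subtopology ?Z (\<U> x \<times> topspace ?Q)) T (?f f)" by simp
    next
      fix z assume z: "z \<in> topspace ?Z"
      show "\<exists>x. x \<in> V \<and> z \<in> \<U> x \<times> topspace ?Q \<and> ?f f z = ?f f z"
        using z U(1)[of "fst z"] by (intro exI[of _ "fst z"]) (auto simp: mem_Times_iff)
    qed simp
  qed
qed

section \<open>Charts inducing an almost complex structure\<close>

lemma smooth_map_continuous:
  assumes "smooth_map T E V f"
  shows "continuous_map (subtopology T V) T f"
  unfolding continuous_map_atin
proof
  fix x assume x: "x \<in> topspace (subtopology T V)"
  have "limitin (subtopology T V) (\<lambda>y. y) x (atin (subtopology T V) x)"
    using limitin_continuous_map[OF continuous_map_id x refl] by (simp add: id_def)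
  from smooth_map_limit[OF assms this list_all2_Nil[THEN iffD2, OF refl]]
  show "limitin T f (f x) (atin (subtopology T V) x)" by simp
qed

lemma smooth_map_cong:
  assumes "smooth_map T E V f" "subspace E" "E \<subseteq> X" "\<And>y. y \<in> V \<Longrightarrow> g y = f y"
  shows "smooth_map T E V g"
  by (rule smooth_map_local[OF smooth_map_open[OF assms(1)] assms(2,3)]) (use assms in blast)

lemma smooth_map_subset:
  assumes "smooth_map T E V f" "subspace E" "E \<subseteq> X" "openin (subtopology T E) V'" "V' \<subseteq> V"
  shows "smooth_map T E V' f"
  by (rule smooth_map_local[OF assms(4,2,3)]) (use assms in blast)

lemma openin_subtopology_trans:
  "\<lbrakk>openin (subtopology T U) W; openin (subtopology T E) U\<rbrakk> \<Longrightarrow> openin (subtopology T E) W"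
  unfolding openin_subtopology by (metis inf_assoc openin_Int)

lemma openin_subtopology_Int_dom:
  "\<lbrakk>openin (subtopology T S) A; openin (subtopology T S) B\<rbrakk> \<Longrightarrow> openin (subtopology T A) (A \<inter> B)"
  unfolding openin_subtopology by blast

context
  fixes S c
  assumes c: "smooth_chart T S c"
begin

lemma chart_model: "subspace (cmodel c)" "closedin T (cmodel c)" "cmodel c \<subseteq> X"
  and chart_str: "h \<in> cmodel c \<Longrightarrow> cstr c h \<in> cmodel c"
  using c closedin_subset by (auto simp: smooth_chart_def complex_model_def)

lemma chart_open: "openin (subtopology T S) (cdom c)" "openin (subtopology T (cmodel c)) (cimg c)"
  and chart_inv_smooth: "smooth_map T (cmodel c) (cimg c) (cinv c)"
  and chart_homeo: "homeomorphic_map (subtopology T (cdom c)) (subtopology T (cimg c)) (cmap c)"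
  using c by (auto simp: smooth_chart_def)

lemma chart_dom: "cdom c \<subseteq> X" "cdom c \<subseteq> S"
  using openin_subset[OF chart_open(1)] by auto

lemma chart_img: "cimg c \<subseteq> cmodel c"
  using openin_subset[OF chart_open(2)] by auto

lemma chart_inj: "inj_on (cmap c) (cdom c)"
  using homeomorphic_imp_injective_map[OF chart_homeo] chart_dom by (simp add: inf.absorb2)

lemma cinv_cmap: "x \<in> cdom c \<Longrightarrow> cinv c (cmap c x) = x"
  unfolding cinv_def by (rule inv_into_f_f[OF chart_inj])

lemma cmap_cinv: "v \<in> cimg c \<Longrightarrow> cmap c (cinv c v) = v" and cinv_mem: "v \<in> cimg c \<Longrightarrow> cinv c v \<in> cdom c"
  unfolding cinv_def cimg_def by (auto intro: f_inv_into_f inv_into_into)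

end

lemma overlap_open:
  assumes c: "smooth_chart T S c" and d: "smooth_chart T S d"
  shows "openin (subtopology T (cmodel c)) (cmap c ` (cdom c \<inter> cdom d))"
proof (rule openin_subtopology_trans[OF _ chart_open(2)[OF c]])
  have "open_map (subtopology T (cdom c)) (subtopology T (cimg c)) (cmap c)"
    by (rule homeomorphic_imp_open_map[OF chart_homeo[OF c]])
  then show "openin (subtopology T (cimg c)) (cmap c ` (cdom c \<inter> cdom d))"
    using openin_subtopology_Int_dom[OF chart_open(1)[OF c] chart_open(1)[OF d]]
    by (simp add: open_map_def)
qed

lemma transition_mem:
  assumes c: "smooth_chart T S c" and d: "smooth_chart T S d" and v: "v \<in> cmap c ` (cdom c \<inter> cdom d)"
  shows "cinv c v \<in> cdom c \<inter> cdom d" "(cmap d \<circ> cinv c) v \<in> cmap d ` (cdom d \<inter> cdom c)"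
    "cinv d ((cmap d \<circ> cinv c) v) = cinv c v" "v \<in> cimg c" "(cmap d \<circ> cinv c) v \<in> cimg d"
    "(cmap d \<circ> cinv c) v \<in> cmodel d"
proof -
  obtain x where x: "x \<in> cdom c" "x \<in> cdom d" "v = cmap c x" using v by blast
  then show "cinv c v \<in> cdom c \<inter> cdom d" "(cmap d \<circ> cinv c) v \<in> cmap d ` (cdom d \<inter> cdom c)"
    "cinv d ((cmap d \<circ> cinv c) v) = cinv c v" "v \<in> cimg c" "(cmap d \<circ> cinv c) v \<in> cimg d"
    using cinv_cmap[OF c] cinv_cmap[OF d] by (auto simp: cimg_def)
  then show "(cmap d \<circ> cinv c) v \<in> cmodel d" using chart_img[OF d] by blast
qed

text \<open>Near \<open>v\<close> the map \<open>cmap d\<close> is replaced by a smooth ambient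
  extension \<open>f\<close> defined on an open \<open>W\<close>; composition applies on the part of
  the overlap that \<open>cinv c\<close> sends into \<open>W\<close>.\<close>

lemma smooth_transition:
  assumes c: "smooth_chart T S c" and d: "smooth_chart T S d"
  shows "smooth_map T (cmodel c) (cmap c ` (cdom c \<inter> cdom d)) (cmap d \<circ> cinv c)"
proof (rule smooth_map_local[OF overlap_open[OF c d] chart_model(1,3)[OF c]])
  let ?V = "cmap c ` (cdom c \<inter> cdom d)"
  fix v assume v: "v \<in> ?V"
  have "cinv c v \<in> cdom d" using transition_mem[OF c d v] by simp
  then obtain W f where W: "cinv c v \<in> W" "smooth_map T X W f" "\<forall>y \<in> W \<inter> cdom d. f y = cmap d y"
    using d unfolding smooth_chart_def by blast
  have sV: "smooth_map T (cmodel c) ?V (cinv c)"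
    using transition_mem(4)[OF c d]
    by (intro smooth_map_subset[OF chart_inv_smooth[OF c] chart_model(1,3)[OF c] overlap_open[OF c d]]) blast
  have opW: "openin T W" using smooth_map_open[OF W(2)] by simp
  let ?V' = "{w \<in> topspace (subtopology T ?V). cinv c w \<in> W}"
  have "openin (subtopology T ?V) ?V'"
    by (rule openin_continuous_map_preimage[OF smooth_map_continuous[OF sV] opW])
  then have op': "openin (subtopology T (cmodel c)) ?V'"
    using openin_subtopology_trans overlap_open[OF c d] by blast
  have "smooth_map T (cmodel c) ?V' (f \<circ> cinv c)"
    by (rule smooth_map_compose[OF _ chart_model(1,3)[OF c] W(2) subspace_topspace closedin_topspace])
      (use smooth_map_subset[OF sV chart_model(1,3)[OF c] op'] in auto)
  moreover have "v \<in> ?V'"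
    using v W(1) transition_mem(4)[OF c d v] chart_img[OF c] chart_model(3)[OF c] by auto
  moreover have "\<forall>y\<in>?V' \<inter> ?V. (cmap d \<circ> cinv c) y = (f \<circ> cinv c) y"
    using W(3) transition_mem(1)[OF c d] by simp
  ultimately show "\<exists>V' g. v \<in> V' \<and> smooth_map T (cmodel c) V' g \<and> (\<forall>y\<in>V' \<inter> ?V. (cmap d \<circ> cinv c) y = g y)"
    by (intro exI[of _ ?V'] exI[of _ "f \<circ> cinv c"] conjI)
qed

lemma dir_deriv_closed:
  assumes "smooth_map T E V f" "subspace E" "E \<subseteq> X" "subspace F" "closedin T F" "\<And>y. y \<in> V \<Longrightarrow> f y \<in> F"
    "h \<in> E" "x \<in> V"
  shows "dir_deriv T f x h \<in> F"
  using smooth_map_iter_mem_closed[OF assms(1-6), of "[h]" x] assms(7,8) by simp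

text \<open>The chain rule for \<open>cinv d \<circ> (cmap d \<circ> cinv c)\<close>, which agrees
  with \<open>cinv c\<close> on the overlap.\<close>

lemma transition_deriv:
  assumes c: "smooth_chart T S c" and d: "smooth_chart T S d"
    and v: "v \<in> cmap c ` (cdom c \<inter> cdom d)" and h: "h \<in> cmodel c"
  shows "dir_deriv T (cmap d \<circ> cinv c) v h \<in> cmodel d"
    and "dir_deriv T (cinv d) ((cmap d \<circ> cinv c) v) (dir_deriv T (cmap d \<circ> cinv c) v h) = dir_deriv T (cinv c) v h"
proof -
  let ?\<tau> = "cmap d \<circ> cinv c"
  note E = chart_model(1,3)[OF c] and F = chart_model(1,2)[OF d]
  show "dir_deriv T ?\<tau> v h \<in> cmodel d"
    by (rule dir_deriv_closed[OF smooth_transition[OF c d] E F transition_mem(6)[OF c d] h v])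
  have "has_dir_deriv T (cinv d \<circ> ?\<tau>) v h (dir_deriv T (cinv d) (?\<tau> v) (dir_deriv T ?\<tau> v h))"
    by (rule has_dir_deriv_compose[OF overlap_open[OF c d] E v h
        smooth_map_has_dir_deriv1[OF smooth_transition[OF c d] h v] F chart_inv_smooth[OF d] transition_mem(5)[OF c d]])
  then have "dir_deriv T (cinv d \<circ> ?\<tau>) v h = dir_deriv T (cinv d) (?\<tau> v) (dir_deriv T ?\<tau> v h)"
    by (rule dir_deriv_eq)
  moreover have "dir_deriv T (cinv d \<circ> ?\<tau>) v h = dir_deriv T (cinv c) v h"
    using transition_mem(3)[OF c d] by (intro dir_deriv_cong[OF overlap_open[OF c d] E v h]) simp
  ultimately show "dir_deriv T (cinv d) (?\<tau> v) (dir_deriv T ?\<tau> v h) = dir_deriv T (cinv c) v h" by simp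
qed

text \<open>The chain rule for the composition of the two opposite transitions, which is the
  identity on the overlap. It supplies the inverse of the differential of a transition.\<close>

lemma transition_deriv_inverse:
  assumes c: "smooth_chart T S c" and d: "smooth_chart T S d"
    and v: "v \<in> cmap c ` (cdom c \<inter> cdom d)" and h: "h \<in> cmodel c"
  shows "dir_deriv T (cmap c \<circ> cinv d) ((cmap d \<circ> cinv c) v) (dir_deriv T (cmap d \<circ> cinv c) v h) = h"
proof -
  let ?\<tau> = "cmap d \<circ> cinv c" and ?\<sigma> = "cmap c \<circ> cinv d"
  note E = chart_model(1,3)[OF c] and F = chart_model(1,2)[OF d]
  have "has_dir_deriv T (?\<sigma> \<circ> ?\<tau>) v h (dir_deriv T ?\<sigma> (?\<tau> v) (dir_deriv T ?\<tau> v h))"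
    by (rule has_dir_deriv_compose[OF overlap_open[OF c d] E v h
        smooth_map_has_dir_deriv1[OF smooth_transition[OF c d] h v] F smooth_transition[OF d c] transition_mem(2)[OF c d]])
  then have "dir_deriv T (?\<sigma> \<circ> ?\<tau>) v h = dir_deriv T ?\<sigma> (?\<tau> v) (dir_deriv T ?\<tau> v h)"
    by (rule dir_deriv_eq)
  moreover have "dir_deriv T (?\<sigma> \<circ> ?\<tau>) v h = dir_deriv T (\<lambda>x. x) v h"
    using transition_mem(3,4)[OF c d] cmap_cinv[OF c]
    by (intro dir_deriv_cong[OF overlap_open[OF c d] E v h]) simp
  moreover have "dir_deriv T (\<lambda>x. x) v h = h"
    using h E by (intro dir_deriv_eq has_dir_deriv_ident) auto
  ultimately show ?thesis by simp
qed

text \<open>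
  The differentials of the inverse charts are injective and complex linear, and that of the
  transition map is their quotient.
\<close>

lemma holomorphic_transition_induced:
  assumes c: "smooth_chart T S c" and d: "smooth_chart T S d"
    and ind: "induces T TS {c, d} JJ"
  shows "holomorphic_transition T c d"
  unfolding holomorphic_transition_def holomorphic_map_def
proof (intro conjI ballI smooth_transition[OF c d])
  let ?\<tau> = "cmap d \<circ> cinv c"
  show "?\<tau> ` (cmap c ` (cdom c \<inter> cdom d)) \<subseteq> cmodel d" using transition_mem(6)[OF c d] by blast
  fix v h assume v: "v \<in> cmap c ` (cdom c \<inter> cdom d)" and h: "h \<in> cmodel c"
  note m = transition_mem[OF c d v]
  have "inj_on (dir_deriv T (cinv d) (?\<tau> v)) (cmodel d)"
    using ind m(5) unfolding induces_def bij_betw_def by blast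
  moreover have "dir_deriv T (cinv d) (?\<tau> v) (dir_deriv T ?\<tau> v (cstr c h)) =
      dir_deriv T (cinv d) (?\<tau> v) (cstr d (dir_deriv T ?\<tau> v h))"
  proof -
    have "dir_deriv T (cinv d) (?\<tau> v) (dir_deriv T ?\<tau> v (cstr c h)) = dir_deriv T (cinv c) v (cstr c h)"
      by (rule transition_deriv(2)[OF c d v chart_str[OF c h]])
    also have "\<dots> = JJ (cinv c v) (dir_deriv T (cinv c) v h)"
      using ind m(4) h unfolding induces_def by blast
    also have "\<dots> = JJ (cinv d (?\<tau> v)) (dir_deriv T (cinv d) (?\<tau> v) (dir_deriv T ?\<tau> v h))"
      unfolding m(3) transition_deriv(2)[OF c d v h] ..
    also have "\<dots> = dir_deriv T (cinv d) (?\<tau> v) (cstr d (dir_deriv T ?\<tau> v h))"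
      using ind m(5) transition_deriv(1)[OF c d v h] unfolding induces_def by simp
    finally show ?thesis .
  qed
  ultimately show "dir_deriv T ?\<tau> v (cstr c h) = cstr d (dir_deriv T ?\<tau> v h)"
    using transition_deriv(1)[OF c d v] h chart_str[OF c] chart_str[OF d] by (meson inj_onD)
qed

text \<open>Around a given point \<open>cinv c\<close> factors through a chart \<open>d\<close> of
  the family. The differential of the transition is a complex linear bijection of the models, so
  both requirements of \<open>induces\<close> pass from \<open>d\<close> to
  \<open>c\<close>.\<close>

lemma induces_compatible:
  assumes c: "smooth_chart T S c" and D: "\<And>d. d \<in> \<D> \<Longrightarrow> smooth_chart T S d" "(\<Union>d\<in>\<D>. cdom d) = S"
    and ind: "induces T TS \<D> JJ" and hol: "\<And>d. d \<in> \<D> \<Longrightarrow> holomorphic_transition T c d"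
  shows "induces T TS {c} JJ"
proof -
  have "bij_betw (dir_deriv T (cinv c) v) (cmodel c) (TS (cinv c v)) \<and>
      (\<forall>h\<in>cmodel c. dir_deriv T (cinv c) v (cstr c h) = JJ (cinv c v) (dir_deriv T (cinv c) v h))"
    if v: "v \<in> cimg c" for v
  proof -
    obtain d where d: "d \<in> \<D>" "cinv c v \<in> cdom d"
      using cinv_mem[OF c v] chart_dom(2)[OF c] D(2) by blast
    let ?\<tau> = "cmap d \<circ> cinv c" and ?\<sigma> = "cmap c \<circ> cinv d"
    note sd = D(1)[OF d(1)]
    have v': "v \<in> cmap c ` (cdom c \<inter> cdom d)"
      using cmap_cinv[OF c v] cinv_mem[OF c v] d(2) by (metis IntI imageI)
    note m = transition_mem[OF c sd v']
    have vv: "?\<sigma> (?\<tau> v) = v" using m(3) cmap_cinv[OF c v] by simp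
    have "bij_betw (dir_deriv T ?\<tau> v) (cmodel c) (cmodel d)"
      by (rule bij_betw_byWitness[where f'="dir_deriv T ?\<sigma> (?\<tau> v)"])
        (use transition_deriv_inverse[OF c sd v'] transition_deriv_inverse[OF sd c m(2)]
          transition_deriv(1)[OF c sd v'] transition_deriv(1)[OF sd c m(2)] vv in auto)
    moreover have "bij_betw (dir_deriv T (cinv d) (?\<tau> v)) (cmodel d) (TS (cinv c v))"
      using ind d(1) m(3,5) unfolding induces_def by metis
    ultimately have "bij_betw (dir_deriv T (cinv d) (?\<tau> v) \<circ> dir_deriv T ?\<tau> v) (cmodel c) (TS (cinv c v))"
      by (rule bij_betw_trans)
    then have "bij_betw (dir_deriv T (cinv c) v) (cmodel c) (TS (cinv c v))"
      by (rule bij_betw_cong[THEN iffD1, rotated]) (simp add: transition_deriv(2)[OF c sd v', unfolded o_def] o_def)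
    moreover have "dir_deriv T (cinv c) v (cstr c h) = JJ (cinv c v) (dir_deriv T (cinv c) v h)"
      if h: "h \<in> cmodel c" for h
    proof -
      have "dir_deriv T (cinv c) v (cstr c h) = dir_deriv T (cinv d) (?\<tau> v) (dir_deriv T ?\<tau> v (cstr c h))"
        using transition_deriv(2)[OF c sd v' chart_str[OF c h]] ..
      also have "dir_deriv T ?\<tau> v (cstr c h) = cstr d (dir_deriv T ?\<tau> v h)"
        using hol[OF d(1)] v' h unfolding holomorphic_transition_def holomorphic_map_def by blast
      also have "dir_deriv T (cinv d) (?\<tau> v) \<dots> = JJ (cinv d (?\<tau> v)) (dir_deriv T (cinv d) (?\<tau> v) (dir_deriv T ?\<tau> v h))"
        using ind d(1) m(5) transition_deriv(1)[OF c sd v' h] unfolding induces_def by blast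
      finally show ?thesis unfolding m(3) transition_deriv(2)[OF c sd v' h] .
    qed
    ultimately show ?thesis by blast
  qed
  then show ?thesis by (simp add: induces_def)
qed

lemma induces_iff: "induces T TS \<C> JJ \<longleftrightarrow> (\<forall>c\<in>\<C>. induces T TS {c} JJ)"
  by (simp add: induces_def)

section \<open>Complex structures that induce a given almost complex structure\<close>

context
  fixes S TS JJ \<D>
  assumes smooth: "\<And>d. d \<in> \<D> \<Longrightarrow> smooth_chart T S d" and cover: "(\<Union>d\<in>\<D>. cdom d) = S"
    and ind: "induces T TS \<D> JJ"
begin

lemma holomorphic_transition_pair:
  "\<lbrakk>smooth_chart T S c; smooth_chart T S d; induces T TS {c} JJ; induces T TS {d} JJ\<rbrakk> \<Longrightarrow> holomorphic_transition T c d"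
  by (rule holomorphic_transition_induced) (auto simp: induces_def)

lemma complex_atlas_induced: "complex_atlas T S \<D>"
  unfolding complex_atlas_def
  using smooth cover ind by (auto simp: induces_iff[of _ \<D>] intro: holomorphic_transition_pair)

text \<open>The right-hand side no longer mentions \<open>\<D>\<close>: all covering families of
  smooth charts inducing \<open>JJ\<close> generate the same set of charts. This is the source of
  uniqueness.\<close>

lemma complex_structure_of_induced:
  "complex_structure_of T S \<D> = {c. smooth_chart T S c \<and> induces T TS {c} JJ}"
proof (intro equalityI subsetI CollectI conjI)
  fix c assume "c \<in> complex_structure_of T S \<D>"
  then show "smooth_chart T S c" "induces T TS {c} JJ"
    by (auto simp: complex_structure_of_def intro: induces_compatible[OF _ smooth cover ind])
next
  fix c assume "c \<in> {c. smooth_chart T S c \<and> induces T TS {c} JJ}"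
  then show "c \<in> complex_structure_of T S \<D>"
    using smooth ind by (auto simp: complex_structure_of_def induces_iff[of _ \<D>] intro: holomorphic_transition_pair)
qed

end

text \<open>A complex structure inducing \<open>JJ\<close> consists of inducing charts, and by its
  maximality it contains all of them. Conversely that set of charts is itself a covering, inducing
  family, so it equals what it generates.\<close>

theorem unique_induced_complex_structure:
  assumes smooth: "\<And>d. d \<in> \<D> \<Longrightarrow> smooth_chart T S d" and cover: "(\<Union>d\<in>\<D>. cdom d) = S"
    and ind: "induces T TS \<D> JJ"
  shows "complex_structure T S \<C> \<and> induces T TS \<C> JJ \<longleftrightarrow> \<C> = complex_structure_of T S \<D>"
proof
  assume L: "complex_structure T S \<C> \<and> induces T TS \<C> JJ"
  then have C: "\<And>c. c \<in> \<C> \<Longrightarrow> smooth_chart T S c" "(\<Union>d\<in>\<C>. cdom d) = S" "induces T TS \<C> JJ"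
    by (auto simp: complex_structure_def complex_atlas_def)
  have "{c. smooth_chart T S c \<and> induces T TS {c} JJ} \<subseteq> \<C>"
    using L complex_structure_of_induced[OF C] by (simp add: complex_structure_def)
  then have "\<C> = {c. smooth_chart T S c \<and> induces T TS {c} JJ}"
    using C(1,3) induces_iff[of TS \<C> JJ] by blast
  then show "\<C> = complex_structure_of T S \<D>"
    using complex_structure_of_induced[OF smooth cover ind] by simp
next
  define \<M> where "\<M> = complex_structure_of T S \<D>"
  have M: "\<M> = {c. smooth_chart T S c \<and> induces T TS {c} JJ}"
    unfolding \<M>_def by (rule complex_structure_of_induced[OF smooth cover ind])
  have sm: "\<And>c. c \<in> \<M> \<Longrightarrow> smooth_chart T S c" and indM: "induces T TS \<M> JJ"
    unfolding M induces_iff[of _ "{c. smooth_chart T S c \<and> induces T TS {c} JJ}"] by auto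
  have "\<D> \<subseteq> \<M>" using smooth ind by (auto simp: M induces_iff[of _ \<D>])
  then have cov: "(\<Union>d\<in>\<M>. cdom d) = S"
    using cover chart_dom(2)[OF sm] by blast
  have "complex_structure T S \<M>"
    unfolding complex_structure_def
  proof
    show "complex_atlas T S \<M>"
      by (rule complex_atlas_induced[OF _ cov indM]) (rule sm)
    have "complex_structure_of T S \<M> = {c. smooth_chart T S c \<and> induces T TS {c} JJ}"
      by (rule complex_structure_of_induced[OF _ cov indM]) (rule sm)
    then show "complex_structure_of T S \<M> \<subseteq> \<M>" using M by simp
  qed
  moreover assume "\<C> = complex_structure_of T S \<D>"
  ultimately show "complex_structure T S \<C> \<and> induces T TS \<C> JJ" using indM by (simp add: \<M>_def)
qed

end

section \<open>Continuous inverse algebras\<close>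

text \<open>The laws are restricted to \<open>topspace T\<close> because the ambient type contains
  objects that are not elements of the algebra. \<open>G\<close> is exactly the group of units: its
  elements have inverses, and \<open>unit_in_G\<close> gives the converse. Off \<open>G\<close> the
  function \<open>inv\<close> is arbitrary.\<close>

locale continuous_inverse_algebra = seminormed_space +
  fixes mul :: "'a \<Rightarrow> 'a \<Rightarrow> 'a" (infixl "\<cdot>" 70) and one :: 'a ("\<e>") and inv :: "'a \<Rightarrow> 'a" and G :: "'a set"
  assumes mul_closed [simp, intro]: "\<lbrakk>x \<in> topspace T; y \<in> topspace T\<rbrakk> \<Longrightarrow> x \<cdot> y \<in> topspace T"
    and one_closed [simp, intro]: "\<e> \<in> topspace T"
    and mul_assoc: "\<lbrakk>x \<in> topspace T; y \<in> topspace T; z \<in> topspace T\<rbrakk> \<Longrightarrow> x \<cdot> y \<cdot> z = x \<cdot> (y \<cdot> z)"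
    and mul_add_left: "\<lbrakk>x \<in> topspace T; y \<in> topspace T; z \<in> topspace T\<rbrakk> \<Longrightarrow> (x + y) \<cdot> z = x \<cdot> z + y \<cdot> z"
    and mul_add_right: "\<lbrakk>x \<in> topspace T; y \<in> topspace T; z \<in> topspace T\<rbrakk> \<Longrightarrow> z \<cdot> (x + y) = z \<cdot> x + z \<cdot> y"
    and mul_scale_left: "\<lbrakk>x \<in> topspace T; y \<in> topspace T\<rbrakk> \<Longrightarrow> (r *\<^sub>R x) \<cdot> y = r *\<^sub>R (x \<cdot> y)"
    and mul_scale_right: "\<lbrakk>x \<in> topspace T; y \<in> topspace T\<rbrakk> \<Longrightarrow> x \<cdot> (r *\<^sub>R y) = r *\<^sub>R (x \<cdot> y)"
    and one_left [simp]: "x \<in> topspace T \<Longrightarrow> \<e> \<cdot> x = x"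
    and one_right [simp]: "x \<in> topspace T \<Longrightarrow> x \<cdot> \<e> = x"
    and mul_continuous: "continuous_map (prod_topology T T) T (\<lambda>(x, y). x \<cdot> y)"
    and G_open: "openin T G"
    and inv_closed [simp, intro]: "x \<in> G \<Longrightarrow> inv x \<in> topspace T"
    and inv_left [simp]: "x \<in> G \<Longrightarrow> inv x \<cdot> x = \<e>"
    and inv_right [simp]: "x \<in> G \<Longrightarrow> x \<cdot> inv x = \<e>"
    and unit_in_G: "\<lbrakk>x \<in> topspace T; y \<in> topspace T; x \<cdot> y = \<e>; y \<cdot> x = \<e>\<rbrakk> \<Longrightarrow> x \<in> G"
    and inv_continuous: "continuous_map (subtopology T G) T inv"
begin

lemma G_subset: "x \<in> G \<Longrightarrow> x \<in> X"
  using openin_subset[OF G_open] by blast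

lemma mul_minus_left: "\<lbrakk>x \<in> X; y \<in> X\<rbrakk> \<Longrightarrow> (- x) \<cdot> y = - (x \<cdot> y)"
  using mul_scale_left[of x y "-1"] by simp

lemma mul_minus_right: "\<lbrakk>x \<in> X; y \<in> X\<rbrakk> \<Longrightarrow> x \<cdot> (- y) = - (x \<cdot> y)"
  using mul_scale_right[of x y "-1"] by simp

lemma mul_diff_left: "\<lbrakk>x \<in> X; y \<in> X; z \<in> X\<rbrakk> \<Longrightarrow> (x - y) \<cdot> z = x \<cdot> z - y \<cdot> z"
  using mul_add_left[of x "- y" z] by (simp add: mul_minus_left)

lemma mul_diff_right: "\<lbrakk>x \<in> X; y \<in> X; z \<in> X\<rbrakk> \<Longrightarrow> z \<cdot> (x - y) = z \<cdot> x - z \<cdot> y"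
  using mul_add_right[of x "- y" z] by (simp add: mul_minus_right)

lemma mul_zero: "x \<in> X \<Longrightarrow> 0 \<cdot> x = 0" "x \<in> X \<Longrightarrow> x \<cdot> 0 = 0"
  using mul_scale_left[of x x 0] mul_scale_right[of x x 0] by auto

lemmas mul_simps = mul_assoc mul_add_left mul_add_right mul_diff_left mul_diff_right
  mul_minus_left mul_minus_right mul_scale_left mul_scale_right mul_zero

lemma inv_left': "\<lbrakk>x \<in> G; y \<in> X\<rbrakk> \<Longrightarrow> inv x \<cdot> (x \<cdot> y) = y"
  using mul_assoc[of "inv x" x y] G_subset by simp

lemma inv_right': "\<lbrakk>x \<in> G; y \<in> X\<rbrakk> \<Longrightarrow> x \<cdot> (inv x \<cdot> y) = y"
  using mul_assoc[of x "inv x" y] G_subset by simp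

lemma G_mul: "\<lbrakk>x \<in> G; y \<in> G\<rbrakk> \<Longrightarrow> x \<cdot> y \<in> G"
  by (rule unit_in_G[of _ "inv y \<cdot> inv x"]) (simp_all add: mul_assoc inv_left' inv_right' G_subset)

lemma G_scale: "\<lbrakk>x \<in> G; r \<noteq> 0\<rbrakk> \<Longrightarrow> r *\<^sub>R x \<in> G"
  by (rule unit_in_G[of _ "(1 / r) *\<^sub>R inv x"]) (simp_all add: mul_scale_left mul_scale_right G_subset)

lemma G_inv: "x \<in> G \<Longrightarrow> inv x \<in> G"
  by (rule unit_in_G[of _ x]) (auto simp: G_subset)

lemma G_one: "\<e> \<in> G"
  by (rule unit_in_G[of _ \<e>]) auto

lemma G_cancel_left: "\<lbrakk>x \<in> G; y \<in> X; z \<in> X; x \<cdot> y = x \<cdot> z\<rbrakk> \<Longrightarrow> y = z"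
  using inv_left' by metis

lemma G_cancel_right:
  assumes x: "x \<in> G" and yz: "y \<in> X" "z \<in> X" and eq: "y \<cdot> x = z \<cdot> x"
  shows "y = z"
proof -
  have "y = y \<cdot> x \<cdot> inv x" using x yz by (simp add: mul_assoc G_subset)
  also have "\<dots> = z" unfolding eq using x yz by (simp add: mul_assoc G_subset)
  finally show ?thesis .
qed

lemma limitin_mul:
  assumes "limitin T f a F" "limitin T g b F"
  shows "limitin T (\<lambda>i. f i \<cdot> g i) (a \<cdot> b) F"
proof -
  have "limitin (prod_topology T T) (\<lambda>i. (f i, g i)) (a, b) F"
    using assms by (simp add: limitin_pairwise o_def)
  from continuous_map_limit[OF mul_continuous this] show ?thesis by (simp add: o_def)
qed

lemma limitin_inv:
  assumes "limitin T f a F" "a \<in> G"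
  shows "limitin T (\<lambda>i. inv (f i)) (inv a) F"
proof -
  have "limitin (subtopology T G) f a F"
    using assms limitinD[OF assms(1) G_open assms(2)] by (simp add: limitin_subtopology)
  from continuous_map_limit[OF inv_continuous this] show ?thesis by (simp add: o_def)
qed

lemma continuous_mul:
  "\<lbrakk>continuous_map Y T f; continuous_map Y T g\<rbrakk> \<Longrightarrow> continuous_map Y T (\<lambda>z. f z \<cdot> g z)"
  unfolding continuous_map_atin by (auto intro: limitin_mul)

lemma continuous_inv:
  "\<lbrakk>continuous_map Y T f; \<And>z. z \<in> topspace Y \<Longrightarrow> f z \<in> G\<rbrakk> \<Longrightarrow> continuous_map Y T (\<lambda>z. inv (f z))"
  unfolding continuous_map_atin by (auto intro: limitin_inv)

lemma has_dir_deriv_limit: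
  assumes "has_dir_deriv T f x h L" "f x \<in> X"
  shows "limitin T (\<lambda>t. f (x + t *\<^sub>R h)) (f x) (at 0)"
proof -
  have "limitin T (\<lambda>t. f x + t *\<^sub>R ((1 / t) *\<^sub>R (f (x + t *\<^sub>R h) - f x))) (f x + 0 *\<^sub>R L) (at 0)"
    using assms by (intro limitin_add limitin_scale) (auto simp: has_dir_deriv_def)
  moreover have "\<forall>\<^sub>F t in at 0. f x + t *\<^sub>R ((1 / t) *\<^sub>R (f (x + t *\<^sub>R h) - f x)) = f (x + t *\<^sub>R h)"
    using eventually_nonzero by eventually_elim simp
  ultimately have "limitin T (\<lambda>t. f (x + t *\<^sub>R h)) (f x + 0 *\<^sub>R L) (at 0)"
    by (rule limitin_transform_eventually[rotated])
  then show ?thesis by simp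
qed

lemma has_dir_deriv_mul:
  assumes f: "has_dir_deriv T f x h L" "f x \<in> X" and g: "has_dir_deriv T g x h M" "g x \<in> X"
  shows "has_dir_deriv T (\<lambda>x. f x \<cdot> g x) x h (L \<cdot> g x + f x \<cdot> M)"
  unfolding has_dir_deriv_def
proof (rule limitin_transform_eventually)
  note fl = has_dir_deriv_limit[OF f] and gl = has_dir_deriv_limit[OF g]
  show "limitin T (\<lambda>t. ((1 / t) *\<^sub>R (f (x + t *\<^sub>R h) - f x)) \<cdot> g (x + t *\<^sub>R h) + f x \<cdot> ((1 / t) *\<^sub>R (g (x + t *\<^sub>R h) - g x)))
      (L \<cdot> g x + f x \<cdot> M) (at 0)"
    using f g gl by (intro limitin_add limitin_mul) (auto simp: has_dir_deriv_def)
  have "\<forall>\<^sub>F t in at 0. f (x + t *\<^sub>R h) \<in> X" "\<forall>\<^sub>F t in at 0. g (x + t *\<^sub>R h) \<in> X"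
    using fl gl by (simp_all add: limitin_iff)
  then show "\<forall>\<^sub>F t in at 0. ((1 / t) *\<^sub>R (f (x + t *\<^sub>R h) - f x)) \<cdot> g (x + t *\<^sub>R h) + f x \<cdot> ((1 / t) *\<^sub>R (g (x + t *\<^sub>R h) - g x)) =
      (1 / t) *\<^sub>R (f (x + t *\<^sub>R h) \<cdot> g (x + t *\<^sub>R h) - f x \<cdot> g x)"
    by eventually_elim (use f(2) g(2) in \<open>simp add: mul_simps scaleR_diff_right del: times_divide_eq_left\<close>)
qed

text \<open>By \<open>inv a - inv b = - (inv a \<cdot> (a - b) \<cdot> inv b)\<close>, continuity of
  inversion already implies that it is differentiable.\<close>

lemma has_dir_deriv_inv:
  assumes f: "has_dir_deriv T f x h L" "f x \<in> G"
  shows "has_dir_deriv T (\<lambda>x. inv (f x)) x h (- (inv (f x) \<cdot> L \<cdot> inv (f x)))"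
  unfolding has_dir_deriv_def
proof (rule limitin_transform_eventually)
  note fl = has_dir_deriv_limit[OF f(1) G_subset[OF f(2)]]
  show "limitin T (\<lambda>t. - (inv (f (x + t *\<^sub>R h)) \<cdot> ((1 / t) *\<^sub>R (f (x + t *\<^sub>R h) - f x)) \<cdot> inv (f x)))
      (- (inv (f x) \<cdot> L \<cdot> inv (f x))) (at 0)"
    using f limitin_inv[OF fl f(2)] by (intro limitin_minus limitin_mul) (auto simp: has_dir_deriv_def)
  have "\<forall>\<^sub>F t in at 0. f (x + t *\<^sub>R h) \<in> G" by (rule limitinD[OF fl G_open f(2)])
  then show "\<forall>\<^sub>F t in at 0. - (inv (f (x + t *\<^sub>R h)) \<cdot> ((1 / t) *\<^sub>R (f (x + t *\<^sub>R h) - f x)) \<cdot> inv (f x)) =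
      (1 / t) *\<^sub>R (inv (f (x + t *\<^sub>R h)) - inv (f x))"
    by eventually_elim
      (use f(2) in \<open>simp add: G_subset mul_simps inv_left' inv_right' scaleR_diff_right del: times_divide_eq_left\<close>)
qed

text \<open>Noncommutative rational expressions in the point and the directions, with inverses only
  of expressions that are units on all of \<open>V\<close>. Directions are included because
  differentiation produces them; the derivative of an inverse is built from that same inverse, so
  the class is closed under differentiation.\<close>

inductive_set rational :: "'a set \<Rightarrow> 'a set \<Rightarrow> ((nat \<Rightarrow> 'a) \<Rightarrow> 'a \<Rightarrow> 'a) set" for E V where
  const: "a \<in> X \<Longrightarrow> (\<lambda>h x. a) \<in> rational E V"
| point: "(\<lambda>h x. x) \<in> rational E V"
| dir: "(\<lambda>h x. h i) \<in> rational E V"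
| plus: "\<lbrakk>\<phi> \<in> rational E V; \<psi> \<in> rational E V\<rbrakk> \<Longrightarrow> (\<lambda>h x. \<phi> h x + \<psi> h x) \<in> rational E V"
| scale: "\<phi> \<in> rational E V \<Longrightarrow> (\<lambda>h x. r *\<^sub>R \<phi> h x) \<in> rational E V"
| mul: "\<lbrakk>\<phi> \<in> rational E V; \<psi> \<in> rational E V\<rbrakk> \<Longrightarrow> (\<lambda>h x. \<phi> h x \<cdot> \<psi> h x) \<in> rational E V"
| inverse: "\<lbrakk>\<phi> \<in> rational E V; \<And>h x. \<lbrakk>range h \<subseteq> E; x \<in> V\<rbrakk> \<Longrightarrow> \<phi> h x \<in> G\<rbrakk> \<Longrightarrow> (\<lambda>h x. inv (\<phi> h x)) \<in> rational E V"

lemma rational_minus: "\<phi> \<in> rational E V \<Longrightarrow> (\<lambda>h x. - \<phi> h x) \<in> rational E V"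
  using rational.scale[of \<phi> E V "-1"] by simp

lemma rational_diff: "\<lbrakk>\<phi> \<in> rational E V; \<psi> \<in> rational E V\<rbrakk> \<Longrightarrow> (\<lambda>h x. \<phi> h x - \<psi> h x) \<in> rational E V"
  using rational.plus[OF _ rational_minus, of \<phi> E V \<psi>] by simp

lemma rational_mem:
  assumes "\<phi> \<in> rational E V" "E \<subseteq> X" "V \<subseteq> X" "range h \<subseteq> E" "x \<in> V"
  shows "\<phi> h x \<in> X"
  using assms by induction (auto dest: range_subsetD)

theorem smooth_rational:
  assumes op: "openin (subtopology T E) V" and E: "subspace E" "E \<subseteq> X"
    and f: "(\<lambda>h. f) \<in> rational E V"
  shows "smooth_map T E V f"
proof (rule smooth_mapI[OF op E f])
  have VX: "V \<subseteq> X" using open_subtopology_mem[OF op] by blast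
  fix \<phi> :: "(nat \<Rightarrow> 'a) \<Rightarrow> 'a \<Rightarrow> 'a" assume "\<phi> \<in> rational E V"
  then show "continuous_map (param_topology E V) T (\<lambda>z. \<phi> (snd z) (fst z))"
  proof induction
    case point
    show ?case using continuous_map_into_fulltopology[OF continuous_param_point] .
  next
    case (dir i)
    show ?case using continuous_map_into_fulltopology[OF continuous_param_dir] .
  next
    case (inverse \<phi>)
    show ?case
    proof (rule continuous_inv[OF inverse(3)])
      fix z assume "z \<in> topspace (param_topology E V)"
      then show "\<phi> (snd z) (fst z) \<in> G"
        using topspace_param[OF VX E(2), of "fst z" "snd z"] inverse(2) by simp
    qed
  qed (auto intro: continuous_add continuous_scale continuous_mul)
next
  have VX: "V \<subseteq> X" using open_subtopology_mem[OF op] by blast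
  fix \<phi> :: "(nat \<Rightarrow> 'a) \<Rightarrow> 'a \<Rightarrow> 'a" and m assume "\<phi> \<in> rational E V"
  then show "\<exists>\<phi>'\<in>rational E V. \<forall>x\<in>V. \<forall>h. range h \<subseteq> E \<longrightarrow> has_dir_deriv T (\<phi> h) x (h m) (\<phi>' h x)"
  proof induction
    case (const a)
    show ?case by (rule bexI[OF _ rational.const[OF in_X(1)]]) (simp add: has_dir_deriv_const)
  next
    case point
    show ?case by (rule bexI[OF _ rational.dir[of m]]) (use E in \<open>blast intro: has_dir_deriv_ident\<close>)
  next
    case (dir i)
    show ?case by (rule bexI[OF _ rational.const[OF in_X(1)]]) (simp add: has_dir_deriv_const)
  next
    case (plus \<phi> \<psi>)
    then obtain \<phi>' \<psi>' where d: "\<phi>' \<in> rational E V" "\<psi>' \<in> rational E V"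
      "\<forall>x\<in>V. \<forall>h. range h \<subseteq> E \<longrightarrow> has_dir_deriv T (\<phi> h) x (h m) (\<phi>' h x)"
      "\<forall>x\<in>V. \<forall>h. range h \<subseteq> E \<longrightarrow> has_dir_deriv T (\<psi> h) x (h m) (\<psi>' h x)" by metis
    show ?case
      by (rule bexI[OF _ rational.plus[OF d(1,2)]]) (use d in \<open>auto intro: has_dir_deriv_add\<close>)
  next
    case (scale \<phi> r)
    then obtain \<phi>' where d: "\<phi>' \<in> rational E V"
      "\<forall>x\<in>V. \<forall>h. range h \<subseteq> E \<longrightarrow> has_dir_deriv T (\<phi> h) x (h m) (\<phi>' h x)" by metis
    show ?case
      by (rule bexI[OF _ rational.scale[OF d(1)]]) (use d in \<open>auto intro: has_dir_deriv_scale\<close>)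
  next
    case (mul \<phi> \<psi>)
    then obtain \<phi>' \<psi>' where d: "\<phi>' \<in> rational E V" "\<psi>' \<in> rational E V"
      "\<forall>x\<in>V. \<forall>h. range h \<subseteq> E \<longrightarrow> has_dir_deriv T (\<phi> h) x (h m) (\<phi>' h x)"
      "\<forall>x\<in>V. \<forall>h. range h \<subseteq> E \<longrightarrow> has_dir_deriv T (\<psi> h) x (h m) (\<psi>' h x)" by metis
    show ?case
      by (rule bexI[OF _ rational.plus[OF rational.mul[OF d(1) mul(2)] rational.mul[OF mul(1) d(2)]]])
        (use d mul rational_mem[OF _ E(2) VX] in \<open>auto intro!: has_dir_deriv_mul\<close>)
  next
    case (inverse \<phi>)
    then obtain \<phi>' where d: "\<phi>' \<in> rational E V"
      "\<forall>x\<in>V. \<forall>h. range h \<subseteq> E \<longrightarrow> has_dir_deriv T (\<phi> h) x (h m) (\<phi>' h x)" by metis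
    note i = rational.inverse[OF inverse(1,2)]
    show ?case
      by (rule bexI[OF _ rational_minus[OF rational.mul[OF rational.mul[OF i d(1)] i]]])
        (use d inverse(2) in \<open>auto intro!: has_dir_deriv_inv\<close>)
  qed
qed

section \<open>Algebra of the Cayley transform\<close>

definition acs :: "'a set" where "acs = {J \<in> X. J \<cdot> J = - \<e>}"
definition anti :: "'a \<Rightarrow> 'a set" where "anti J = {K \<in> X. J \<cdot> K + K \<cdot> J = 0}"
definition cayley_dom :: "'a \<Rightarrow> 'a set" where "cayley_dom J0 = {J \<in> acs. \<e> - J \<cdot> J0 \<in> G}"
definition cayley_img :: "'a \<Rightarrow> 'a set" where "cayley_img J0 = {K \<in> anti J0. \<e> - K \<in> G}"
definition cayley :: "'a \<Rightarrow> 'a \<Rightarrow> 'a" where "cayley J0 J = inv (\<e> - J \<cdot> J0) \<cdot> (\<e> + J \<cdot> J0)"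

text \<open>Since \<open>J0 (1 + K) = (1 - K) J0\<close> for \<open>K\<close> anticommuting with \<open>J0\<close>, this is \<open>J0 (1 + K) (1 - K)\<^sup>-\<^sup>1\<close>.\<close>

definition cayley_inv :: "'a \<Rightarrow> 'a \<Rightarrow> 'a" where "cayley_inv J0 K = (\<e> - K) \<cdot> J0 \<cdot> inv (\<e> - K)"

context
  fixes J0
  assumes J0: "J0 \<in> acs"
begin

lemma J0_X: "J0 \<in> X" and J0_sq: "J0 \<cdot> J0 = - \<e>"
  using J0 by (auto simp: acs_def)

lemma J0_sq': "y \<in> X \<Longrightarrow> J0 \<cdot> (J0 \<cdot> y) = - y"
  using mul_assoc[of J0 J0 y] by (simp add: J0_X J0_sq mul_minus_left)

lemma acs_in_G: "J0 \<in> G"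
  by (rule unit_in_G[of _ "- J0"]) (auto simp: J0_X mul_minus_left mul_minus_right J0_sq)

end

lemma anti_swap: "\<lbrakk>J \<in> X; K \<in> anti J\<rbrakk> \<Longrightarrow> K \<cdot> J = - (J \<cdot> K)"
  unfolding anti_def by (simp add: eq_neg_iff_add_eq_0 add.commute)

lemma anti_X: "K \<in> anti J \<Longrightarrow> K \<in> X" by (simp add: anti_def)

text \<open>For \<open>u = \<e> - J \<cdot> J0\<close> and \<open>w = \<e> + J \<cdot> J0\<close>
  one has \<open>u \<cdot> J0 = J \<cdot> u\<close> and
  \<open>w \<cdot> J0 = - (J \<cdot> w)\<close>, so \<open>K = inv u \<cdot> w\<close> anticommutes
  with \<open>J0\<close>. Moreover \<open>\<e> - K = inv u \<cdot> (u - w)\<close> is a product of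
  units up to the factor \<open>-2\<close>, and it conjugates \<open>J0\<close> into
  \<open>J\<close>.\<close>

lemma
  assumes J0: "J0 \<in> acs" and J: "J \<in> cayley_dom J0"
  shows cayley_mem: "cayley J0 J \<in> cayley_img J0" and cayley_inv_cayley: "cayley_inv J0 (cayley J0 J) = J"
proof -
  define u where "u = \<e> - J \<cdot> J0"
  define w where "w = \<e> + J \<cdot> J0"
  have u: "u \<in> G" and Ja: "J \<in> acs" using J by (auto simp: cayley_dom_def u_def)
  note [simp] = J0_X[OF J0] J0_X[OF Ja] G_subset[OF u] inv_closed[OF u]
  note sq = J0_sq[OF J0] J0_sq'[OF J0] J0_sq[OF Ja] J0_sq'[OF Ja]
  have wX [simp]: "w \<in> X" by (simp add: w_def)
  have uJ: "u \<cdot> J0 = J \<cdot> u" by (simp add: u_def mul_simps sq add.commute)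
  have wJ: "w \<cdot> J0 = - (J \<cdot> w)" by (simp add: w_def mul_simps sq)
  have iJ: "J0 \<cdot> inv u = inv u \<cdot> J"
  proof (rule G_cancel_left[OF u])
    have "u \<cdot> (J0 \<cdot> inv u) = u \<cdot> J0 \<cdot> inv u" by (simp add: mul_assoc)
    also have "\<dots> = J" by (simp add: uJ mul_assoc u)
    finally show "u \<cdot> (J0 \<cdot> inv u) = u \<cdot> (inv u \<cdot> J)" by (simp add: inv_right' u)
  qed auto
  define K where "K = inv u \<cdot> w"
  have KX [simp]: "K \<in> X" by (simp add: K_def)
  have "J0 \<cdot> K = inv u \<cdot> (J \<cdot> w)"
    using iJ by (simp add: K_def flip: mul_assoc)
  moreover have "K \<cdot> J0 = - (inv u \<cdot> (J \<cdot> w))"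
    by (simp add: K_def mul_assoc wJ mul_minus_right)
  ultimately have anti: "K \<in> anti J0" by (simp add: anti_def)
  define z where "z = \<e> - K"
  have z: "z = inv u \<cdot> ((-2) *\<^sub>R (J \<cdot> J0))"
  proof -
    have "z = inv u \<cdot> (u - w)" by (simp add: z_def K_def mul_diff_right u)
    also have "u - w = (-2) *\<^sub>R (J \<cdot> J0)" by (simp add: u_def w_def scaleR_2)
    finally show ?thesis .
  qed
  have zG: "z \<in> G"
    unfolding z by (intro G_mul G_inv G_scale u acs_in_G[OF J0] acs_in_G[OF Ja]) simp
  note [simp] = G_subset[OF zG] inv_closed[OF zG]
  show "cayley J0 J \<in> cayley_img J0"
    using anti zG by (simp add: cayley_img_def cayley_def K_def u_def w_def z_def)
  \<comment> \<open>\<open>u\<close> is a polynomial in \<open>J \<cdot> J0\<close>, so its inverse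
    commutes with that product as well.\<close>
  have comm: "inv u \<cdot> (J \<cdot> J0) = J \<cdot> J0 \<cdot> inv u"
  proof (rule G_cancel_right[OF u])
    have "u \<cdot> (J \<cdot> J0) = J \<cdot> J0 \<cdot> u" by (simp add: u_def mul_simps)
    then have "inv u \<cdot> (J \<cdot> J0 \<cdot> u) = J \<cdot> J0" using inv_left'[OF u, of "J \<cdot> J0"] by simp
    then show "inv u \<cdot> (J \<cdot> J0) \<cdot> u = J \<cdot> J0 \<cdot> inv u \<cdot> u" by (simp add: mul_assoc u)
  qed auto
  have "J \<cdot> z = z \<cdot> J0"
  proof -
    have "J \<cdot> z = (-2) *\<^sub>R (J \<cdot> (inv u \<cdot> (J \<cdot> J0)))" by (simp add: z mul_simps)
    also have "\<dots> = 2 *\<^sub>R (J0 \<cdot> inv u)" unfolding comm by (simp add: mul_simps sq)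
    also have "\<dots> = z \<cdot> J0" unfolding iJ by (simp add: z mul_simps sq)
    finally show ?thesis .
  qed
  then have "z \<cdot> J0 \<cdot> inv z = J" by (metis J0_X[OF Ja] \<open>z \<in> X\<close> \<open>inv z \<in> X\<close> inv_right mul_assoc one_right zG)
  then show "cayley_inv J0 (cayley J0 J) = J"
    by (simp add: cayley_inv_def cayley_def K_def u_def w_def z_def)
qed

text \<open>With \<open>z = \<e> - K\<close> and \<open>y = \<e> + K\<close>, anticommutation reads
  \<open>y \<cdot> J0 = J0 \<cdot> z\<close>. Hence \<open>y\<close> is a unit along with
  \<open>z\<close>, and \<open>J \<cdot> J0 = - (z \<cdot> inv y)\<close>. The two factors of the
  Cayley transform become \<open>2 *\<^sub>R inv y\<close> and
  \<open>2 *\<^sub>R (K \<cdot> inv y)\<close>, and \<open>K\<close> commutes with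
  \<open>inv y\<close>.\<close>

lemma
  assumes J0: "J0 \<in> acs" and K: "K \<in> cayley_img J0"
  shows cayley_inv_mem: "cayley_inv J0 K \<in> cayley_dom J0" and cayley_cayley_inv: "cayley J0 (cayley_inv J0 K) = K"
proof -
  define z where "z = \<e> - K"
  define y where "y = \<e> + K"
  have z: "z \<in> G" and Ka: "K \<in> anti J0" using K by (auto simp: cayley_img_def z_def)
  note [simp] = J0_X[OF J0] G_subset[OF z] inv_closed[OF z] anti_X[OF Ka]
  note sq = J0_sq[OF J0] J0_sq'[OF J0]
  have yX [simp]: "y \<in> X" by (simp add: y_def)
  have yJ: "y \<cdot> J0 = J0 \<cdot> z"
    by (simp add: y_def z_def mul_simps anti_swap[OF J0_X[OF J0] Ka])
  have "y = (-1) *\<^sub>R (J0 \<cdot> z \<cdot> J0)"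
    by (simp add: mul_assoc sq mul_minus_right flip: yJ)
  then have yG: "y \<in> G"
    using G_scale[OF G_mul[OF G_mul[OF acs_in_G[OF J0] z] acs_in_G[OF J0]], of "-1"] by simp
  note [simp] = inv_closed[OF yG]
  have iJ: "inv y \<cdot> J0 = J0 \<cdot> inv z"
  proof (rule G_cancel_left[OF yG])
    have "y \<cdot> (J0 \<cdot> inv z) = y \<cdot> J0 \<cdot> inv z" by (simp add: mul_assoc)
    also have "\<dots> = J0" unfolding yJ by (simp add: mul_assoc z)
    finally show "y \<cdot> (inv y \<cdot> J0) = y \<cdot> (J0 \<cdot> inv z)" by (simp add: inv_right' yG)
  qed auto
  define J where "J = z \<cdot> J0 \<cdot> inv z"
  have JX [simp]: "J \<in> X" by (simp add: J_def)
  have "J \<cdot> J = - \<e>" by (simp add: J_def mul_simps inv_left' z sq)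
  then have Ja: "J \<in> acs" by (simp add: acs_def)
  have JJ: "J \<cdot> J0 = - (z \<cdot> inv y)"
  proof -
    have "J \<cdot> J0 = z \<cdot> (J0 \<cdot> inv z \<cdot> J0)" by (simp add: J_def mul_assoc)
    also have "J0 \<cdot> inv z \<cdot> J0 = - inv y"
      unfolding iJ[symmetric] by (simp add: mul_assoc sq mul_minus_right)
    finally show ?thesis by (simp add: mul_minus_right)
  qed
  have eq1: "\<e> - J \<cdot> J0 = 2 *\<^sub>R inv y"
  proof -
    have "\<e> - J \<cdot> J0 = (y + z) \<cdot> inv y" by (simp add: JJ mul_simps yG)
    also have "y + z = 2 *\<^sub>R \<e>" by (simp add: y_def z_def scaleR_2)
    finally show ?thesis by (simp add: mul_simps)
  qed
  have eq2: "\<e> + J \<cdot> J0 = 2 *\<^sub>R (K \<cdot> inv y)"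
  proof -
    have "\<e> + J \<cdot> J0 = (y - z) \<cdot> inv y" by (simp add: JJ mul_simps yG)
    also have "y - z = 2 *\<^sub>R K" by (simp add: y_def z_def scaleR_2)
    finally show ?thesis by (simp add: mul_simps)
  qed
  have u: "\<e> - J \<cdot> J0 \<in> G" unfolding eq1 by (intro G_scale G_inv yG) simp
  then show "cayley_inv J0 K \<in> cayley_dom J0"
    using Ja by (simp add: cayley_dom_def cayley_inv_def J_def z_def)
  have comm: "inv y \<cdot> K = K \<cdot> inv y"
  proof (rule G_cancel_left[OF yG])
    have "y \<cdot> (K \<cdot> inv y) = y \<cdot> K \<cdot> inv y" by (simp add: mul_assoc)
    also have "y \<cdot> K = K \<cdot> y" by (simp add: y_def mul_simps)
    also have "K \<cdot> y \<cdot> inv y = K" by (simp add: mul_assoc yG)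
    finally show "y \<cdot> (inv y \<cdot> K) = y \<cdot> (K \<cdot> inv y)" by (simp add: inv_right' yG)
  qed auto
  have "inv (\<e> - J \<cdot> J0) \<cdot> (\<e> + J \<cdot> J0) = K"
  proof (rule G_cancel_left[OF u])
    show "(\<e> - J \<cdot> J0) \<cdot> (inv (\<e> - J \<cdot> J0) \<cdot> (\<e> + J \<cdot> J0)) = (\<e> - J \<cdot> J0) \<cdot> K"
      using comm by (simp add: inv_right'[OF u]) (simp add: eq1 eq2 mul_scale_left)
  qed (use u in auto)
  then show "cayley J0 (cayley_inv J0 K) = K"
    by (simp add: cayley_def cayley_inv_def J_def z_def)
qed

lemma bij_betw_cayley: "J0 \<in> acs \<Longrightarrow> bij_betw (cayley J0) (cayley_dom J0) (cayley_img J0)"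
  by (rule bij_betw_byWitness[where f'="cayley_inv J0"])
    (auto simp: cayley_inv_cayley cayley_cayley_inv intro: cayley_mem cayley_inv_mem)

section \<open>Cayley charts\<close>

lemma subspace_anti:
  assumes J: "J \<in> X"
  shows "subspace (anti J)"
proof (rule subspaceI)
  show "0 \<in> anti J" using J by (simp add: anti_def mul_zero)
  show "x + y \<in> anti J" if x: "x \<in> anti J" and y: "y \<in> anti J" for x y
  proof -
    have "J \<cdot> (x + y) + (x + y) \<cdot> J = (J \<cdot> x + x \<cdot> J) + (J \<cdot> y + y \<cdot> J)"
      using J anti_X[OF x] anti_X[OF y] by (simp add: mul_simps)
    also have "\<dots> = 0" using x y by (simp add: anti_def)
    finally show ?thesis using x y by (simp add: anti_def)
  qed
  show "c *\<^sub>R x \<in> anti J" if x: "x \<in> anti J" for c x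
  proof -
    have "J \<cdot> (c *\<^sub>R x) + (c *\<^sub>R x) \<cdot> J = c *\<^sub>R (J \<cdot> x + x \<cdot> J)"
      using J anti_X[OF x] by (simp add: mul_simps scaleR_add_right)
    also have "\<dots> = 0" using x by (simp add: anti_def)
    finally show ?thesis using x by (simp add: anti_def)
  qed
qed

lemma anti_subset: "anti J \<subseteq> X" by (auto simp: anti_def)

lemma continuous_ident: "continuous_map T T (\<lambda>x. x)"
  using continuous_map_id[of T] by (simp add: id_def)

lemma closedin_anti:
  assumes "J \<in> X"
  shows "closedin T (anti J)"
proof -
  have "continuous_map T T (\<lambda>K. J \<cdot> K + K \<cdot> J)"
    using assms by (intro continuous_add continuous_mul continuous_ident) auto
  moreover have "closedin T {0}" using closedin_Hausdorff_sing_eq[OF Hausdorff] by simp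
  ultimately have "closedin T {K \<in> X. J \<cdot> K + K \<cdot> J \<in> {0}}" by (rule closedin_continuous_map_preimage)
  then show ?thesis by (simp add: anti_def)
qed

lemma anti_mul:
  assumes J: "J \<in> acs" and K: "K \<in> anti J"
  shows "K \<cdot> J \<in> anti J"
proof -
  note [simp] = J0_X[OF J] anti_X[OF K]
  have "J \<cdot> (K \<cdot> J) + K \<cdot> J \<cdot> J = (J \<cdot> K + K \<cdot> J) \<cdot> J" by (simp add: mul_simps)
  also have "\<dots> = 0" using K by (simp add: anti_def mul_zero)
  finally show ?thesis by (simp add: anti_def)
qed

lemma complex_model_anti:
  assumes J: "J \<in> acs"
  shows "complex_model T (anti J) (\<lambda>A. A \<cdot> J)"
  unfolding complex_model_def
proof (intro conjI ballI allI)
  note [simp] = J0_X[OF J]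
  show "subspace (anti J)" "closedin T (anti J)" by (simp_all add: subspace_anti closedin_anti)
  show sub: "(\<lambda>A. A \<cdot> J) ` anti J \<subseteq> anti J" using anti_mul[OF J] by blast
  show "(a *\<^sub>R h + b *\<^sub>R k) \<cdot> J = a *\<^sub>R (h \<cdot> J) + b *\<^sub>R (k \<cdot> J)" if "h \<in> anti J" "k \<in> anti J" for h k a b
    using that by (simp add: anti_X mul_simps)
  show "h \<cdot> J \<cdot> J = - h" if "h \<in> anti J" for h
    using that by (simp add: anti_X mul_assoc J0_sq[OF J] mul_minus_right)
  have "continuous_map T T (\<lambda>A. A \<cdot> J)" by (intro continuous_mul continuous_ident) simp
  from continuous_map_from_subtopology[OF this, of "anti J"] sub
  show "continuous_map (subtopology T (anti J)) (subtopology T (anti J)) (\<lambda>A. A \<cdot> J)"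
    by (auto simp: continuous_map_in_subtopology)
qed

lemma openin_units_preimage:
  assumes "continuous_map T T f"
  shows "openin T {x \<in> X. f x \<in> G}"
  by (rule openin_continuous_map_preimage[OF assms G_open])

text \<open>The domain of the Cayley formula once the condition on the square of \<open>J\<close> is
  dropped. It is open in the whole algebra, so it carries the ambient smooth extension demanded by
  \<open>smooth_chart\<close>.\<close>

definition cayley_ext :: "'a \<Rightarrow> 'a set" where "cayley_ext J0 = {J \<in> X. \<e> - J \<cdot> J0 \<in> G}"

lemma smooth_cayley:
  assumes "J0 \<in> X"
  shows "smooth_map T X (cayley_ext J0) (cayley J0)"
proof (rule smooth_rational[OF _ subspace_topspace])
  show "openin (subtopology T X) (cayley_ext J0)"
    unfolding cayley_ext_def using assms
    by (simp, intro openin_units_preimage continuous_diff continuous_mul continuous_ident) auto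
  have a: "(\<lambda>h x. x \<cdot> J0) \<in> rational X (cayley_ext J0)"
    by (intro rational.mul rational.point rational.const assms)
  show "(\<lambda>h. cayley J0) \<in> rational X (cayley_ext J0)"
    unfolding cayley_def[abs_def]
    by (intro rational.mul rational.inverse rational.plus rational_diff rational.const a one_closed)
      (simp add: cayley_ext_def)
qed simp

lemma cayley_img_open:
  assumes "J0 \<in> X"
  shows "openin (subtopology T (anti J0)) (cayley_img J0)"
proof -
  have "openin T {x \<in> X. \<e> - x \<in> G}"
    by (intro openin_units_preimage continuous_diff continuous_ident) auto
  moreover have "cayley_img J0 = {x \<in> X. \<e> - x \<in> G} \<inter> anti J0"
    by (auto simp: cayley_img_def anti_X)
  ultimately show ?thesis by (auto simp: openin_subtopology)
qed

lemma smooth_cayley_inv: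
  assumes "J0 \<in> X"
  shows "smooth_map T (anti J0) (cayley_img J0) (cayley_inv J0)"
proof (rule smooth_rational[OF cayley_img_open[OF assms] subspace_anti[OF assms] anti_subset])
  have a: "(\<lambda>h x. \<e> - x) \<in> rational (anti J0) (cayley_img J0)"
    by (intro rational_diff rational.point rational.const one_closed)
  show "(\<lambda>h. cayley_inv J0) \<in> rational (anti J0) (cayley_img J0)"
    unfolding cayley_inv_def[abs_def]
    by (intro rational.mul rational.inverse rational.const a assms) (simp add: cayley_img_def)
qed

definition cayley_chart :: "'a \<Rightarrow> 'a cchart"
  where "cayley_chart J0 = CChart (cayley_dom J0) (cayley J0) (anti J0) (\<lambda>A. A \<cdot> J0)"

lemma cayley_chart_sel [simp]: "cdom (cayley_chart J0) = cayley_dom J0" "cmap (cayley_chart J0) = cayley J0"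
  "cmodel (cayley_chart J0) = anti J0" "cstr (cayley_chart J0) = (\<lambda>A. A \<cdot> J0)"
  by (simp_all add: cayley_chart_def)

lemma cimg_cayley: "J0 \<in> acs \<Longrightarrow> cimg (cayley_chart J0) = cayley_img J0"
  using bij_betw_cayley by (simp add: cimg_def bij_betw_def)

text \<open>\<open>cinv\<close> stems from \<open>inv_into\<close> and is uncontrolled off the
  image. Smoothness and derivatives of \<open>cayley_inv\<close> are therefore transferred to it by
  congruence on the relatively open set \<open>cayley_img J0\<close>.\<close>

lemma cinv_cayley: "\<lbrakk>J0 \<in> acs; K \<in> cayley_img J0\<rbrakk> \<Longrightarrow> cinv (cayley_chart J0) K = cayley_inv J0 K"
  using inv_into_f_f[OF bij_betw_imp_inj_on[OF bij_betw_cayley], of J0 "cayley_inv J0 K"]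
  by (simp add: cinv_def cayley_cayley_inv cayley_inv_mem)

lemma smooth_chart_cayley:
  assumes J0: "J0 \<in> acs"
  shows "smooth_chart T acs (cayley_chart J0)"
  unfolding smooth_chart_def cimg_cayley[OF J0] cayley_chart_sel
proof (intro conjI ballI complex_model_anti[OF J0] cayley_img_open)
  note J0X = J0_X[OF J0]
  show "J0 \<in> X" by (rule J0X)
  note smc = smooth_cayley[OF J0X] and sminv = smooth_cayley_inv[OF J0X]
  have dom: "cayley_dom J0 = cayley_ext J0 \<inter> acs"
    by (auto simp: cayley_dom_def cayley_ext_def acs_def)
  show "openin (subtopology T acs) (cayley_dom J0)"
    using smooth_map_open[OF smc] unfolding dom by (auto simp: openin_subtopology)
  show "smooth_map T (anti J0) (cayley_img J0) (cinv (cayley_chart J0))"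
    by (rule smooth_map_cong[OF sminv subspace_anti[OF J0X] anti_subset cinv_cayley[OF J0]])
  have "continuous_map (subtopology T (cayley_dom J0)) T (cayley J0)"
    using continuous_map_from_subtopology_mono[OF smooth_map_continuous[OF smc]] dom by blast
  moreover have "continuous_map (subtopology T (cayley_img J0)) T (cayley_inv J0)"
    by (rule smooth_map_continuous[OF sminv])
  ultimately have "homeomorphic_maps (subtopology T (cayley_dom J0)) (subtopology T (cayley_img J0)) (cayley J0) (cayley_inv J0)"
    unfolding homeomorphic_maps_def
    by (auto simp: continuous_map_in_subtopology cayley_inv_cayley[OF J0] cayley_cayley_inv[OF J0]
        intro: cayley_mem[OF J0] cayley_inv_mem[OF J0])
  then show "homeomorphic_map (subtopology T (cayley_dom J0)) (subtopology T (cayley_img J0)) (cayley J0)"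
    unfolding homeomorphic_map_maps by blast
  fix x assume "x \<in> cayley_dom J0"
  then show "\<exists>W f. x \<in> W \<and> smooth_map T X W f \<and> (\<forall>y\<in>W \<inter> cayley_dom J0. f y = cayley J0 y)"
    using smc dom by blast
qed

text \<open>The product rule for \<open>z \<cdot> J0 \<cdot> inv z\<close>, where
  \<open>z = \<e> - K\<close> has derivative \<open>- h\<close>. Anticommutation replaces
  \<open>- (h \<cdot> J0)\<close> by \<open>J0 \<cdot> h\<close>, after which
  \<open>h \<cdot> inv z\<close> factors out on the right.\<close>

lemma dir_deriv_cayley_inv:
  assumes J0: "J0 \<in> acs" and K: "K \<in> cayley_img J0" and h: "h \<in> anti J0"
  shows "dir_deriv T (cinv (cayley_chart J0)) K h = (J0 + cayley_inv J0 K) \<cdot> h \<cdot> inv (\<e> - K)"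
proof -
  define z where "z = \<e> - K"
  have z: "z \<in> G" using K by (simp add: cayley_img_def z_def)
  have KX: "K \<in> X" using K anti_X[of K J0] by (simp add: cayley_img_def)
  note [simp] = J0_X[OF J0] G_subset[OF z] inv_closed[OF z] anti_X[OF h]
  have dz: "has_dir_deriv T (\<lambda>K. \<e> - K) K h (- h)"
    using has_dir_deriv_add[OF has_dir_deriv_const[of \<e> K h] has_dir_deriv_scale[OF has_dir_deriv_ident[of h K], of "-1"]]
    by simp
  have "has_dir_deriv T (cayley_inv J0) K h
      ((- h \<cdot> J0 + z \<cdot> 0) \<cdot> inv z + z \<cdot> J0 \<cdot> (- (inv z \<cdot> (- h) \<cdot> inv z)))"
    unfolding cayley_inv_def[abs_def] z_def
    by (intro has_dir_deriv_mul has_dir_deriv_inv has_dir_deriv_const dz)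
      (use z KX in \<open>auto simp flip: z_def\<close>)
  also have "(- h \<cdot> J0 + z \<cdot> 0) \<cdot> inv z + z \<cdot> J0 \<cdot> (- (inv z \<cdot> (- h) \<cdot> inv z)) = (J0 + z \<cdot> J0 \<cdot> inv z) \<cdot> h \<cdot> inv z"
    by (simp add: mul_minus_left anti_swap[OF J0_X[OF J0] h]) (simp add: mul_simps)
  also have "z \<cdot> J0 \<cdot> inv z = cayley_inv J0 K" by (simp add: cayley_inv_def z_def)
  finally have "dir_deriv T (cayley_inv J0) K h = (J0 + cayley_inv J0 K) \<cdot> h \<cdot> inv z"
    by (rule dir_deriv_eq)
  moreover have "dir_deriv T (cinv (cayley_chart J0)) K h = dir_deriv T (cayley_inv J0) K h"
    by (rule dir_deriv_cong[OF cayley_img_open subspace_anti anti_subset K h cinv_cayley[OF J0]]) simp_all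
  ultimately show ?thesis by (simp add: z_def)
qed

text \<open>Both \<open>s = J0 + J\<close> and \<open>z = \<e> - K\<close> intertwine
  \<open>J0\<close> with \<open>J\<close>. Therefore
  \<open>h \<mapsto> s \<cdot> h \<cdot> inv z\<close> maps \<open>anti J0\<close> into
  \<open>anti J\<close>, and \<open>A \<mapsto> inv s \<cdot> A \<cdot> z\<close> is its inverse.
  Complex linearity is the intertwining property of \<open>inv z\<close> alone.\<close>

lemma induces_cayley_chart:
  assumes J0: "J0 \<in> acs"
  shows "induces T anti {cayley_chart J0} (\<lambda>J A. A \<cdot> J)"
proof -
  have "bij_betw (dir_deriv T (cinv (cayley_chart J0)) K) (anti J0) (anti (cinv (cayley_chart J0) K)) \<and>
    (\<forall>h\<in>anti J0. dir_deriv T (cinv (cayley_chart J0)) K (h \<cdot> J0)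
      = dir_deriv T (cinv (cayley_chart J0)) K h \<cdot> cinv (cayley_chart J0) K)"
    if K: "K \<in> cayley_img J0" for K
  proof -
    define z where "z = \<e> - K"
    define J where "J = cayley_inv J0 K"
    define s where "s = J0 + J"
    have z: "z \<in> G" using K by (simp add: cayley_img_def z_def)
    have Jd: "J \<in> cayley_dom J0" unfolding J_def by (rule cayley_inv_mem[OF J0 K])
    then have Ja: "J \<in> acs" and uG: "\<e> - J \<cdot> J0 \<in> G" by (auto simp: cayley_dom_def)
    note [simp] = J0_X[OF J0] J0_X[OF Ja] G_subset[OF z] inv_closed[OF z]
    note sq = J0_sq[OF J0] J0_sq'[OF J0] J0_sq[OF Ja] J0_sq'[OF Ja]
    have "s = (\<e> - J \<cdot> J0) \<cdot> J0" by (simp add: s_def mul_simps sq add.commute)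
    then have s: "s \<in> G" using G_mul[OF uG acs_in_G[OF J0]] by simp
    note [simp] = G_subset[OF s] inv_closed[OF s]
    have sJ: "s \<cdot> J0 = J \<cdot> s" by (simp add: s_def mul_simps sq add.commute)
    have zJ: "z \<cdot> J0 = J \<cdot> z" by (simp add: J_def cayley_inv_def mul_assoc z flip: z_def)
    have Ji: "J0 \<cdot> inv s = inv s \<cdot> J"
    proof (rule G_cancel_left[OF s])
      have "s \<cdot> (J0 \<cdot> inv s) = s \<cdot> J0 \<cdot> inv s" by (simp add: mul_assoc)
      also have "\<dots> = J" unfolding sJ by (simp add: mul_assoc s)
      finally show "s \<cdot> (J0 \<cdot> inv s) = s \<cdot> (inv s \<cdot> J)" by (simp add: inv_right' s)
    qed auto
    have Jz: "J0 \<cdot> inv z = inv z \<cdot> J"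
    proof (rule G_cancel_left[OF z])
      have "z \<cdot> (J0 \<cdot> inv z) = z \<cdot> J0 \<cdot> inv z" by (simp add: mul_assoc)
      also have "\<dots> = J" unfolding zJ by (simp add: mul_assoc z)
      finally show "z \<cdot> (J0 \<cdot> inv z) = z \<cdot> (inv z \<cdot> J)" by (simp add: inv_right' z)
    qed auto
    have D: "dir_deriv T (cinv (cayley_chart J0)) K h = s \<cdot> h \<cdot> inv z" if "h \<in> anti J0" for h
      using dir_deriv_cayley_inv[OF J0 K that] by (simp add: s_def J_def z_def)
    have fwd: "s \<cdot> h \<cdot> inv z \<in> anti J" if h: "h \<in> anti J0" for h
    proof -
      note [simp] = anti_X[OF h]
      have "J \<cdot> (s \<cdot> h \<cdot> inv z) = J \<cdot> s \<cdot> (h \<cdot> inv z)" by (simp add: mul_assoc)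
      also have "\<dots> = s \<cdot> (J0 \<cdot> h) \<cdot> inv z" unfolding sJ[symmetric] by (simp add: mul_assoc)
      finally have 1: "J \<cdot> (s \<cdot> h \<cdot> inv z) = s \<cdot> (J0 \<cdot> h) \<cdot> inv z" .
      have "s \<cdot> h \<cdot> inv z \<cdot> J = s \<cdot> h \<cdot> (inv z \<cdot> J)" by (simp add: mul_assoc)
      also have "\<dots> = s \<cdot> (h \<cdot> J0) \<cdot> inv z" unfolding Jz[symmetric] by (simp add: mul_assoc)
      finally have "s \<cdot> h \<cdot> inv z \<cdot> J = - (s \<cdot> (J0 \<cdot> h) \<cdot> inv z)"
        by (simp add: anti_swap[OF J0_X[OF J0] h] mul_minus_left mul_minus_right)
      with 1 show ?thesis by (simp add: anti_def)
    qed
    have bwd: "inv s \<cdot> A \<cdot> z \<in> anti J0" if A: "A \<in> anti J" for A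
    proof -
      note [simp] = anti_X[OF A]
      have "J0 \<cdot> (inv s \<cdot> A \<cdot> z) = J0 \<cdot> inv s \<cdot> (A \<cdot> z)" by (simp add: mul_assoc)
      also have "\<dots> = inv s \<cdot> (J \<cdot> A) \<cdot> z" unfolding Ji by (simp add: mul_assoc)
      finally have 1: "J0 \<cdot> (inv s \<cdot> A \<cdot> z) = inv s \<cdot> (J \<cdot> A) \<cdot> z" .
      have "inv s \<cdot> A \<cdot> z \<cdot> J0 = inv s \<cdot> A \<cdot> (z \<cdot> J0)" by (simp add: mul_assoc)
      also have "\<dots> = inv s \<cdot> (A \<cdot> J) \<cdot> z" unfolding zJ by (simp add: mul_assoc)
      finally have "inv s \<cdot> A \<cdot> z \<cdot> J0 = - (inv s \<cdot> (J \<cdot> A) \<cdot> z)"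
        by (simp add: anti_swap[OF J0_X[OF Ja] A] mul_minus_left mul_minus_right)
      with 1 show ?thesis by (simp add: anti_def)
    qed
    have "bij_betw (\<lambda>h. s \<cdot> h \<cdot> inv z) (anti J0) (anti J)"
    proof (rule bij_betw_byWitness[where f'="\<lambda>A. inv s \<cdot> A \<cdot> z"])
      show "(\<lambda>h. s \<cdot> h \<cdot> inv z) ` anti J0 \<subseteq> anti J" "(\<lambda>A. inv s \<cdot> A \<cdot> z) ` anti J \<subseteq> anti J0"
        using fwd bwd by blast+
    qed (auto simp: anti_X mul_assoc inv_left' inv_right' s z)
    then have "bij_betw (dir_deriv T (cinv (cayley_chart J0)) K) (anti J0) (anti J)"
      using bij_betw_cong[of "anti J0" "dir_deriv T (cinv (cayley_chart J0)) K" "\<lambda>h. s \<cdot> h \<cdot> inv z"] D by blast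
    moreover have "dir_deriv T (cinv (cayley_chart J0)) K (h \<cdot> J0) = dir_deriv T (cinv (cayley_chart J0)) K h \<cdot> J"
      if h: "h \<in> anti J0" for h
      unfolding D[OF h] D[OF anti_mul[OF J0 h]] using Jz by (simp add: mul_assoc anti_X[OF h])
    ultimately show ?thesis using cinv_cayley[OF J0 K] by (simp add: J_def)
  qed
  then show ?thesis by (simp add: induces_def cimg_cayley[OF J0])
qed

text \<open>Each structure is the centre of its own chart, since
  \<open>\<e> - J \<cdot> J = 2 *\<^sub>R \<e>\<close>; hence the charts cover.\<close>

lemma acs_in_cayley_dom:
  assumes "J \<in> acs"
  shows "J \<in> cayley_dom J"
  using assms G_scale[OF G_one, of 2] by (simp add: cayley_dom_def J0_sq scaleR_2)

theorem integrable_cayley: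
  shows "integrable_acs T acs anti (\<lambda>J A. A \<cdot> J)"
    and "complex_atlas T acs (cayley_chart ` acs)"
    and "complex_structure T acs \<C> \<and> induces T anti \<C> (\<lambda>J A. A \<cdot> J) \<longleftrightarrow>
      \<C> = complex_structure_of T acs (cayley_chart ` acs)"
proof -
  have sm: "smooth_chart T acs d" if "d \<in> cayley_chart ` acs" for d
    using that smooth_chart_cayley by blast
  have cover: "(\<Union>d\<in>cayley_chart ` acs. cdom d) = acs"
    using acs_in_cayley_dom by (auto simp: cayley_dom_def)
  have ind: "induces T anti (cayley_chart ` acs) (\<lambda>J A. A \<cdot> J)"
    unfolding induces_iff[of _ "cayley_chart ` acs"] using induces_cayley_chart by blast
  show at: "complex_atlas T acs (cayley_chart ` acs)"
    by (rule complex_atlas_induced[OF _ cover ind]) (rule sm)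
  show "integrable_acs T acs anti (\<lambda>J A. A \<cdot> J)"
    unfolding integrable_acs_def using at ind by blast
  show "complex_structure T acs \<C> \<and> induces T anti \<C> (\<lambda>J A. A \<cdot> J) \<longleftrightarrow>
      \<C> = complex_structure_of T acs (cayley_chart ` acs)"
    by (rule unique_induced_complex_structure[OF _ cover ind]) (rule sm)
qed

end

section \<open>Smooth matrix-valued functions\<close>

text \<open>The recursion of \<open>iter_deriv\<close> removes the derivative taken last. Inductions
  on the order have to remove the one taken first, so that the hypothesis applies to the first
  derivative of the function.\<close>

lemma iter_deriv_snoc: "iter_deriv (vs @ [v]) f = iter_deriv vs (iter_deriv [v] f)"
  by (induction vs) simp_all

lemma has_derivative_cong_open:
  assumes "open U" "x \<in> U" "\<And>y. y \<in> U \<Longrightarrow> f y = g y"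
  shows "(f has_derivative D) (at x) \<longleftrightarrow> (g has_derivative D) (at x)"
  using has_derivative_transform_within_open[OF _ assms(1,2), of f D UNIV g]
    has_derivative_transform_within_open[OF _ assms(1,2), of g D UNIV f] assms(3) by auto

lemma frechet_derivative_cong_open:
  assumes "open U" "x \<in> U" "\<And>y. y \<in> U \<Longrightarrow> f y = g y"
  shows "frechet_derivative f (at x) = frechet_derivative g (at x)"
  unfolding frechet_derivative_def using has_derivative_cong_open[OF assms] by simp

lemma differentiable_cong_open:
  assumes "open U" "x \<in> U" "\<And>y. y \<in> U \<Longrightarrow> f y = g y"
  shows "f differentiable (at x) \<longleftrightarrow> g differentiable (at x)"
  unfolding differentiable_def using has_derivative_cong_open[OF assms] by simp

lemma iter_deriv_cong_open:
  assumes "open U" "x \<in> U" "\<And>y. y \<in> U \<Longrightarrow> f y = g y"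
  shows "iter_deriv vs f x = iter_deriv vs g x"
  using assms(2)
proof (induction vs arbitrary: x)
  case (Cons v vs)
  then show ?case using frechet_derivative_cong_open[OF assms(1), of x "iter_deriv vs f" "iter_deriv vs g"] by simp
qed (use assms in simp)

text \<open>Off by one: this is differentiability of order \<open>n + 1\<close>.\<close>

definition diff_order :: "nat \<Rightarrow> 'a::real_normed_vector set \<Rightarrow> ('a \<Rightarrow> 'b::real_normed_vector) \<Rightarrow> bool"
  where "diff_order n U f \<longleftrightarrow> (\<forall>vs. length vs \<le> n \<longrightarrow> (\<forall>x\<in>U. iter_deriv vs f differentiable (at x)))"

lemma smooth_on_iff: "smooth_on U f \<longleftrightarrow> open U \<and> (\<forall>n. diff_order n U f)"
  by (auto simp: smooth_on_def diff_order_def)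

lemma diff_order_0: "diff_order 0 U f \<longleftrightarrow> (\<forall>x\<in>U. f differentiable (at x))"
  by (simp add: diff_order_def)

lemma all_list_snoc:
  "(\<forall>vs. length vs \<le> Suc n \<longrightarrow> Q vs) \<longleftrightarrow> Q [] \<and> (\<forall>v vs. length vs \<le> n \<longrightarrow> Q (vs @ [v]))"
proof (intro iffI conjI allI impI)
  fix vs :: "'a list" assume *: "Q [] \<and> (\<forall>v vs. length vs \<le> n \<longrightarrow> Q (vs @ [v]))" "length vs \<le> Suc n"
  then show "Q vs" by (cases vs rule: rev_cases) auto
qed auto

lemma diff_order_Suc: "diff_order (Suc n) U f \<longleftrightarrow> diff_order 0 U f \<and> (\<forall>v. diff_order n U (iter_deriv [v] f))"
  unfolding diff_order_def[of "Suc n"] all_list_snoc iter_deriv_snoc diff_order_0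
  by (auto simp: diff_order_def)

lemma diff_order_le: "diff_order n U f \<Longrightarrow> m \<le> n \<Longrightarrow> diff_order m U f"
  by (auto simp: diff_order_def)

lemma diff_order_differentiable: "\<lbrakk>diff_order n U f; x \<in> U\<rbrakk> \<Longrightarrow> f differentiable (at x)"
  using diff_order_le[of n U f 0] by (simp add: diff_order_0)

lemma diff_order_cong:
  assumes "open U" "\<And>y. y \<in> U \<Longrightarrow> f y = g y"
  shows "diff_order n U f \<longleftrightarrow> diff_order n U g"
proof -
  have "iter_deriv vs f differentiable (at x) \<longleftrightarrow> iter_deriv vs g differentiable (at x)" if "x \<in> U" for vs x
    by (rule differentiable_cong_open[OF assms(1) that]) (rule iter_deriv_cong_open[OF assms(1) _ assms(2)])
  then show ?thesis by (simp add: diff_order_def)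
qed

lemma smooth_on_cong:
  assumes "\<And>y. y \<in> U \<Longrightarrow> f y = g y"
  shows "smooth_on U f \<longleftrightarrow> smooth_on U g"
proof -
  have "open U \<Longrightarrow> diff_order n U f \<longleftrightarrow> diff_order n U g" for n by (rule diff_order_cong[OF _ assms])
  then show ?thesis by (auto simp: smooth_on_iff)
qed

lemma smooth_on_iter: "smooth_on U f \<Longrightarrow> x \<in> U \<Longrightarrow> iter_deriv vs f differentiable (at x)"
  by (simp add: smooth_on_def)

lemma smooth_on_deriv: "smooth_on U f \<Longrightarrow> smooth_on U (iter_deriv [v] f)"
  unfolding smooth_on_iff using diff_order_Suc by blast

lemma smooth_on_continuous: "smooth_on U f \<Longrightarrow> continuous_on U (iter_deriv vs f)"
  by (meson continuous_at_imp_continuous_on differentiable_imp_continuous_within smooth_on_iter)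

lemma iter_deriv1_const: "iter_deriv [v] (\<lambda>x. c) = (\<lambda>x. 0)"
  by (simp add: frechet_derivative_const)

lemma diff_order_const: "diff_order n U (\<lambda>x. c)"
proof (induction n arbitrary: c)
  case (Suc n)
  then show ?case unfolding diff_order_Suc iter_deriv1_const by (simp add: diff_order_0)
qed (simp add: diff_order_0)

lemma smooth_on_const: "open U \<Longrightarrow> smooth_on U (\<lambda>x. c)"
  by (simp add: smooth_on_iff diff_order_const)

lemma frechet_bilinear:
  assumes "bounded_bilinear b" "f differentiable (at x)" "g differentiable (at x)"
  shows "((\<lambda>x. b (f x) (g x)) has_derivative
    (\<lambda>v. b (f x) (frechet_derivative g (at x) v) + b (frechet_derivative f (at x) v) (g x))) (at x)"
  by (rule bounded_bilinear.FDERIV[OF assms(1)]) (use assms frechet_derivative_works in blast)+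

lemma iter_deriv1_bilinear:
  assumes "bounded_bilinear b" "f differentiable (at x)" "g differentiable (at x)"
  shows "iter_deriv [v] (\<lambda>x. b (f x) (g x)) x = b (f x) (iter_deriv [v] g x) + b (iter_deriv [v] f x) (g x)"
  using frechet_derivative_at[OF frechet_bilinear[OF assms]] by (simp add: fun_eq_iff)

lemma iter_deriv1_add:
  assumes "f differentiable (at x)" "g differentiable (at x)"
  shows "iter_deriv [v] (\<lambda>x. f x + g x) x = iter_deriv [v] f x + iter_deriv [v] g x"
proof -
  have "((\<lambda>x. f x + g x) has_derivative (\<lambda>h. frechet_derivative f (at x) h + frechet_derivative g (at x) h)) (at x)"
    using assms frechet_derivative_works by (blast intro: has_derivative_add)
  from frechet_derivative_at[OF this] show ?thesis by (simp add: fun_eq_iff)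
qed

lemma diff_order_add:
  assumes "open U" "diff_order n U f" "diff_order n U g"
  shows "diff_order n U (\<lambda>x. f x + g x)"
  using assms(2,3)
proof (induction n arbitrary: f g)
  case (Suc n)
  have d: "f differentiable (at x)" "g differentiable (at x)" if "x \<in> U" for x
    using Suc.prems diff_order_differentiable that by blast+
  have "diff_order n U (iter_deriv [v] (\<lambda>x. f x + g x))" for v
  proof -
    have "diff_order n U (\<lambda>x. iter_deriv [v] f x + iter_deriv [v] g x)"
      by (rule Suc.IH) (use Suc.prems diff_order_Suc in blast)+
    then show ?thesis
      by (rule diff_order_cong[OF assms(1), THEN iffD1, rotated]) (rule iter_deriv1_add[OF d, symmetric])
  qed
  then show ?case unfolding diff_order_Suc diff_order_0 using d differentiable_add by blast
qed (auto simp: diff_order_0 intro: differentiable_add)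

text \<open>By the Leibniz rule the derivative is a sum of two terms of the same bilinear form, and
  \<open>f\<close>, \<open>g\<close> are general in the induction so that one of them may be
  replaced by its derivative.\<close>

lemma diff_order_bilinear:
  assumes b: "bounded_bilinear b" and U: "open U" and "diff_order n U f" "diff_order n U g"
  shows "diff_order n U (\<lambda>x. b (f x) (g x))"
  using assms(3,4)
proof (induction n arbitrary: f g)
  case 0
  then show ?case unfolding diff_order_0 using frechet_bilinear[OF b] differentiableI by blast
next
  case (Suc n)
  have d: "f differentiable (at x)" "g differentiable (at x)" if "x \<in> U" for x
    using Suc.prems diff_order_differentiable that by blast+
  have "diff_order n U (iter_deriv [v] (\<lambda>x. b (f x) (g x)))" for v
  proof -
    have "diff_order n U (\<lambda>x. b (f x) (iter_deriv [v] g x) + b (iter_deriv [v] f x) (g x))"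
      by (intro diff_order_add[OF U] Suc.IH)
        (use Suc.prems diff_order_Suc diff_order_le[of "Suc n" U _ n] in \<open>blast intro: le_SucI order_refl\<close>)+
    then show ?thesis
      by (rule diff_order_cong[OF U, THEN iffD1, rotated]) (rule iter_deriv1_bilinear[OF b d, symmetric])
  qed
  then show ?case unfolding diff_order_Suc diff_order_0
    using frechet_bilinear[OF b d] differentiableI by blast
qed

lemma smooth_on_add: "\<lbrakk>smooth_on U f; smooth_on U g\<rbrakk> \<Longrightarrow> smooth_on U (\<lambda>x. f x + g x)"
  by (simp add: smooth_on_iff diff_order_add)

lemma smooth_on_bilinear:
  "\<lbrakk>bounded_bilinear b; smooth_on U f; smooth_on U g\<rbrakk> \<Longrightarrow> smooth_on U (\<lambda>x. b (f x) (g x))"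
  by (simp add: smooth_on_iff diff_order_bilinear)

lemma smooth_on_scaleR: "smooth_on U f \<Longrightarrow> smooth_on U (\<lambda>x. r *\<^sub>R f x)"
  by (rule smooth_on_bilinear[OF bounded_bilinear_scaleR smooth_on_const]) (auto simp: smooth_on_def)

lemma iter_deriv_add:
  assumes "smooth_on U f" "smooth_on U g" "x \<in> U"
  shows "iter_deriv vs (\<lambda>x. f x + g x) x = iter_deriv vs f x + iter_deriv vs g x"
  using assms(3)
proof (induction vs arbitrary: x)
  case (Cons v vs)
  have U: "open U" using assms by (simp add: smooth_on_def)
  have "iter_deriv (v # vs) (\<lambda>x. f x + g x) x = iter_deriv [v] (\<lambda>x. iter_deriv vs f x + iter_deriv vs g x) x"
    using frechet_derivative_cong_open[OF U Cons.prems Cons.IH] by simp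
  then show ?case using iter_deriv1_add[OF smooth_on_iter smooth_on_iter] assms Cons.prems by force
qed simp

lemma iter_deriv_scaleR:
  assumes "smooth_on U f" "x \<in> U"
  shows "iter_deriv vs (\<lambda>x. r *\<^sub>R f x) x = r *\<^sub>R iter_deriv vs f x"
  using assms(2)
proof (induction vs arbitrary: x)
  case (Cons v vs)
  have U: "open U" using assms by (simp add: smooth_on_def)
  have "iter_deriv (v # vs) (\<lambda>x. r *\<^sub>R f x) x = iter_deriv [v] (\<lambda>x. r *\<^sub>R iter_deriv vs f x) x"
    using frechet_derivative_cong_open[OF U Cons.prems Cons.IH] by simp
  also have "\<dots> = r *\<^sub>R iter_deriv [v] (iter_deriv vs f) x"
    using iter_deriv1_bilinear[OF bounded_bilinear_scaleR _ smooth_on_iter[OF assms(1) Cons.prems], of "\<lambda>_. r"]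
    by (simp add: frechet_derivative_const)
  finally show ?case by simp
qed simp

text \<open>Uniform convergence on compact sets of all derivatives up to order \<open>n\<close>; in
  contrast to \<open>diff_order\<close>, the order is exact and \<open>n = 0\<close> concerns the
  functions themselves. It is the one-chart form of convergence in
  \<open>Cinf_topology\<close>.\<close>

definition conv_order ::
  "nat \<Rightarrow> 'a::real_normed_vector set \<Rightarrow> 'i filter \<Rightarrow> ('i \<Rightarrow> 'a \<Rightarrow> 'b::real_normed_vector) \<Rightarrow> ('a \<Rightarrow> 'b) \<Rightarrow> bool"
  where "conv_order n U F fs f \<longleftrightarrow> (\<forall>vs. length vs \<le> n \<longrightarrow> (\<forall>C. compact C \<and> C \<subseteq> U \<longrightarrow>
    uniform_limit C (\<lambda>i. iter_deriv vs (fs i)) (iter_deriv vs f) F))"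

lemma conv_order_0:
  "conv_order 0 U F fs f \<longleftrightarrow> (\<forall>C. compact C \<and> C \<subseteq> U \<longrightarrow> uniform_limit C fs f F)"
  by (simp add: conv_order_def)

lemma conv_order_Suc:
  "conv_order (Suc n) U F fs f \<longleftrightarrow> conv_order 0 U F fs f \<and>
    (\<forall>v. conv_order n U F (\<lambda>i. iter_deriv [v] (fs i)) (iter_deriv [v] f))"
  unfolding conv_order_def[of "Suc n"] all_list_snoc iter_deriv_snoc conv_order_0
  by (auto simp: conv_order_def)

lemma conv_order_le: "conv_order n U F fs f \<Longrightarrow> m \<le> n \<Longrightarrow> conv_order m U F fs f"
  by (auto simp: conv_order_def)

lemma conv_order_cong:
  fixes U :: "'a::real_normed_vector set"
  assumes U: "open U" and "\<forall>\<^sub>F i in F. \<forall>y\<in>U. fs i y = gs i y" "\<And>y. y \<in> U \<Longrightarrow> f y = g y"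
    and "conv_order n U F fs f"
  shows "conv_order n U F gs g"
  unfolding conv_order_def
proof (intro allI impI)
  fix vs :: "'a list" and C assume vs: "length vs \<le> n" and C: "compact C \<and> C \<subseteq> U"
  have "\<forall>\<^sub>F i in F. \<forall>y\<in>C. iter_deriv vs (fs i) y = iter_deriv vs (gs i) y"
    using assms(2) by eventually_elim (use C in \<open>blast intro: iter_deriv_cong_open[OF U]\<close>)
  moreover have "iter_deriv vs f y = iter_deriv vs g y" if "y \<in> C" for y
    by (rule iter_deriv_cong_open[OF U _ assms(3)]) (use that C in auto)
  moreover have "uniform_limit C (\<lambda>i. iter_deriv vs (fs i)) (iter_deriv vs f) F"
    using assms(4) vs C by (simp add: conv_order_def)
  ultimately show "uniform_limit C (\<lambda>i. iter_deriv vs (gs i)) (iter_deriv vs g) F"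
    by (subst (asm) uniform_limit_cong) auto
qed

lemma conv_order_add:
  fixes U :: "'a::real_normed_vector set"
  assumes sm: "\<forall>\<^sub>F i in F. smooth_on U (fs i)" "\<forall>\<^sub>F i in F. smooth_on U (gs i)" "smooth_on U f" "smooth_on U g"
    and "conv_order n U F fs f" "conv_order n U F gs g"
  shows "conv_order n U F (\<lambda>i x. fs i x + gs i x) (\<lambda>x. f x + g x)"
  unfolding conv_order_def
proof (intro allI impI)
  fix vs :: "'a list" and C assume vs: "length vs \<le> n" and C: "compact C \<and> C \<subseteq> U"
  have "uniform_limit C (\<lambda>i x. iter_deriv vs (fs i) x + iter_deriv vs (gs i) x)
      (\<lambda>x. iter_deriv vs f x + iter_deriv vs g x) F"
    using assms(5,6) vs C by (auto simp: conv_order_def intro!: uniform_limit_add)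
  moreover have "\<forall>\<^sub>F i in F. \<forall>y\<in>C. iter_deriv vs (fs i) y + iter_deriv vs (gs i) y = iter_deriv vs (\<lambda>x. fs i x + gs i x) y"
    using sm(1,2) by eventually_elim (use C iter_deriv_add in \<open>metis subsetD\<close>)
  moreover have "iter_deriv vs f y + iter_deriv vs g y = iter_deriv vs (\<lambda>x. f x + g x) y" if "y \<in> C" for y
    using sm(3,4) that C iter_deriv_add by (metis subsetD)
  ultimately show "uniform_limit C (\<lambda>i. iter_deriv vs (\<lambda>x. fs i x + gs i x)) (iter_deriv vs (\<lambda>x. f x + g x)) F"
    by (subst (asm) uniform_limit_cong) auto
qed

text \<open>In order \<open>0\<close>, uniform limits multiply because the limit functions are
  bounded on compact sets. Higher orders follow from the Leibniz rule, where smoothness of the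
  approximants is needed only eventually.\<close>

lemma conv_order_bilinear:
  assumes b: "bounded_bilinear b"
    and "\<forall>\<^sub>F i in F. smooth_on U (fs i)" "\<forall>\<^sub>F i in F. smooth_on U (gs i)" "smooth_on U f" "smooth_on U g"
    and "conv_order n U F fs f" "conv_order n U F gs g"
  shows "conv_order n U F (\<lambda>i x. b (fs i x) (gs i x)) (\<lambda>x. b (f x) (g x))"
  using assms(2-)
proof (induction n arbitrary: fs gs f g)
  case 0
  show ?case
    unfolding conv_order_0
  proof (intro allI impI)
    fix C assume C: "compact C \<and> C \<subseteq> U"
    have "bounded (f ` C)" "bounded (g ` C)"
      using C smooth_on_continuous[OF 0(3), of "[]"] smooth_on_continuous[OF 0(4), of "[]"]
      by (auto intro!: compact_imp_bounded compact_continuous_image elim: continuous_on_subset)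
    then show "uniform_limit C (\<lambda>i x. b (fs i x) (gs i x)) (\<lambda>x. b (f x) (g x)) F"
      using 0 C by (intro bounded_bilinear.bounded_uniform_limit[OF b]) (auto simp: conv_order_0)
  qed
next
  case (Suc n)
  have U: "open U" using Suc.prems by (simp add: smooth_on_def)
  note c = Suc.prems(5,6)[unfolded conv_order_Suc]
  have c0: "conv_order n U F fs f" "conv_order n U F gs g"
    using Suc.prems(5,6) by (auto intro: conv_order_le)
  have d1: "\<forall>\<^sub>F i in F. smooth_on U (iter_deriv [v] (fs i))" for v
    using Suc.prems(1) by eventually_elim (rule smooth_on_deriv)
  have d2: "\<forall>\<^sub>F i in F. smooth_on U (iter_deriv [v] (gs i))" for v
    using Suc.prems(2) by eventually_elim (rule smooth_on_deriv)
  have ev1: "\<forall>\<^sub>F i in F. smooth_on U (\<lambda>x. b (fs i x) (iter_deriv [v] (gs i) x))" for v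
    using Suc.prems(1) d2[of v] by eventually_elim (rule smooth_on_bilinear[OF b])
  have ev2: "\<forall>\<^sub>F i in F. smooth_on U (\<lambda>x. b (iter_deriv [v] (fs i) x) (gs i x))" for v
    using d1[of v] Suc.prems(2) by eventually_elim (rule smooth_on_bilinear[OF b])
  have "conv_order n U F (\<lambda>i. iter_deriv [v] (\<lambda>x. b (fs i x) (gs i x))) (iter_deriv [v] (\<lambda>x. b (f x) (g x)))" for v
  proof (rule conv_order_cong[OF U])
    show "conv_order n U F (\<lambda>i x. b (fs i x) (iter_deriv [v] (gs i) x) + b (iter_deriv [v] (fs i) x) (gs i x))
      (\<lambda>x. b (f x) (iter_deriv [v] g x) + b (iter_deriv [v] f x) (g x))"
    proof (rule conv_order_add[OF ev1 ev2])
      show "conv_order n U F (\<lambda>i x. b (fs i x) (iter_deriv [v] (gs i) x)) (\<lambda>x. b (f x) (iter_deriv [v] g x))"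
        using Suc.IH[OF Suc.prems(1) d2 Suc.prems(3) smooth_on_deriv[OF Suc.prems(4)] c0(1)] c by blast
      show "conv_order n U F (\<lambda>i x. b (iter_deriv [v] (fs i) x) (gs i x)) (\<lambda>x. b (iter_deriv [v] f x) (g x))"
        using Suc.IH[OF d1 Suc.prems(2) smooth_on_deriv[OF Suc.prems(3)] Suc.prems(4) _ c0(2)] c by blast
    qed (use Suc.prems in \<open>auto intro!: smooth_on_bilinear[OF b] smooth_on_deriv simp del: iter_deriv.simps\<close>)
    show "\<forall>\<^sub>F i in F. \<forall>y\<in>U. b (fs i y) (iter_deriv [v] (gs i) y) + b (iter_deriv [v] (fs i) y) (gs i y) =
        iter_deriv [v] (\<lambda>x. b (fs i x) (gs i x)) y"
      using Suc.prems(1,2)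
    proof eventually_elim
      case (elim i)
      then show ?case using iter_deriv1_bilinear[OF b] smooth_on_iter[of U _ _ "[]"] by (metis iter_deriv.simps(1))
    qed
    show "b (f y) (iter_deriv [v] g y) + b (iter_deriv [v] f y) (g y) = iter_deriv [v] (\<lambda>x. b (f x) (g x)) y"
      if "y \<in> U" for y
      using iter_deriv1_bilinear[OF b] smooth_on_iter[of U _ _ "[]"] Suc.prems(3,4) that by (metis iter_deriv.simps(1))
  qed
  moreover have "conv_order 0 U F (\<lambda>i x. b (fs i x) (gs i x)) (\<lambda>x. b (f x) (g x))"
    using Suc.IH[OF Suc.prems(1-4) c0] by (rule conv_order_le) simp
  ultimately show ?case unfolding conv_order_Suc by blast
qed

section \<open>Inversion of matrix-valued functions\<close>

lemma bounded_bilinear_mm: "bounded_bilinear ((**) :: real^'d^'d \<Rightarrow> real^'d^'d \<Rightarrow> real^'d^('d::finite))"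
  unfolding bilinear_conv_bounded_bilinear[symmetric] bilinear_def
  by (auto intro!: linearI simp: matrix_matrix_mult_def vec_eq_iff sum.distrib sum_distrib_left algebra_simps)

text \<open>The resolvent identity, from which continuity, differentiability and convergence of
  inverses are all derived.\<close>

lemma matrix_inverse_diff:
  fixes A B A' B' :: "real^'d^('d::finite)"
  assumes "A ** B = mat 1" "B' ** A' = mat 1"
  shows "B' - B = B' ** (A - A') ** B"
proof -
  have "B' ** A ** B = B'" using assms by (simp add: matrix_mul_assoc[symmetric])
  moreover have "B' ** A' ** B = B" using assms by simp
  ultimately show ?thesis
    by (simp add: bounded_bilinear.diff_left[OF bounded_bilinear_mm] bounded_bilinear.diff_right[OF bounded_bilinear_mm])
qed

lemma norm_mm_le: "\<exists>K>0. \<forall>(A :: real^'d^('d::finite)) (B :: real^'d^'d). norm (A ** B) \<le> norm A * norm B * K"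
  by (rule bounded_bilinear.pos_bounded[OF bounded_bilinear_mm])

text \<open>No bound on \<open>Bs\<close> is assumed. The resolvent identity bounds the error by a
  small multiple of the norm of \<open>Bs i y\<close> itself; absorbing it yields the bound
  \<open>2 * M\<close>, which is then put back into the identity.\<close>

lemma uniform_limit_matrix_inverse:
  fixes A B :: "'a \<Rightarrow> real^'d^('d::finite)"
  assumes lim: "uniform_limit C As A F" and bd: "bounded (B ` C)"
    and inv: "\<And>y. y \<in> C \<Longrightarrow> A y ** B y = mat 1"
      "\<forall>\<^sub>F i in F. \<forall>y\<in>C. Bs i y ** As i y = mat 1"
  shows "uniform_limit C Bs B F"
proof (rule uniform_limitI)
  fix e :: real assume e: "e > 0"
  obtain K where K: "K > 0" "\<And>(A :: real^'d^'d) (B :: real^'d^'d). norm (A ** B) \<le> norm A * norm B * K"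
    using norm_mm_le[where 'd='d] by blast
  obtain M where M: "M > 0" "\<And>y. y \<in> C \<Longrightarrow> norm (B y) \<le> M"
    using bd unfolding bounded_pos by auto
  \<comment> \<open>The first entry makes the factor in the resolvent estimate at most
    \<open>1 / 2\<close>, as absorption requires; the second makes the final error at most
    \<open>e / 2\<close>.\<close>
  define \<delta> where "\<delta> = min (1 / (2 * K * K * M)) (e / (4 * K * K * M * M))"
  have \<delta>: "\<delta> > 0" "K * K * M * \<delta> \<le> 1 / 2" "K * K * M * M * \<delta> \<le> e / 4"
  proof -
    show "\<delta> > 0" using K M e by (simp add: \<delta>_def)
    have "\<delta> \<le> 1 / (2 * K * K * M)" "\<delta> \<le> e / (4 * K * K * M * M)" by (auto simp: \<delta>_def)
    then show "K * K * M * \<delta> \<le> 1 / 2" "K * K * M * M * \<delta> \<le> e / 4"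
      using K M by (auto simp: field_simps)
  qed
  show "\<forall>\<^sub>F i in F. \<forall>y\<in>C. dist (Bs i y) (B y) < e"
    using uniform_limitD[OF lim \<delta>(1)] inv(2)
  proof eventually_elim
    case (elim i)
    show ?case
    proof
      fix y assume y: "y \<in> C"
      have "norm (Bs i y ** (A y - As i y) ** B y) \<le> norm (Bs i y ** (A y - As i y)) * norm (B y) * K" by (rule K)
      also have "\<dots> \<le> (norm (Bs i y) * norm (A y - As i y) * K) * norm (B y) * K"
        using K by (intro mult_right_mono) auto
      also have "\<dots> \<le> (norm (Bs i y) * \<delta> * K) * M * K"
        using elim(1) y K(1) M(2)[OF y] \<delta>(1)
        by (intro mult_right_mono mult_mono mult_left_mono) (auto simp: dist_norm norm_minus_commute less_imp_le)
      finally have b: "norm (Bs i y - B y) \<le> norm (Bs i y) * (K * K * M * \<delta>)"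
        using matrix_inverse_diff[OF inv(1)[OF y] elim(2)[rule_format, OF y]] by (simp add: mult_ac)
      also have "\<dots> \<le> norm (Bs i y) * (1 / 2)" by (intro mult_left_mono \<delta>) simp
      finally have "norm (Bs i y) \<le> 2 * M"
        using norm_triangle_sub[of "Bs i y" "B y"] M(2)[OF y] by simp
      then have "norm (Bs i y) * (K * K * M * \<delta>) \<le> 2 * M * (K * K * M * \<delta>)"
        using K M \<delta> by (intro mult_right_mono) auto
      then show "dist (Bs i y) (B y) < e" using b \<delta>(3) e by (simp add: dist_norm mult_ac)
    qed
  qed
qed

text \<open>By the resolvent identity the remainder splits in two: one part contains the remainder
  of \<open>A\<close>, the other contains \<open>B y - B x\<close> next to \<open>A' (y - x)\<close>
  and is small because \<open>B\<close> is continuous at \<open>x\<close>.\<close>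

lemma has_derivative_matrix_inverse:
  fixes A B :: "'a::real_normed_vector \<Rightarrow> real^'d^('d::finite)"
  assumes U: "open U" "x \<in> U" and A: "(A has_derivative A') (at x)"
    and inv: "\<And>y. y \<in> U \<Longrightarrow> A y ** B y = mat 1" "\<And>y. y \<in> U \<Longrightarrow> B y ** A y = mat 1"
  shows "(B has_derivative (\<lambda>h. - (B x ** A' h ** B x))) (at x)"
proof -
  note mm = bounded_bilinear_mm[where 'd='d]
  interpret mm: bounded_bilinear "(**) :: real^'d^'d \<Rightarrow> real^'d^'d \<Rightarrow> real^'d^'d" by (rule mm)
  obtain K where K: "K > 0" "\<And>(A :: real^'d^'d) (B :: real^'d^'d). norm (A ** B) \<le> norm A * norm B * K"
    using norm_mm_le[where 'd='d] by blast
  have K3: "norm (P ** Q ** R) \<le> norm P * norm Q * norm R * K * K" for P Q R :: "real^'d^'d"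
  proof -
    have "norm (P ** Q ** R) \<le> norm (P ** Q) * norm R * K" by (rule K)
    also have "\<dots> \<le> (norm P * norm Q * K) * norm R * K" using K by (intro mult_right_mono) auto
    finally show ?thesis by (simp add: mult_ac)
  qed
  have bl: "bounded_linear A'" using A by (rule has_derivative_bounded_linear)
  obtain L where L: "L > 0" "\<And>h. norm (A' h) \<le> norm h * L"
    using bounded_linear.pos_bounded[OF bl] by blast
  have evU: "\<forall>\<^sub>F y in at x. y \<in> U" using U eventually_at_in_open' by blast
  have "(A \<longlongrightarrow> A x) (at x)" using A has_derivative_continuous by (auto simp: continuous_within)
  \<comment> \<open>Continuity of \<open>B\<close> at \<open>x\<close> is uniform convergence of
    inverses on a one-point set.\<close>
  then have "uniform_limit {x} (\<lambda>y _. A y) (\<lambda>_. A x) (at x)" by (simp add: uniform_limit_singleton)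
  then have "uniform_limit {x} (\<lambda>y _. B y) (\<lambda>_. B x) (at x)"
    by (rule uniform_limit_matrix_inverse) (use inv U evU in \<open>auto elim: eventually_mono\<close>)
  then have B: "(B \<longlongrightarrow> B x) (at x)" by (simp add: uniform_limit_singleton)
  let ?r = "\<lambda>y. norm (A y - A x - A' (y - x)) / norm (y - x)"
  have r: "(?r \<longlongrightarrow> 0) (at x)" using A unfolding has_derivative_iff_norm by simp
  show ?thesis
    unfolding has_derivative_iff_norm
  proof
    show "bounded_linear (\<lambda>h. - (B x ** A' h ** B x))"
      by (intro bounded_linear_minus bounded_linear_compose[OF mm.bounded_linear_left]
          bounded_linear_compose[OF mm.bounded_linear_right] bl)
    let ?g = "\<lambda>y. norm (B y) * ?r y * norm (B x) * K * K + norm (B y - B x) * L * norm (B x) * K * K"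
    show "((\<lambda>y. norm (B y - B x - - (B x ** A' (y - x) ** B x)) / norm (y - x)) \<longlongrightarrow> 0) (at x)"
    proof (rule Lim_null_comparison)
      have "((\<lambda>y. norm (B y - B x)) \<longlongrightarrow> 0) (at x)" using B by (simp add: LIM_zero tendsto_norm_zero)
      then have "(?g \<longlongrightarrow> norm (B x) * 0 * norm (B x) * K * K + 0 * L * norm (B x) * K * K) (at x)"
        by (intro tendsto_intros B r)
      then show "(?g \<longlongrightarrow> 0) (at x)" by simp
      have ne: "\<forall>\<^sub>F y in at x. y \<noteq> x" by (simp add: eventually_at_filter)
      show "\<forall>\<^sub>F y in at x. norm (norm (B y - B x - - (B x ** A' (y - x) ** B x)) / norm (y - x)) \<le> ?g y"
        using evU ne
      proof eventually_elim
        case (elim y)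
        have "B y - B x = B y ** (A x - A y) ** B x"
          by (rule matrix_inverse_diff) (use inv U elim in auto)
        moreover have "B y ** (A x - A y) ** B x - - (B x ** A' (y - x) ** B x)
          = - (B y ** (A y - A x - A' (y - x)) ** B x) - (B y - B x) ** A' (y - x) ** B x"
          by (simp add: mm.diff_left mm.diff_right)
        ultimately have "B y - B x - - (B x ** A' (y - x) ** B x)
          = - (B y ** (A y - A x - A' (y - x)) ** B x) - (B y - B x) ** A' (y - x) ** B x"
          by simp
        then have "norm (B y - B x - - (B x ** A' (y - x) ** B x))
          \<le> norm (B y ** (A y - A x - A' (y - x)) ** B x) + norm ((B y - B x) ** A' (y - x) ** B x)"
          using norm_triangle_ineq4 by (metis norm_minus_cancel)
        also have "\<dots> \<le> norm (B y) * norm (A y - A x - A' (y - x)) * norm (B x) * K * K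
            + norm (B y - B x) * norm (A' (y - x)) * norm (B x) * K * K"
          by (intro add_mono K3)
        also have "\<dots> \<le> norm (B y) * norm (A y - A x - A' (y - x)) * norm (B x) * K * K
            + norm (B y - B x) * (norm (y - x) * L) * norm (B x) * K * K"
          using K L by (intro add_left_mono mult_right_mono mult_left_mono) auto
        also have "\<dots> = ?g y * norm (y - x)" using elim by (simp add: field_simps)
        finally show ?case using elim by (simp add: divide_le_eq)
      qed
    qed
  qed
qed

lemma iter_deriv1_matrix_inverse:
  fixes A B :: "'a::real_normed_vector \<Rightarrow> real^'d^('d::finite)"
  assumes "open U" "x \<in> U" "A differentiable (at x)"
    and "\<And>y. y \<in> U \<Longrightarrow> A y ** B y = mat 1" "\<And>y. y \<in> U \<Longrightarrow> B y ** A y = mat 1"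
  shows "B differentiable (at x)" "iter_deriv [v] B x = - (B x ** iter_deriv [v] A x ** B x)"
proof -
  have *: "(B has_derivative (\<lambda>h. - (B x ** frechet_derivative A (at x) h ** B x))) (at x)"
    by (rule has_derivative_matrix_inverse[OF assms(1,2) _ assms(4,5)]) (use assms(3) frechet_derivative_works in blast)+
  then show "B differentiable (at x)" by (rule differentiableI)
  show "iter_deriv [v] B x = - (B x ** iter_deriv [v] A x ** B x)"
    using frechet_derivative_at[OF *] by (simp add: fun_eq_iff)
qed

text \<open>Bootstrapping: the derivative \<open>- (B x ** iter_deriv [v] A x ** B x)\<close> is as
  often differentiable as \<open>B\<close> is already known to be, which gains one order for
  \<open>B\<close>.\<close>

lemma smooth_on_matrix_inverse:
  fixes A B :: "'a::real_normed_vector \<Rightarrow> real^'d^('d::finite)"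
  assumes A: "smooth_on U A"
    and inv: "\<And>y. y \<in> U \<Longrightarrow> A y ** B y = mat 1" "\<And>y. y \<in> U \<Longrightarrow> B y ** A y = mat 1"
  shows "smooth_on U B"
proof -
  have U: "open U" using A by (simp add: smooth_on_def)
  note d = iter_deriv1_matrix_inverse[OF U _ smooth_on_iter[OF A, of _ "[]", simplified] inv]
  have "diff_order n U B" for n
  proof (induction n)
    case (Suc n)
    have "diff_order n U (iter_deriv [v] B)" for v
    proof -
      have "diff_order n U (iter_deriv [v] A)" using smooth_on_deriv[OF A] by (simp add: smooth_on_iff)
      then have "diff_order n U (\<lambda>x. B x ** iter_deriv [v] A x ** B x)"
        by (intro diff_order_bilinear[OF bounded_bilinear_mm U] Suc.IH)
      from diff_order_bilinear[OF bounded_bilinear_scaleR U diff_order_const this, of "-1"]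
      show ?thesis by (rule diff_order_cong[OF U, THEN iffD1, rotated]) (simp add: d(2)[simplified])
    qed
    then show ?case unfolding diff_order_Suc diff_order_0 using d(1) by blast
  qed (simp add: diff_order_0 d(1))
  then show ?thesis using U by (simp add: smooth_on_iff)
qed

text \<open>The same bootstrapping for convergence: the formula for the first derivative of an
  inverse involves the inverse only in the order already treated.\<close>

lemma conv_order_matrix_inverse:
  fixes A B :: "'a::real_normed_vector \<Rightarrow> real^'d^('d::finite)"
  assumes sm: "\<forall>\<^sub>F i in F. smooth_on U (As i)" "smooth_on U A"
    and inv: "\<And>y. y \<in> U \<Longrightarrow> A y ** B y = mat 1" "\<And>y. y \<in> U \<Longrightarrow> B y ** A y = mat 1"
    and invs: "\<forall>\<^sub>F i in F. \<forall>y\<in>U. As i y ** Bs i y = mat 1 \<and> Bs i y ** As i y = mat 1"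
    and conv: "\<And>n. conv_order n U F As A"
  shows "conv_order n U F Bs B"
proof (induction n)
  case 0
  show ?case
    unfolding conv_order_0
  proof (intro allI impI)
    fix C assume C: "compact C \<and> C \<subseteq> U"
    have "continuous_on C B"
      using smooth_on_continuous[OF smooth_on_matrix_inverse[OF sm(2) inv], of "[]"] C
      by (auto elim: continuous_on_subset)
    then have bd: "bounded (B ` C)" using C by (auto intro!: compact_imp_bounded compact_continuous_image)
    show "uniform_limit C Bs B F"
    proof (rule uniform_limit_matrix_inverse[OF _ bd])
      show "uniform_limit C As A F" using conv[of 0] C by (simp add: conv_order_0)
      show "\<forall>\<^sub>F i in F. \<forall>y\<in>C. Bs i y ** As i y = mat 1" using invs by eventually_elim (use C in auto)
    qed (use inv C in auto)
  qed
next
  case (Suc n)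
  have U: "open U" using sm by (simp add: smooth_on_def)
  have smB: "smooth_on U B" by (rule smooth_on_matrix_inverse[OF sm(2) inv])
  have smBs: "\<forall>\<^sub>F i in F. smooth_on U (Bs i)"
    using sm(1) invs by eventually_elim (rule smooth_on_matrix_inverse, auto)
  have "conv_order n U F (\<lambda>i. iter_deriv [v] (Bs i)) (iter_deriv [v] B)" for v
  proof -
    have c: "conv_order n U F (\<lambda>i. iter_deriv [v] (As i)) (iter_deriv [v] A)"
      using conv[of "Suc n"] conv_order_Suc by blast
    have s: "smooth_on U (iter_deriv [v] A)" by (rule smooth_on_deriv[OF sm(2)])
    have ss: "\<forall>\<^sub>F i in F. smooth_on U (iter_deriv [v] (As i))"
      using sm(1) by eventually_elim (rule smooth_on_deriv)
    have ss2: "\<forall>\<^sub>F i in F. smooth_on U (\<lambda>x. Bs i x ** iter_deriv [v] (As i) x)"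
      using smBs ss by eventually_elim (rule smooth_on_bilinear[OF bounded_bilinear_mm])
    have ss3: "\<forall>\<^sub>F i in F. smooth_on U (\<lambda>x. Bs i x ** iter_deriv [v] (As i) x ** Bs i x)"
      using ss2 smBs by eventually_elim (rule smooth_on_bilinear[OF bounded_bilinear_mm])
    have s2: "smooth_on U (\<lambda>x. B x ** iter_deriv [v] A x)" by (rule smooth_on_bilinear[OF bounded_bilinear_mm smB s])
    have s3: "smooth_on U (\<lambda>x. B x ** iter_deriv [v] A x ** B x)" by (rule smooth_on_bilinear[OF bounded_bilinear_mm s2 smB])
    have c3: "conv_order n U F (\<lambda>i x. Bs i x ** iter_deriv [v] (As i) x ** Bs i x) (\<lambda>x. B x ** iter_deriv [v] A x ** B x)"
      by (rule conv_order_bilinear[OF bounded_bilinear_mm ss2 smBs s2 smB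
          conv_order_bilinear[OF bounded_bilinear_mm smBs ss smB s Suc.IH c] Suc.IH])
    \<comment> \<open>The minus sign is treated as scaling by the constant function
      \<open>- 1\<close>, so that it becomes one more bilinear product.\<close>
    have cc: "conv_order n U F (\<lambda>i x. - 1) (\<lambda>x::'a. - 1 :: real)"
      by (auto simp: conv_order_def intro: uniform_limit_const)
    have cs: "smooth_on U (\<lambda>x. - 1 :: real)" by (rule smooth_on_const[OF U])
    show ?thesis
    proof (rule conv_order_cong[OF U _ _ conv_order_bilinear[OF bounded_bilinear_scaleR always_eventually ss3 cs s3 cc c3]])
      show "\<forall>i. smooth_on U (\<lambda>x. - 1 :: real)" using cs by simp
      show "\<forall>\<^sub>F i in F. \<forall>y\<in>U. - 1 *\<^sub>R (Bs i y ** iter_deriv [v] (As i) y ** Bs i y) = iter_deriv [v] (Bs i) y"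
        using sm(1) invs
      proof eventually_elim
        case (elim i)
        then show ?case
          using iter_deriv1_matrix_inverse(2)[OF U _ smooth_on_iter[OF elim(1), of _ "[]", simplified], of _ "Bs i" v] by simp
      qed
      show "- 1 *\<^sub>R (B y ** iter_deriv [v] A y ** B y) = iter_deriv [v] B y" if "y \<in> U" for y
        using iter_deriv1_matrix_inverse(2)[OF U that smooth_on_iter[OF sm(2) that, of "[]", simplified] inv, of v] by simp
    qed
  qed
  moreover have "conv_order 0 U F Bs B" using Suc by (rule conv_order_le) simp
  ultimately show ?case unfolding conv_order_Suc by blast
qed

section \<open>Endomorphism fields as a locally convex space\<close>

text \<open>The generating balls have arbitrary centres; the triangle inequality recentres a ball at
  any of its points, and finite intersections lead to finite sets of seminorms. \<open>P\<close> is
  nonempty so that the generating sets cover \<open>X\<close>.\<close>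

lemma openin_generated_seminorms:
  fixes P :: "('v::real_vector \<Rightarrow> real) set"
  assumes X: "subspace X" and ne: "P \<noteq> {}"
    and add: "\<And>p x y. \<lbrakk>p \<in> P; x \<in> X; y \<in> X\<rbrakk> \<Longrightarrow> p (x + y) \<le> p x + p y"
    and zero: "\<And>p. p \<in> P \<Longrightarrow> p 0 = 0"
  defines "\<B> \<equiv> {{y \<in> X. p (y - x) < \<epsilon>} | x p \<epsilon>. x \<in> X \<and> p \<in> P \<and> (\<epsilon>::real) > 0}"
  shows "openin (topology_generated_by \<B>) U \<longleftrightarrow> U \<subseteq> X \<and>
      (\<forall>x\<in>U. \<exists>F \<epsilon>. finite F \<and> F \<subseteq> P \<and> \<epsilon> > 0 \<and> {y \<in> X. \<forall>p\<in>F. p (y - x) < \<epsilon>} \<subseteq> U)"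
    and "topspace (topology_generated_by \<B>) = X"
proof -
  have X0: "0 \<in> X" and Xd: "\<And>x y. \<lbrakk>x \<in> X; y \<in> X\<rbrakk> \<Longrightarrow> x - y \<in> X"
    using X by (auto simp: subspace_0 subspace_diff)
  show top: "topspace (topology_generated_by \<B>) = X"
  proof -
    obtain p where p: "p \<in> P" using ne by blast
    have "x \<in> \<Union>\<B>" if "x \<in> X" for x
    proof
      show "{y \<in> X. p (y - x) < 1} \<in> \<B>"
        unfolding \<B>_def using p that zero_less_one by blast
      show "x \<in> {y \<in> X. p (y - x) < 1}" using that zero[OF p] by simp
    qed
    then show ?thesis unfolding topology_generated_by_topspace by (auto simp: \<B>_def)
  qed
  let ?Q = "\<lambda>U. \<forall>x\<in>U. \<exists>F \<epsilon>. finite F \<and> F \<subseteq> P \<and> \<epsilon> > 0 \<and> {y \<in> X. \<forall>p\<in>F. p (y - x) < \<epsilon>} \<subseteq> U"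
  have 1: "?Q U" if "generate_topology_on \<B> U"
    using that
  proof induction
    case (Int a b)
    show ?case
    proof
      fix x assume x: "x \<in> a \<inter> b"
      obtain F \<epsilon> where F: "finite F" "F \<subseteq> P" "\<epsilon> > 0" "{y \<in> X. \<forall>p\<in>F. p (y - x) < \<epsilon>} \<subseteq> a"
        using Int(3) x by (meson IntD1)
      obtain F' \<epsilon>' where F': "finite F'" "F' \<subseteq> P" "\<epsilon>' > 0" "{y \<in> X. \<forall>p\<in>F'. p (y - x) < \<epsilon>'} \<subseteq> b"
        using Int(4) x by (meson IntD2)
      have "{y \<in> X. \<forall>p\<in>F \<union> F'. p (y - x) < min \<epsilon> \<epsilon>'} \<subseteq> a \<inter> b" using F(4) F'(4) by auto
      then show "\<exists>F \<epsilon>. finite F \<and> F \<subseteq> P \<and> \<epsilon> > 0 \<and> {y \<in> X. \<forall>p\<in>F. p (y - x) < \<epsilon>} \<subseteq> a \<inter> b"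
        using F F' by (intro exI[of _ "F \<union> F'"] exI[of _ "min \<epsilon> \<epsilon>'"]) auto
    qed
  next
    case (UN K)
    show ?case
    proof
      fix x assume "x \<in> \<Union>K"
      then obtain k where k: "k \<in> K" "x \<in> k" by blast
      obtain F \<epsilon> where F: "finite F \<and> F \<subseteq> P \<and> \<epsilon> > 0 \<and> {y \<in> X. \<forall>p\<in>F. p (y - x) < \<epsilon>} \<subseteq> k"
        using bspec[OF UN(2)[OF k(1)] k(2)] by (elim exE)
      then show "\<exists>F \<epsilon>. finite F \<and> F \<subseteq> P \<and> \<epsilon> > 0 \<and> {y \<in> X. \<forall>p\<in>F. p (y - x) < \<epsilon>} \<subseteq> \<Union>K"
        using k by (intro exI[of _ F] exI[of _ \<epsilon>]) auto
    qed
  next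
    case (Basis s)
    then obtain z p \<epsilon> where s: "s = {y \<in> X. p (y - z) < \<epsilon>}" "z \<in> X" "p \<in> P" "\<epsilon> > 0" by (auto simp: \<B>_def)
    show ?case
    proof
      fix x assume x: "x \<in> s"
      have "{y \<in> X. \<forall>q\<in>{p}. q (y - x) < \<epsilon> - p (x - z)} \<subseteq> s"
      proof
        fix y assume y: "y \<in> {y \<in> X. \<forall>q\<in>{p}. q (y - x) < \<epsilon> - p (x - z)}"
        then have "p (y - z) \<le> p (y - x) + p (x - z)"
          using add[OF s(3) Xd[of y x] Xd[of x z]] x s by simp
        then show "y \<in> s" using y s by auto
      qed
      then show "\<exists>F \<epsilon>. finite F \<and> F \<subseteq> P \<and> \<epsilon> > 0 \<and> {y \<in> X. \<forall>p\<in>F. p (y - x) < \<epsilon>} \<subseteq> s"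
        using x s by (intro exI[of _ "{p}"] exI[of _ "\<epsilon> - p (x - z)"]) auto
    qed
  qed simp
  have ball: "openin (topology_generated_by \<B>) {y \<in> X. \<forall>p\<in>F. p (y - x) < \<epsilon>}"
    if "finite F" "F \<subseteq> P" "\<epsilon> > 0" "x \<in> X" for F \<epsilon> x
    using that
  proof (induction rule: finite_induct)
    case empty
    then show ?case using openin_topspace[of "topology_generated_by \<B>"] top by simp
  next
    case (insert p F)
    have "{y \<in> X. p (y - x) < \<epsilon>} \<in> \<B>" unfolding \<B>_def using insert.prems by blast
    then have "openin (topology_generated_by \<B>) {y \<in> X. p (y - x) < \<epsilon>}" by (rule topology_generated_by_Basis)
    moreover have "openin (topology_generated_by \<B>) {y \<in> X. \<forall>p\<in>F. p (y - x) < \<epsilon>}"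
      using insert by blast
    ultimately have "openin (topology_generated_by \<B>) ({y \<in> X. p (y - x) < \<epsilon>} \<inter> {y \<in> X. \<forall>p\<in>F. p (y - x) < \<epsilon>})"
      by (rule openin_Int)
    moreover have "{y \<in> X. p (y - x) < \<epsilon>} \<inter> {y \<in> X. \<forall>p\<in>F. p (y - x) < \<epsilon>} = {y \<in> X. \<forall>p\<in>insert p F. p (y - x) < \<epsilon>}"
      by auto
    ultimately show ?case by simp
  qed
  show "openin (topology_generated_by \<B>) U \<longleftrightarrow> U \<subseteq> X \<and> ?Q U"
  proof
    assume U: "openin (topology_generated_by \<B>) U"
    then show "U \<subseteq> X \<and> ?Q U" using openin_subset[OF U] top 1 by (simp add: openin_topology_generated_by_iff)
  next
    assume U: "U \<subseteq> X \<and> ?Q U"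
    show "openin (topology_generated_by \<B>) U"
    proof (subst openin_subopen, intro ballI)
      fix x assume x: "x \<in> U"
      then obtain F \<epsilon> where F: "finite F" "F \<subseteq> P" "\<epsilon> > 0" "{y \<in> X. \<forall>p\<in>F. p (y - x) < \<epsilon>} \<subseteq> U"
        using U by meson
      have z: "p (x - x) < \<epsilon>" if "p \<in> F" for p
        using zero[OF subsetD[OF F(2) that]] F(3) by simp
      show "\<exists>W. openin (topology_generated_by \<B>) W \<and> x \<in> W \<and> W \<subseteq> U"
      proof (intro exI conjI)
        show "openin (topology_generated_by \<B>) {y \<in> X. \<forall>p\<in>F. p (y - x) < \<epsilon>}" using F x U by (intro ball) auto
        show "x \<in> {y \<in> X. \<forall>p\<in>F. p (y - x) < \<epsilon>}"
          using z x U by blast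
      qed (rule F(4))
    qed
  qed
qed

section \<open>Tangent vectors and endomorphism fields in chart components\<close>

locale closed_manifold =
  fixes \<M> :: "('m::t2_space, 'd::finite) chart set"
  assumes mfd: "closed_oriented_manifold \<M>"
begin

abbreviation dom :: "('m, 'd) chart \<Rightarrow> 'm set" where "dom c \<equiv> fst c"
abbreviation img :: "('m, 'd) chart \<Rightarrow> (real ^ 'd) set" where "img c \<equiv> snd c ` fst c"
abbreviation TM where "TM \<equiv> tangent_space \<M>"
abbreviation lm where "lm \<equiv> local_matrix \<M>"

lemma compact_M: "compact (UNIV :: 'm set)"
  and ex_chart: "\<exists>c\<in>\<M>. p \<in> dom c"
  using mfd by (auto simp: closed_oriented_manifold_def)

lemma chart_props:
  assumes "c \<in> \<M>"
  shows "open (dom c)" "open (img c)" "homeomorphism (dom c) (img c) (snd c) (chart_inv c)"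
  using mfd assms by (auto simp: closed_oriented_manifold_def)

lemma chart_inv_chart: "\<lbrakk>c \<in> \<M>; p \<in> dom c\<rbrakk> \<Longrightarrow> chart_inv c (snd c p) = p"
  using chart_props(3) by (auto simp: homeomorphism_def)

definition jac where "jac c d p = frechet_derivative (transition c d) (at (snd c p))"

lemma transition_deriv:
  assumes "c \<in> \<M>" "d \<in> \<M>" "p \<in> dom c" "p \<in> dom d"
  shows "(transition c d has_derivative jac c d p) (at (snd c p))"
proof -
  have "smooth_on (snd c ` (fst c \<inter> fst d)) (transition c d)"
    using mfd assms by (simp add: closed_oriented_manifold_def)
  then have "transition c d differentiable (at (snd c p))"
    using smooth_on_iter[of _ "transition c d" "snd c p" "[]"] assms by simp
  then show ?thesis unfolding jac_def frechet_derivative_works by simp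
qed

lemma open_overlap: "\<lbrakk>c \<in> \<M>; d \<in> \<M>\<rbrakk> \<Longrightarrow> open (snd c ` (dom c \<inter> dom d))"
  using mfd by (simp add: closed_oriented_manifold_def smooth_on_def)

lemma jac_linear: "\<lbrakk>c \<in> \<M>; d \<in> \<M>; p \<in> dom c; p \<in> dom d\<rbrakk> \<Longrightarrow> linear (jac c d p)"
  using transition_deriv has_derivative_linear by blast

lemma transition_chart: "\<lbrakk>c \<in> \<M>; p \<in> dom c\<rbrakk> \<Longrightarrow> transition c d (snd c p) = snd d p"
  by (simp add: transition_def chart_inv_chart)

lemma jac_self:
  assumes c: "c \<in> \<M>" "p \<in> dom c"
  shows "jac c c p w = w"
proof -
  have "transition c c y = y" if "y \<in> img c" for y
    using that transition_chart[OF c(1)] by (metis imageE)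
  then have "((\<lambda>y. y) has_derivative jac c c p) (at (snd c p))"
    using has_derivative_transform_within_open[OF transition_deriv[OF c(1,1) c(2,2)] chart_props(2)[OF c(1)], of "\<lambda>y. y"]
      c(2) by blast
  from has_derivative_unique[OF this has_derivative_ident] show ?thesis by simp
qed

lemma jac_cocycle:
  assumes c: "c \<in> \<M>" "d \<in> \<M>" "e \<in> \<M>" and p: "p \<in> dom c" "p \<in> dom d" "p \<in> dom e"
  shows "jac d e p (jac c d p w) = jac c e p w"
proof -
  have "(transition d e has_derivative jac d e p) (at (transition c d (snd c p)))"
    using transition_deriv[OF c(2,3) p(2,3)] by (simp add: transition_chart c p)
  from has_derivative_compose[OF transition_deriv[OF c(1,2) p(1,2)] this]
  have "((\<lambda>y. transition d e (transition c d y)) has_derivative (\<lambda>w. jac d e p (jac c d p w))) (at (snd c p))" .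
  moreover have "transition d e (transition c d y) = transition c e y" if y: "y \<in> snd c ` (dom c \<inter> dom d)" for y
  proof -
    obtain q where q: "q \<in> dom c" "q \<in> dom d" "y = snd c q" using y by blast
    then show ?thesis using c by (simp add: transition_chart)
  qed
  ultimately have "(transition c e has_derivative (\<lambda>w. jac d e p (jac c d p w))) (at (snd c p))"
    using has_derivative_transform_within_open[OF _ open_overlap[OF c(1,2)]] p by blast
  from has_derivative_unique[OF this transition_deriv[OF c(1,3) p(1,3)]] show ?thesis by metis
qed

lemma tangent_space_iff:
  "v \<in> TM p \<longleftrightarrow> (\<forall>c\<in>\<M>. \<forall>d\<in>\<M>. p \<in> dom c \<and> p \<in> dom d \<longrightarrow> v d = jac c d p (v c)) \<and>
    (\<forall>c. \<not> (c \<in> \<M> \<and> p \<in> dom c) \<longrightarrow> v c = 0)"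
  by (simp add: tangent_space_def jac_def)

lemma tvec_of_eq: "tvec_of \<M> c p w = (\<lambda>d. if d \<in> \<M> \<and> p \<in> dom d then jac c d p w else 0)"
  unfolding tvec_of_def jac_def ..

lemma tvec_of_mem: "\<lbrakk>c \<in> \<M>; p \<in> dom c\<rbrakk> \<Longrightarrow> tvec_of \<M> c p w \<in> TM p"
  unfolding tangent_space_iff tvec_of_eq by (simp add: jac_cocycle)

lemma tvec_of_self: "\<lbrakk>c \<in> \<M>; p \<in> dom c\<rbrakk> \<Longrightarrow> tvec_of \<M> c p w c = w"
  by (simp add: tvec_of_eq jac_self)

text \<open>Together with \<open>tvec_of_self\<close> this identifies \<open>TM p\<close> with the
  coordinate space through the component in a single chart, so that fields can be compared and
  computed as matrices.\<close>

lemma tvec_of_component: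
  assumes "c \<in> \<M>" "p \<in> dom c" "v \<in> TM p"
  shows "tvec_of \<M> c p (v c) = v"
proof
  fix d
  show "tvec_of \<M> c p (v c) d = v d"
  proof (cases "d \<in> \<M> \<and> p \<in> dom d")
    case True
    then have "v d = jac c d p (v c)" using assms unfolding tangent_space_iff by blast
    then show ?thesis using True by (simp add: tvec_of_eq)
  next
    case False
    then have "v d = 0" using assms(3) unfolding tangent_space_iff by blast
    then show ?thesis by (simp only: tvec_of_eq False if_False)
  qed
qed

lemma tvec_of_linear:
  "\<lbrakk>c \<in> \<M>; p \<in> dom c\<rbrakk> \<Longrightarrow> tvec_of \<M> c p (a *\<^sub>R w + b *\<^sub>R u) = a *\<^sub>R tvec_of \<M> c p w + b *\<^sub>R tvec_of \<M> c p u"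
  by (simp add: tvec_of_eq fun_eq_iff scaleR_fun_def linear_add linear_scale jac_linear)

lemma TM_jac: "\<lbrakk>v \<in> TM p; c \<in> \<M>; d \<in> \<M>; p \<in> dom c; p \<in> dom d\<rbrakk> \<Longrightarrow> v d = jac c d p (v c)"
  and TM_out: "\<lbrakk>v \<in> TM p; \<not> (c \<in> \<M> \<and> p \<in> dom c)\<rbrakk> \<Longrightarrow> v c = 0"
  unfolding tangent_space_iff by blast+

lemma subspace_TM: "subspace (TM p)"
proof (rule subspaceI)
  show "0 \<in> TM p" by (simp add: tangent_space_iff linear_0 jac_linear)
  show "x + y \<in> TM p" if x: "x \<in> TM p" and y: "y \<in> TM p" for x y
    unfolding tangent_space_iff plus_fun_apply
  proof (intro conjI ballI allI impI)
    fix c d assume c: "c \<in> \<M>" "d \<in> \<M>" "p \<in> dom c \<and> p \<in> dom d"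
    show "x d + y d = jac c d p (x c + y c)"
      unfolding linear_add[OF jac_linear[OF c(1,2) conjunct1[OF c(3)] conjunct2[OF c(3)]]]
      using TM_jac[OF x c(1,2)] TM_jac[OF y c(1,2)] c(3) by metis
  next
    fix c assume "\<not> (c \<in> \<M> \<and> p \<in> dom c)"
    from TM_out[OF x this] TM_out[OF y this] show "x c + y c = 0" by simp
  qed
  show "r *\<^sub>R x \<in> TM p" if x: "x \<in> TM p" for r x
    unfolding tangent_space_iff scaleR_fun_def
  proof (intro conjI ballI allI impI)
    fix c d assume c: "c \<in> \<M>" "d \<in> \<M>" "p \<in> dom c \<and> p \<in> dom d"
    show "r *\<^sub>R x d = jac c d p (r *\<^sub>R x c)"
      unfolding linear_scale[OF jac_linear[OF c(1,2) conjunct1[OF c(3)] conjunct2[OF c(3)]]]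
      using TM_jac[OF x c(1,2)] c(3) by metis
  next
    fix c assume "\<not> (c \<in> \<M> \<and> p \<in> dom c)"
    from TM_out[OF x this] show "r *\<^sub>R x c = 0" by simp
  qed
qed

lemma TM_eqI: "\<lbrakk>c \<in> \<M>; p \<in> dom c; v \<in> TM p; w \<in> TM p; v c = w c\<rbrakk> \<Longrightarrow> v = w"
  using tvec_of_component by metis

text \<open>The pointwise algebraic half of \<open>smooth_fields\<close>. The rules for local
  matrices depend on this half only, and they are what proves smoothness of sums, compositions and
  inverses.\<close>

definition endo :: "('m, 'd) field \<Rightarrow> bool" where
  "endo K \<longleftrightarrow> (\<forall>p. K p ` TM p \<subseteq> TM p \<and>
      (\<forall>v\<in>TM p. \<forall>w\<in>TM p. \<forall>a b. K p (a *\<^sub>R v + b *\<^sub>R w) = a *\<^sub>R K p v + b *\<^sub>R K p w) \<and>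
      (\<forall>v. v \<notin> TM p \<longrightarrow> K p v = 0))"

abbreviation SF where "SF \<equiv> smooth_fields \<M>"

lemma SF_iff: "K \<in> SF \<longleftrightarrow> endo K \<and> (\<forall>c\<in>\<M>. smooth_on (img c) (lm c K))"
  by (simp add: smooth_fields_def endo_def)

lemma endo_linear:
  "\<lbrakk>endo K; v \<in> TM p; w \<in> TM p\<rbrakk> \<Longrightarrow> K p (a *\<^sub>R v + b *\<^sub>R w) = a *\<^sub>R K p v + b *\<^sub>R K p w"
  by (simp add: endo_def)

lemma endo_out: "\<lbrakk>endo K; v \<notin> TM p\<rbrakk> \<Longrightarrow> K p v = 0" by (simp add: endo_def)

lemma endo_mem:
  assumes "endo K"
  shows "K p v \<in> TM p"
proof (cases "v \<in> TM p")
  case True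
  then show ?thesis using assms unfolding endo_def by blast
next
  case False
  then show ?thesis using endo_out[OF assms] subspace_0[OF subspace_TM] by simp
qed

lemma endoI:
  assumes "\<And>p v. v \<in> TM p \<Longrightarrow> K p v \<in> TM p"
    and "\<And>p v w a b. \<lbrakk>v \<in> TM p; w \<in> TM p\<rbrakk> \<Longrightarrow> K p (a *\<^sub>R v + b *\<^sub>R w) = a *\<^sub>R K p v + b *\<^sub>R K p w"
    and "\<And>p v. v \<notin> TM p \<Longrightarrow> K p v = 0"
  shows "endo K"
  unfolding endo_def using assms by (simp add: image_subset_iff)

lemma endo_zero: "endo K \<Longrightarrow> K p 0 = 0"
  using endo_linear[of K 0 p 0 0 0] subspace_0[OF subspace_TM] by simp

lemma endo_add: "\<lbrakk>endo K; v \<in> TM p; w \<in> TM p\<rbrakk> \<Longrightarrow> K p (v + w) = K p v + K p w"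
  using endo_linear[of K v p w 1 1] by simp

lemma endo_scale: "\<lbrakk>endo K; v \<in> TM p\<rbrakk> \<Longrightarrow> K p (a *\<^sub>R v) = a *\<^sub>R K p v"
  using endo_linear[of K v p v a 0] by simp

text \<open>\<open>matrix\<close> represents a function only if it is linear; linearity combines
  that of \<open>tvec_of\<close> with that of the field on the tangent space.\<close>

lemma local_matrix_works:
  assumes K: "endo K" and c: "c \<in> \<M>" "p \<in> dom c"
  shows "lm c K (snd c p) *v w = K p (tvec_of \<M> c p w) c"
proof -
  have "linear (\<lambda>w. K p (tvec_of \<M> c p w) c)"
  proof (rule linearI)
    fix x y :: "real^'d" and r :: real
    show "K p (tvec_of \<M> c p (x + y)) c = K p (tvec_of \<M> c p x) c + K p (tvec_of \<M> c p y) c"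
      using tvec_of_linear[OF c, of 1 x 1 y] endo_add[OF K tvec_of_mem[OF c] tvec_of_mem[OF c]] by simp
    show "K p (tvec_of \<M> c p (r *\<^sub>R x)) c = r *\<^sub>R K p (tvec_of \<M> c p x) c"
    proof -
      have "tvec_of \<M> c p (r *\<^sub>R x) = r *\<^sub>R tvec_of \<M> c p x"
        using tvec_of_linear[OF c, of r x 0 x] by simp
      then have "K p (tvec_of \<M> c p (r *\<^sub>R x)) = r *\<^sub>R K p (tvec_of \<M> c p x)"
        using endo_scale[OF K tvec_of_mem[OF c]] by metis
      then show ?thesis by (simp only: scaleR_fun_def)
    qed
  qed
  then show ?thesis by (simp add: local_matrix_def chart_inv_chart[OF c] matrix_works)
qed

lemma endo_component:
  assumes "endo K" "c \<in> \<M>" "p \<in> dom c" "v \<in> TM p"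
  shows "K p v c = lm c K (snd c p) *v v c"
  using local_matrix_works[OF assms(1-3), of "v c"] tvec_of_component[OF assms(2-4)] by simp

lemma local_matrix_eqI:
  assumes c: "c \<in> \<M>" "p \<in> dom c" and K: "endo K" and A: "\<And>v. v \<in> TM p \<Longrightarrow> K p v c = A *v v c"
  shows "lm c K (snd c p) = A"
  unfolding matrix_eq using local_matrix_works[OF K c] A[OF tvec_of_mem[OF c]] tvec_of_self[OF c] by simp

lemma endo_plus:
  assumes "endo K" "endo L"
  shows "endo (K + L)"
proof (rule endoI)
  have pl: "(K + L) p v = K p v + L p v" for p v by (simp only: plus_fun_apply)
  fix p v w and a b :: real assume v: "v \<in> TM p" and w: "w \<in> TM p"
  show "(K + L) p v \<in> TM p"
    unfolding pl by (rule subspace_add[OF subspace_TM endo_mem[OF assms(1)] endo_mem[OF assms(2)]])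
  show "(K + L) p (a *\<^sub>R v + b *\<^sub>R w) = a *\<^sub>R (K + L) p v + b *\<^sub>R (K + L) p w"
    unfolding pl endo_linear[OF assms(1) v w] endo_linear[OF assms(2) v w] by (simp add: algebra_simps)
next
  fix p v assume v: "v \<notin> TM p"
  show "(K + L) p v = 0"
    by (simp only: plus_fun_apply endo_out[OF assms(1) v] endo_out[OF assms(2) v] add_0)
qed

lemma endo_scaleR:
  assumes "endo K"
  shows "endo (r *\<^sub>R K)"
proof (rule endoI)
  have r: "(r *\<^sub>R K) p v = r *\<^sub>R K p v" for p v by (simp only: scaleR_fun_def)
  fix p v w and a b :: real assume v: "v \<in> TM p" and w: "w \<in> TM p"
  show "(r *\<^sub>R K) p v \<in> TM p"
    unfolding r by (rule subspace_scale[OF subspace_TM endo_mem[OF assms]])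
  show "(r *\<^sub>R K) p (a *\<^sub>R v + b *\<^sub>R w) = a *\<^sub>R (r *\<^sub>R K) p v + b *\<^sub>R (r *\<^sub>R K) p w"
    unfolding r endo_linear[OF assms v w] by (simp add: algebra_simps)
next
  fix p v assume v: "v \<notin> TM p"
  show "(r *\<^sub>R K) p v = 0"
    by (simp only: scaleR_fun_def[of r K] scaleR_fun_def[of r "K p"] endo_out[OF assms v] scaleR_zero_right)
qed

lemma endo_comp:
  assumes "endo K" "endo L"
  shows "endo (K \<odot> L)"
proof (rule endoI)
  fix p v w and a b :: real assume v: "v \<in> TM p" and w: "w \<in> TM p"
  show "(K \<odot> L) p v \<in> TM p" by (simp add: field_comp_def endo_mem assms)
  show "(K \<odot> L) p (a *\<^sub>R v + b *\<^sub>R w) = a *\<^sub>R (K \<odot> L) p v + b *\<^sub>R (K \<odot> L) p w"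
    by (simp add: field_comp_def endo_linear[OF assms(2) v w] endo_linear[OF assms(1) endo_mem[OF assms(2)] endo_mem[OF assms(2)]])
next
  fix p v assume v: "v \<notin> TM p"
  show "(K \<odot> L) p v = 0"
    by (simp only: field_comp_def o_apply endo_out[OF assms(2) v] endo_zero[OF assms(1)])
qed

lemma endo_id: "endo (id_field \<M>)"
proof (rule endoI)
  fix p v w and a b :: real assume v: "v \<in> TM p" and w: "w \<in> TM p"
  then show "id_field \<M> p v \<in> TM p" by (simp add: id_field_def)
  have "a *\<^sub>R v + b *\<^sub>R w \<in> TM p"
    by (intro subspace_add[OF subspace_TM] subspace_scale[OF subspace_TM] v w)
  then show "id_field \<M> p (a *\<^sub>R v + b *\<^sub>R w) = a *\<^sub>R id_field \<M> p v + b *\<^sub>R id_field \<M> p w"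
    using v w by (simp add: id_field_def)
qed (simp add: id_field_def)

lemma lm_plus:
  assumes "c \<in> \<M>" "y \<in> img c" "endo K" "endo L"
  shows "lm c (K + L) y = lm c K y + lm c L y"
proof -
  obtain p where p: "p \<in> dom c" "y = snd c p" using assms(2) by blast
  show ?thesis unfolding p(2)
    by (rule local_matrix_eqI[OF assms(1) p(1) endo_plus[OF assms(3,4)]])
      (simp add: endo_component[OF _ assms(1) p(1)] assms matrix_vector_mult_add_rdistrib)
qed

lemma lm_scaleR:
  assumes "c \<in> \<M>" "y \<in> img c" "endo K"
  shows "lm c (r *\<^sub>R K) y = r *\<^sub>R lm c K y"
proof -
  obtain p where p: "p \<in> dom c" "y = snd c p" using assms(2) by blast
  show ?thesis unfolding p(2)
    by (rule local_matrix_eqI[OF assms(1) p(1) endo_scaleR[OF assms(3)]])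
      (simp add: endo_component[OF _ assms(1) p(1)] assms scaleR_fun_def scaleR_matrix_vector_assoc)
qed

lemma lm_comp:
  assumes "c \<in> \<M>" "y \<in> img c" "endo K" "endo L"
  shows "lm c (K \<odot> L) y = lm c K y ** lm c L y"
proof -
  obtain p where p: "p \<in> dom c" "y = snd c p" using assms(2) by blast
  show ?thesis unfolding p(2)
    by (rule local_matrix_eqI[OF assms(1) p(1) endo_comp[OF assms(3,4)]])
      (simp add: field_comp_def endo_component[OF _ assms(1) p(1)] endo_mem assms matrix_vector_mul_assoc)
qed

lemma lm_id:
  assumes "c \<in> \<M>" "y \<in> img c"
  shows "lm c (id_field \<M>) y = mat 1"
proof -
  obtain p where p: "p \<in> dom c" "y = snd c p" using assms(2) by blast
  show ?thesis unfolding p(2)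
    by (rule local_matrix_eqI[OF assms(1) p(1) endo_id]) (simp add: id_field_def)
qed

lemma SF_plus: "\<lbrakk>K \<in> SF; L \<in> SF\<rbrakk> \<Longrightarrow> K + L \<in> SF"
  unfolding SF_iff by (auto simp: endo_plus smooth_on_cong[OF lm_plus] intro: smooth_on_add)

lemma SF_scaleR: "K \<in> SF \<Longrightarrow> r *\<^sub>R K \<in> SF"
  unfolding SF_iff by (auto simp: endo_scaleR smooth_on_cong[OF lm_scaleR] intro: smooth_on_scaleR)

lemma SF_comp: "\<lbrakk>K \<in> SF; L \<in> SF\<rbrakk> \<Longrightarrow> K \<odot> L \<in> SF"
  unfolding SF_iff by (auto simp: endo_comp smooth_on_cong[OF lm_comp] intro: smooth_on_bilinear[OF bounded_bilinear_mm])

lemma SF_id: "id_field \<M> \<in> SF"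
  unfolding SF_iff
proof (intro conjI endo_id ballI)
  fix c assume c: "c \<in> \<M>"
  show "smooth_on (img c) (lm c (id_field \<M>))"
    by (rule smooth_on_cong[THEN iffD2, OF lm_id[OF c] smooth_on_const[OF chart_props(2)[OF c]]])
qed

lemma subspace_SF: "subspace SF"
proof (rule subspaceI)
  show "0 \<in> SF" using SF_scaleR[OF SF_id, of 0] by simp
qed (auto intro: SF_plus SF_scaleR)

lemma SF_endo: "K \<in> SF \<Longrightarrow> endo K" by (simp add: SF_iff)

lemma SF_smooth: "\<lbrakk>K \<in> SF; c \<in> \<M>\<rbrakk> \<Longrightarrow> smooth_on (img c) (lm c K)" by (simp add: SF_iff)

lemma lm_diff:
  assumes "c \<in> \<M>" "y \<in> img c" "K \<in> SF" "L \<in> SF"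
  shows "lm c (K - L) y = lm c K y - lm c L y"
  using lm_plus[OF assms(1,2) SF_endo[OF assms(3)] SF_endo[OF SF_scaleR[OF assms(4), of "-1"]]]
    lm_scaleR[OF assms(1,2) SF_endo[OF assms(4)], of "-1"] by simp

text \<open>The inserted \<open>0\<close> keeps the supremum over a nonempty set, with value
  \<open>0\<close> for empty \<open>C\<close>.\<close>

definition sn where "sn c C vs K = Sup (insert 0 ((\<lambda>y. norm (iter_deriv vs (lm c K) y)) ` C))"

definition seminorms where
  "seminorms = {sn c C vs | c C vs. c \<in> \<M> \<and> compact C \<and> C \<subseteq> img c}"

context
  fixes c C and vs :: "(real ^ 'd) list"
  assumes c: "c \<in> \<M>" and C: "compact C" "C \<subseteq> img c"
begin

text \<open>Compactness of \<open>C\<close> and continuity of the derivatives make the supremum a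
  maximum. Hence a strict bound at every point is a strict bound for \<open>sn\<close>, which
  matches the strict inequalities in \<open>Cinf_topology\<close>.\<close>

lemma sn_attained:
  assumes K: "K \<in> SF"
  shows "sn c C vs K \<in> insert 0 ((\<lambda>y. norm (iter_deriv vs (lm c K) y)) ` C)"
    and "\<And>y. y \<in> C \<Longrightarrow> norm (iter_deriv vs (lm c K) y) \<le> sn c C vs K" and "0 \<le> sn c C vs K"
proof -
  have "continuous_on C (iter_deriv vs (lm c K))"
    using smooth_on_continuous[OF SF_smooth[OF K c]] C(2) continuous_on_subset by blast
  then have "compact ((\<lambda>y. norm (iter_deriv vs (lm c K) y)) ` C)"
    using C(1) by (intro compact_continuous_image continuous_on_norm)
  then have cp: "compact (insert 0 ((\<lambda>y. norm (iter_deriv vs (lm c K) y)) ` C))" by simp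
  have bdd: "bdd_above (insert 0 ((\<lambda>y. norm (iter_deriv vs (lm c K) y)) ` C))"
    by (rule bounded_imp_bdd_above[OF compact_imp_bounded[OF cp]])
  show "sn c C vs K \<in> insert 0 ((\<lambda>y. norm (iter_deriv vs (lm c K) y)) ` C)"
    unfolding sn_def by (rule closed_contains_Sup[OF _ bdd compact_imp_closed[OF cp]]) simp
  show "\<And>y. y \<in> C \<Longrightarrow> norm (iter_deriv vs (lm c K) y) \<le> sn c C vs K"
    unfolding sn_def by (rule cSup_upper[OF _ bdd]) auto
  show "0 \<le> sn c C vs K" unfolding sn_def by (rule cSup_upper[OF _ bdd]) auto
qed

lemma sn_less_iff: "\<lbrakk>K \<in> SF; \<epsilon> > 0\<rbrakk> \<Longrightarrow> sn c C vs K < \<epsilon> \<longleftrightarrow> (\<forall>y\<in>C. norm (iter_deriv vs (lm c K) y) < \<epsilon>)"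
  using sn_attained[of K] by fastforce

lemma sn_leI: "\<lbrakk>K \<in> SF; \<And>y. y \<in> C \<Longrightarrow> norm (iter_deriv vs (lm c K) y) \<le> r; 0 \<le> r\<rbrakk> \<Longrightarrow> sn c C vs K \<le> r"
  using sn_attained(1)[of K] by auto

lemma iter_lm_plus:
  assumes "K \<in> SF" "L \<in> SF" "y \<in> C"
  shows "iter_deriv vs (lm c (K + L)) y = iter_deriv vs (lm c K) y + iter_deriv vs (lm c L) y"
proof -
  have y: "y \<in> img c" using assms C by blast
  have "iter_deriv vs (lm c (K + L)) y = iter_deriv vs (\<lambda>y. lm c K y + lm c L y) y"
    by (rule iter_deriv_cong_open[OF chart_props(2)[OF c] y lm_plus[OF c]]) (use assms SF_endo in auto)
  then show ?thesis using iter_deriv_add[OF SF_smooth[OF assms(1) c] SF_smooth[OF assms(2) c] y] by simp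
qed

lemma iter_lm_scaleR:
  assumes "K \<in> SF" "y \<in> C"
  shows "iter_deriv vs (lm c (r *\<^sub>R K)) y = r *\<^sub>R iter_deriv vs (lm c K) y"
proof -
  have y: "y \<in> img c" using assms C by blast
  have "iter_deriv vs (lm c (r *\<^sub>R K)) y = iter_deriv vs (\<lambda>y. r *\<^sub>R lm c K y) y"
    by (rule iter_deriv_cong_open[OF chart_props(2)[OF c] y lm_scaleR[OF c]]) (use assms SF_endo in auto)
  then show ?thesis using iter_deriv_scaleR[OF SF_smooth[OF assms(1) c] y] by simp
qed

lemma iter_lm_diff:
  "\<lbrakk>K \<in> SF; L \<in> SF; y \<in> C\<rbrakk> \<Longrightarrow> iter_deriv vs (lm c (K - L)) y = iter_deriv vs (lm c K) y - iter_deriv vs (lm c L) y"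
  using iter_lm_plus[OF _ SF_scaleR, of K L y "-1"] iter_lm_scaleR[of L y "-1"] by simp

lemma sn_triangle: "\<lbrakk>K \<in> SF; L \<in> SF\<rbrakk> \<Longrightarrow> sn c C vs (K + L) \<le> sn c C vs K + sn c C vs L"
proof (rule sn_leI)
  assume K: "K \<in> SF" and L: "L \<in> SF"
  show "K + L \<in> SF" by (rule SF_plus[OF K L])
  show "0 \<le> sn c C vs K + sn c C vs L" using sn_attained(3) K L by (intro add_nonneg_nonneg)
  show "norm (iter_deriv vs (lm c (K + L)) y) \<le> sn c C vs K + sn c C vs L" if y: "y \<in> C" for y
    unfolding iter_lm_plus[OF K L y]
    using sn_attained(2)[OF K y] sn_attained(2)[OF L y] by (intro norm_triangle_le) simp
qed

lemma sn_homogeneous: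
  assumes K: "K \<in> SF"
  shows "sn c C vs (r *\<^sub>R K) = \<bar>r\<bar> * sn c C vs K"
proof (rule antisym)
  show le: "sn c C vs (r *\<^sub>R K) \<le> \<bar>r\<bar> * sn c C vs K"
    using sn_attained(2,3)[OF K]
    by (intro sn_leI SF_scaleR K) (auto simp: iter_lm_scaleR[OF K] intro: mult_left_mono)
  show "\<bar>r\<bar> * sn c C vs K \<le> sn c C vs (r *\<^sub>R K)"
    using sn_attained(1)[OF K] sn_attained(2,3)[OF SF_scaleR[OF K, of r]]
    by (auto simp: iter_lm_scaleR[OF K])
qed

end

lemma Cinf_topology_eq:
  "Cinf_topology \<M> = topology_generated_by {{L \<in> SF. p (L - K) < \<epsilon>} | K p \<epsilon>. K \<in> SF \<and> p \<in> seminorms \<and> \<epsilon> > 0}"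
proof -
  have eq: "{L \<in> SF. \<forall>y\<in>C. norm (iter_deriv vs (lm c (L - K)) y) < \<epsilon>} = {L \<in> SF. sn c C vs (L - K) < \<epsilon>}"
    if "K \<in> SF" "c \<in> \<M>" "compact C" "C \<subseteq> img c" "\<epsilon> > 0" for K c C vs \<epsilon>
    using sn_less_iff[OF that(2-4) subspace_diff[OF subspace_SF _ that(1)] that(5)] by blast
  have "{{L \<in> SF. \<forall>y\<in>C. norm (iter_deriv vs (lm c (L - K)) y) < \<epsilon>}
     | K c C vs \<epsilon>. K \<in> SF \<and> c \<in> \<M> \<and> compact C \<and> C \<subseteq> img c \<and> (\<epsilon>::real) > 0} =
    {{L \<in> SF. p (L - K) < \<epsilon>} | K p \<epsilon>. K \<in> SF \<and> p \<in> seminorms \<and> \<epsilon> > 0}" (is "?A = ?B")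
  proof (intro equalityI subsetI)
    fix s assume "s \<in> ?A"
    then obtain K c C vs \<epsilon> where s: "s = {L \<in> SF. \<forall>y\<in>C. norm (iter_deriv vs (lm c (L - K)) y) < \<epsilon>}"
      "K \<in> SF" "c \<in> \<M>" "compact C" "C \<subseteq> img c" "\<epsilon> > 0" by blast
    then show "s \<in> ?B" unfolding s(1) eq[OF s(2-6)] seminorms_def by blast
  next
    fix s assume "s \<in> ?B"
    then obtain K c C vs \<epsilon> where s: "s = {L \<in> SF. sn c C vs (L - K) < \<epsilon>}"
      "K \<in> SF" "c \<in> \<M>" "compact C" "C \<subseteq> img c" "\<epsilon> > 0" unfolding seminorms_def by blast
    then show "s \<in> ?A" unfolding s(1) eq[OF s(2-6), symmetric] by blast
  qed
  then show ?thesis by (simp add: Cinf_topology_def)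
qed

lemma seminorms_ne: "seminorms \<noteq> {}"
proof -
  obtain c where "c \<in> \<M>" using ex_chart by blast
  then have "sn c {} [] \<in> seminorms"
    unfolding seminorms_def by (intro CollectI exI[of _ c] exI[of _ "{}"] exI[of _ "[]"]) simp
  then show ?thesis by blast
qed

lemma Cinf_openin:
  shows "openin (Cinf_topology \<M>) U \<longleftrightarrow> U \<subseteq> SF \<and>
      (\<forall>x\<in>U. \<exists>F \<epsilon>. finite F \<and> F \<subseteq> seminorms \<and> \<epsilon> > 0 \<and> {y \<in> SF. \<forall>p\<in>F. p (y - x) < \<epsilon>} \<subseteq> U)"
    and Cinf_topspace: "topspace (Cinf_topology \<M>) = SF"
proof -
  have add: "p (x + y) \<le> p x + p y" if "p \<in> seminorms" "x \<in> SF" "y \<in> SF" for p x y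
    using that sn_triangle unfolding seminorms_def by blast
  have zero: "p 0 = 0" if "p \<in> seminorms" for p
    using that sn_homogeneous[OF _ _ _ SF_id, of _ _ _ 0] unfolding seminorms_def by auto
  show "openin (Cinf_topology \<M>) U \<longleftrightarrow> U \<subseteq> SF \<and>
      (\<forall>x\<in>U. \<exists>F \<epsilon>. finite F \<and> F \<subseteq> seminorms \<and> \<epsilon> > 0 \<and> {y \<in> SF. \<forall>p\<in>F. p (y - x) < \<epsilon>} \<subseteq> U)"
    unfolding Cinf_topology_eq by (rule openin_generated_seminorms(1)[OF subspace_SF seminorms_ne]; (rule add | rule zero); assumption)
  show "topspace (Cinf_topology \<M>) = SF"
    unfolding Cinf_topology_eq by (rule openin_generated_seminorms(2)[OF subspace_SF seminorms_ne]; (rule add | rule zero); assumption)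
qed

lemma field_eqI:
  assumes K: "K \<in> SF" and L: "L \<in> SF" and eq: "\<And>c p. \<lbrakk>c \<in> \<M>; p \<in> dom c\<rbrakk> \<Longrightarrow> lm c K (snd c p) = lm c L (snd c p)"
  shows "K = L"
proof (intro ext)
  fix p v d
  obtain c where c: "c \<in> \<M>" "p \<in> dom c" using ex_chart by blast
  have "K p v = L p v"
  proof (cases "v \<in> TM p")
    case True
    show ?thesis
      by (rule TM_eqI[OF c endo_mem[OF SF_endo[OF K]] endo_mem[OF SF_endo[OF L]]])
        (simp add: endo_component[OF SF_endo[OF K] c True] endo_component[OF SF_endo[OF L] c True] eq[OF c])
  qed (simp add: endo_out SF_endo K L)
  then show "K p v d = L p v d" by simp
qed

end

sublocale closed_manifold \<subseteq> Cinf: seminormed_space "Cinf_topology \<M>" seminorms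
proof (rule seminormed_space.intro, unfold Cinf_topspace)
  show "subspace SF" by (rule subspace_SF)
  show "p (x + y) \<le> p x + p y" if "p \<in> seminorms" "x \<in> SF" "y \<in> SF" for p x y
    using that sn_triangle unfolding seminorms_def by blast
  show "p (a *\<^sub>R x) = \<bar>a\<bar> * p x" if "p \<in> seminorms" "x \<in> SF" for p x a
    using that sn_homogeneous unfolding seminorms_def by blast
  show "openin (Cinf_topology \<M>) U \<longleftrightarrow> U \<subseteq> SF \<and>
      (\<forall>x\<in>U. \<exists>F \<epsilon>. finite F \<and> F \<subseteq> seminorms \<and> \<epsilon> > 0 \<and> {y \<in> SF. \<forall>p\<in>F. p (y - x) < \<epsilon>} \<subseteq> U)" for U
    by (rule Cinf_openin)
  fix x assume x: "x \<in> SF" and p: "\<And>p. p \<in> seminorms \<Longrightarrow> p x = 0"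
  have 0: "0 \<in> SF" by (rule subspace_0[OF subspace_SF])
  show "x = 0"
  proof (rule field_eqI[OF x 0])
    fix c q assume c: "c \<in> \<M>" "q \<in> dom c"
    \<comment> \<open>Seminorms of order zero on single points already separate fields.\<close>
    have C: "compact {snd c q}" "{snd c q} \<subseteq> img c" using c by auto
    have "sn c {snd c q} [] x = 0" using p C c unfolding seminorms_def by blast
    then have "lm c x (snd c q) = 0"
      using sn_attained(2)[OF c(1) C x, of "snd c q" "[]"] by simp
    moreover have "lm c 0 (snd c q) = 0" using lm_scaleR[OF c(1) _ endo_id, of "snd c q" 0] c by simp
    ultimately show "lm c x (snd c q) = lm c 0 (snd c q)" by simp
  qed
qed

section \<open>Inversion of endomorphism fields\<close>

lemma bounded_bilinear_mv: "bounded_bilinear ((*v) :: real^'d^'d \<Rightarrow> real^'d \<Rightarrow> real^('d::finite))"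
  unfolding bilinear_conv_bounded_bilinear[symmetric] bilinear_def
  by (auto intro!: linearI simp: matrix_vector_mult_def vec_eq_iff sum.distrib sum_distrib_left algebra_simps)

text \<open>A kernel vector \<open>x\<close> of \<open>A\<close> satisfies
  \<open>(A - mat 1) *v x = - x\<close>, impossible for nonzero \<open>x\<close> once
  \<open>norm (A - mat 1)\<close> is below \<open>1 / K\<close>, where \<open>K\<close> bounds the
  matrix-vector product.\<close>

lemma invertible_near_mat_1:
  "\<exists>\<delta>>0. \<forall>A :: real^'d^('d::finite). norm (A - mat 1) < \<delta> \<longrightarrow> invertible A"
proof -
  obtain K where K: "K > 0" "\<And>(A :: real^'d^'d) (x :: real^'d). norm (A *v x) \<le> norm A * norm x * K"
    using bounded_bilinear.pos_bounded[OF bounded_bilinear_mv[where 'd='d]] by blast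
  have "invertible A" if A: "norm (A - mat 1) < 1 / K" for A :: "real^'d^'d"
  proof -
    have "x = 0" if x: "A *v x = 0" for x
    proof (rule ccontr)
      assume "x \<noteq> 0"
      have "(A - mat 1) *v x = - x" using x by (simp add: matrix_vector_mult_diff_rdistrib)
      then have "norm x \<le> norm (A - mat 1) * norm x * K" using K(2)[of "A - mat 1" x] by simp
      also have "\<dots> < 1 / K * norm x * K"
        using A K(1) \<open>x \<noteq> 0\<close> by (intro mult_strict_right_mono) auto
      finally show False using K(1) by simp
    qed
    then show ?thesis unfolding invertible_left_inverse matrix_left_invertible_ker by blast
  qed
  then show ?thesis using K(1) by (intro exI[of _ "1 / K"]) auto
qed

context closed_manifold
begin

text \<open>The bridge from fields to matrices: it makes continuity of composition and inversion a
  matter of matrix-valued functions in each chart.\<close>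

lemma Cinf_limit_iff:
  "limitin (Cinf_topology \<M>) Ks K F \<longleftrightarrow> K \<in> SF \<and> (\<forall>\<^sub>F i in F. Ks i \<in> SF) \<and>
    (\<forall>c\<in>\<M>. \<forall>n. conv_order n (img c) F (\<lambda>i. lm c (Ks i)) (lm c K))"
proof -
  have eq: "((\<lambda>i. sn c C vs (Ks i - K)) \<longlongrightarrow> 0) F \<longleftrightarrow>
      uniform_limit C (\<lambda>i. iter_deriv vs (lm c (Ks i))) (iter_deriv vs (lm c K)) F"
    if K: "K \<in> SF" and ev: "\<forall>\<^sub>F i in F. Ks i \<in> SF" and c: "c \<in> \<M>" "compact C" "C \<subseteq> img c" for c C vs
  proof -
    have "eventually (\<lambda>i. dist (sn c C vs (Ks i - K)) 0 < e) F \<longleftrightarrow>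
      eventually (\<lambda>i. \<forall>y\<in>C. dist (iter_deriv vs (lm c (Ks i)) y) (iter_deriv vs (lm c K) y) < e) F" if e: "e > 0" for e
    proof (rule eventually_subst)
      show "\<forall>\<^sub>F i in F. (dist (sn c C vs (Ks i - K)) 0 < e) =
          (\<forall>y\<in>C. dist (iter_deriv vs (lm c (Ks i)) y) (iter_deriv vs (lm c K) y) < e)"
        using ev
      proof eventually_elim
        case (elim i)
        have d: "Ks i - K \<in> SF" by (rule subspace_diff[OF subspace_SF elim K])
        have "dist (sn c C vs (Ks i - K)) 0 < e \<longleftrightarrow> sn c C vs (Ks i - K) < e"
          using sn_attained(3)[OF c d] by (simp add: dist_real_def)
        also have "\<dots> \<longleftrightarrow> (\<forall>y\<in>C. norm (iter_deriv vs (lm c (Ks i - K)) y) < e)"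
          by (rule sn_less_iff[OF c d e])
        also have "\<dots> \<longleftrightarrow> (\<forall>y\<in>C. dist (iter_deriv vs (lm c (Ks i)) y) (iter_deriv vs (lm c K) y) < e)"
          by (simp add: dist_norm iter_lm_diff[OF c elim K])
        finally show ?case .
      qed
    qed
    then show ?thesis unfolding tendsto_iff uniform_limit_iff by simp
  qed
  have sem: "(\<forall>p\<in>seminorms. Q p) \<longleftrightarrow> (\<forall>c\<in>\<M>. \<forall>C vs. compact C \<and> C \<subseteq> img c \<longrightarrow> Q (sn c C vs))" for Q
    unfolding seminorms_def by blast
  show ?thesis
  proof (cases "K \<in> SF \<and> (\<forall>\<^sub>F i in F. Ks i \<in> SF)")
    case True
    then have "(\<forall>p\<in>seminorms. ((\<lambda>i. p (Ks i - K)) \<longlongrightarrow> 0) F) \<longleftrightarrow>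
      (\<forall>c\<in>\<M>. \<forall>C vs. compact C \<and> C \<subseteq> img c \<longrightarrow> uniform_limit C (\<lambda>i. iter_deriv vs (lm c (Ks i))) (iter_deriv vs (lm c K)) F)"
      unfolding sem by (auto simp: eq)
    also have "\<dots> \<longleftrightarrow> (\<forall>c\<in>\<M>. \<forall>n. conv_order n (img c) F (\<lambda>i. lm c (Ks i)) (lm c K))"
      unfolding conv_order_def by blast
    finally show ?thesis unfolding Cinf.limitin_iff Cinf_topspace by blast
  qed (use Cinf.limitin_iff Cinf_topspace in auto)
qed

lemma Cinf_limit_comp:
  assumes K: "limitin (Cinf_topology \<M>) Ks K F" and L: "limitin (Cinf_topology \<M>) Ls L F"
  shows "limitin (Cinf_topology \<M>) (\<lambda>i. Ks i \<odot> Ls i) (K \<odot> L) F"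
  unfolding Cinf_limit_iff
proof (intro conjI ballI allI)
  note k = K[unfolded Cinf_limit_iff] and l = L[unfolded Cinf_limit_iff]
  have KL: "K \<in> SF" "L \<in> SF" and evK: "\<forall>\<^sub>F i in F. Ks i \<in> SF" and evL: "\<forall>\<^sub>F i in F. Ls i \<in> SF"
    using k l by auto
  show "K \<odot> L \<in> SF" by (rule SF_comp[OF KL])
  show "\<forall>\<^sub>F i in F. Ks i \<odot> Ls i \<in> SF" using evK evL by eventually_elim (rule SF_comp)
  fix c n assume c: "c \<in> \<M>"
  have sK: "\<forall>\<^sub>F i in F. smooth_on (img c) (lm c (Ks i))" using evK by eventually_elim (rule SF_smooth[OF _ c])
  have sL: "\<forall>\<^sub>F i in F. smooth_on (img c) (lm c (Ls i))" using evL by eventually_elim (rule SF_smooth[OF _ c])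
  have cK: "conv_order n (img c) F (\<lambda>i. lm c (Ks i)) (lm c K)" and cL: "conv_order n (img c) F (\<lambda>i. lm c (Ls i)) (lm c L)"
    using k l c by blast+
  show "conv_order n (img c) F (\<lambda>i. lm c (Ks i \<odot> Ls i)) (lm c (K \<odot> L))"
  proof (rule conv_order_cong[OF chart_props(2)[OF c] _ _
        conv_order_bilinear[OF bounded_bilinear_mm sK sL SF_smooth[OF KL(1) c] SF_smooth[OF KL(2) c] cK cL]])
    show "\<forall>\<^sub>F i in F. \<forall>y\<in>img c. lm c (Ks i) y ** lm c (Ls i) y = lm c (Ks i \<odot> Ls i) y"
      using evK evL by eventually_elim (use lm_comp[OF c] SF_endo in metis)
    show "lm c K y ** lm c L y = lm c (K \<odot> L) y" if "y \<in> img c" for y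
      using lm_comp[OF c that SF_endo[OF KL(1)] SF_endo[OF KL(2)]] by simp
  qed
qed

lemma comp_id: "endo K \<Longrightarrow> K \<odot> id_field \<M> = K" "endo K \<Longrightarrow> id_field \<M> \<odot> K = K"
proof -
  assume K: "endo K"
  show "K \<odot> id_field \<M> = K"
  proof (intro ext)
    fix p v d
    have "K p (id_field \<M> p v) = K p v"
      by (cases "v \<in> TM p") (simp_all only: id_field_def if_True if_False not_False_eq_True endo_zero[OF K] endo_out[OF K])
    then show "(K \<odot> id_field \<M>) p v d = K p v d" by (simp add: field_comp_def)
  qed
  show "id_field \<M> \<odot> K = K"
    by (intro ext) (simp add: field_comp_def id_field_def endo_mem[OF K])
qed

lemma comp_assoc: "K \<odot> L \<odot> N = K \<odot> (L \<odot> N)"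
  by (simp add: field_comp_def o_assoc)

lemma inverse_fields_unique:
  assumes "inverse_fields \<M> K L" "inverse_fields \<M> K L'"
  shows "L = L'"
proof -
  have "L = L \<odot> (K \<odot> L')" using assms comp_id SF_endo by (simp add: inverse_fields_def)
  also have "\<dots> = (L \<odot> K) \<odot> L'" by (simp only: comp_assoc)
  also have "\<dots> = L'" using assms comp_id SF_endo by (simp add: inverse_fields_def)
  finally show ?thesis .
qed

lemma field_inv_works:
  assumes "invertible_field \<M> K"
  shows "inverse_fields \<M> K (field_inv \<M> K)"
proof -
  obtain L where L: "inverse_fields \<M> K L" using assms by (auto simp: invertible_field_def)
  show ?thesis
    unfolding field_inv_def
    by (rule theI[of "inverse_fields \<M> K", OF L]) (rule inverse_fields_unique[OF _ L])
qed

lemma inverse_fields_matrix: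
  assumes "inverse_fields \<M> K L" "c \<in> \<M>" "y \<in> img c"
  shows "lm c K y ** lm c L y = mat 1" "lm c L y ** lm c K y = mat 1"
  using assms lm_comp[OF assms(2,3) SF_endo SF_endo, symmetric] lm_id[OF assms(2,3)]
  by (simp_all add: inverse_fields_def)

lemma Cinf_limit_inv:
  assumes K: "limitin (Cinf_topology \<M>) Ks K F" and iK: "invertible_field \<M> K"
    and iKs: "\<forall>\<^sub>F i in F. invertible_field \<M> (Ks i)"
  shows "limitin (Cinf_topology \<M>) (\<lambda>i. field_inv \<M> (Ks i)) (field_inv \<M> K) F"
  unfolding Cinf_limit_iff
proof (intro conjI ballI allI)
  note k = K[unfolded Cinf_limit_iff]
  note inv = field_inv_works[OF iK]
  have invs: "\<forall>\<^sub>F i in F. inverse_fields \<M> (Ks i) (field_inv \<M> (Ks i))"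
    using iKs by eventually_elim (rule field_inv_works)
  show "field_inv \<M> K \<in> SF" using inv by (simp add: inverse_fields_def)
  show "\<forall>\<^sub>F i in F. field_inv \<M> (Ks i) \<in> SF" using invs by eventually_elim (simp add: inverse_fields_def)
  fix c n assume c: "c \<in> \<M>"
  show "conv_order n (img c) F (\<lambda>i. lm c (field_inv \<M> (Ks i))) (lm c (field_inv \<M> K))"
  proof (rule conv_order_matrix_inverse)
    have "\<forall>\<^sub>F i in F. Ks i \<in> SF" using k by blast
    then show "\<forall>\<^sub>F i in F. smooth_on (img c) (lm c (Ks i))" by eventually_elim (rule SF_smooth[OF _ c])
    show "smooth_on (img c) (lm c K)" using k SF_smooth[OF _ c] by blast
    show "conv_order n (img c) F (\<lambda>i. lm c (Ks i)) (lm c K)" for n using k c by blast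
    show "\<forall>\<^sub>F i in F. \<forall>y\<in>img c. lm c (Ks i) y ** lm c (field_inv \<M> (Ks i)) y = mat 1 \<and>
        lm c (field_inv \<M> (Ks i)) y ** lm c (Ks i) y = mat 1"
      using invs by eventually_elim (use inverse_fields_matrix[OF _ c] in blast)
  qed (rule inverse_fields_matrix[OF inv c]; assumption)+
qed

text \<open>The inverses on the tangent spaces are assembled without reference to a chart. In every
  chart the local matrix of the result is then the inverse of that of \<open>L\<close>, hence
  smooth, although invertibility was supposed in only one chart around each point.\<close>

lemma invertible_field_pointwise:
  assumes L: "L \<in> SF" and inv: "\<And>p. \<exists>c\<in>\<M>. p \<in> dom c \<and> invertible (lm c L (snd c p))"
  shows "invertible_field \<M> L"
proof -
  note eL = SF_endo[OF L]
  have bij: "bij_betw (L p) (TM p) (TM p)" for p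
  proof -
    obtain c where c: "c \<in> \<M>" "p \<in> dom c" and "invertible (lm c L (snd c p))" using inv by blast
    then obtain B where B: "lm c L (snd c p) ** B = mat 1" "B ** lm c L (snd c p) = mat 1"
      by (auto simp: invertible_def)
    show ?thesis
    proof (rule bij_betw_byWitness[where f'="\<lambda>v. tvec_of \<M> c p (B *v v c)"])
      show "\<forall>v\<in>TM p. tvec_of \<M> c p (B *v L p v c) = v"
        by (simp add: endo_component[OF eL c] matrix_vector_mul_assoc B tvec_of_component[OF c])
      show "\<forall>v\<in>TM p. L p (tvec_of \<M> c p (B *v v c)) = v"
      proof
        fix v assume v: "v \<in> TM p"
        show "L p (tvec_of \<M> c p (B *v v c)) = v"
          by (rule TM_eqI[OF c endo_mem[OF eL] v])
            (simp add: endo_component[OF eL c tvec_of_mem[OF c]] tvec_of_self[OF c] matrix_vector_mul_assoc B)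
      qed
    qed (use endo_mem[OF eL] tvec_of_mem[OF c] in auto)
  qed
  \<comment> \<open>The value \<open>0\<close> outside the tangent space is the convention for
    fields; with it both composites equal \<open>id_field \<M>\<close> as functions.\<close>
  define N where "N = (\<lambda>p v. if v \<in> TM p then the_inv_into (TM p) (L p) v else 0)"
  have N: "N p v = the_inv_into (TM p) (L p) v" if "v \<in> TM p" for p v
    unfolding N_def by (simp only: that if_True)
  have Nout: "N p v = 0" if "v \<notin> TM p" for p v
    unfolding N_def by (simp only: that if_False)
  have Nmem: "N p v \<in> TM p" and LN: "L p (N p v) = v" if "v \<in> TM p" for p v
    using that bij_betwE[OF bij_betw_the_inv_into[OF bij]] f_the_inv_into_f_bij_betw[OF bij] N by auto
  have NL: "N p (L p v) = v" if "v \<in> TM p" for p v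
    using the_inv_into_f_f[OF bij_betw_imp_inj_on[OF bij] that] N[OF endo_mem[OF eL]] by simp
  have eN: "endo N"
  proof (rule endoI[OF Nmem _ Nout])
    fix p v w and a b :: real assume v: "v \<in> TM p" and w: "w \<in> TM p"
    have lin: "a *\<^sub>R N p v + b *\<^sub>R N p w \<in> TM p"
      by (intro subspace_add[OF subspace_TM] subspace_scale[OF subspace_TM] Nmem v w)
    have "L p (a *\<^sub>R N p v + b *\<^sub>R N p w) = a *\<^sub>R v + b *\<^sub>R w"
      by (simp only: endo_linear[OF eL Nmem[OF v] Nmem[OF w]] LN[OF v] LN[OF w])
    then show "N p (a *\<^sub>R v + b *\<^sub>R w) = a *\<^sub>R N p v + b *\<^sub>R N p w" using NL[OF lin] by simp
  qed
  have LNid: "L \<odot> N = id_field \<M>"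
  proof (intro ext)
    fix p v d
    have "L p (N p v) = id_field \<M> p v"
      by (cases "v \<in> TM p") (simp_all only: id_field_def if_True if_False not_False_eq_True LN Nout endo_zero[OF eL])
    then show "(L \<odot> N) p v d = id_field \<M> p v d" by (simp add: field_comp_def)
  qed
  have NLid: "N \<odot> L = id_field \<M>"
  proof (intro ext)
    fix p v d
    have "N p (L p v) = id_field \<M> p v"
      by (cases "v \<in> TM p") (simp_all only: id_field_def if_True if_False not_False_eq_True NL endo_out[OF eL] endo_zero[OF eN])
    then show "(N \<odot> L) p v d = id_field \<M> p v d" by (simp add: field_comp_def)
  qed
  have "smooth_on (img c) (lm c N)" if c: "c \<in> \<M>" for c
  proof (rule smooth_on_matrix_inverse[OF SF_smooth[OF L c]])
    fix y assume y: "y \<in> img c"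
    show "lm c L y ** lm c N y = mat 1" "lm c N y ** lm c L y = mat 1"
      using lm_comp[OF c y eL eN] lm_comp[OF c y eN eL] lm_id[OF c y] by (simp_all add: LNid NLid)
  qed
  then have "N \<in> SF" using eN by (simp add: SF_iff)
  then have "inverse_fields \<M> L N" using L LNid NLid by (simp add: inverse_fields_def)
  then show ?thesis by (auto simp: invertible_field_def)
qed

text \<open>Closed balls inside the chart images are the compact sets; the preimages of the open
  balls cover the compact manifold. Finitely many seminorms thus control a field at every
  point.\<close>

lemma finite_compact_cover:
  "\<exists>\<F>. finite \<F> \<and> (\<forall>z\<in>\<F>. fst z \<in> \<M> \<and> compact (snd z) \<and> snd z \<subseteq> img (fst z)) \<and>
    (\<forall>p. \<exists>z\<in>\<F>. p \<in> dom (fst z) \<and> snd (fst z) p \<in> snd z)"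
proof -
  have "\<exists>c C U. c \<in> \<M> \<and> compact C \<and> C \<subseteq> img c \<and> open U \<and> p \<in> U \<and> U \<subseteq> dom c \<and> snd c ` U \<subseteq> C" for p
  proof -
    obtain c where c: "c \<in> \<M>" "p \<in> dom c" using ex_chart by blast
    have "snd c p \<in> img c" using c by blast
    then obtain r where r: "r > 0" "cball (snd c p) r \<subseteq> img c"
      using chart_props(2)[OF c(1)] open_contains_cball by blast
    have "continuous_on (dom c) (snd c)" using chart_props(3)[OF c(1)] by (simp add: homeomorphism_def)
    then have "open (dom c \<inter> snd c -` ball (snd c p) r)"
      using chart_props(1)[OF c(1)] continuous_open_preimage by blast
    then show ?thesis using c r
      by (intro exI[of _ c] exI[of _ "cball (snd c p) r"] exI[of _ "dom c \<inter> snd c -` ball (snd c p) r"]) auto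
  qed
  then obtain c C U where *: "\<And>p. c p \<in> \<M>" "\<And>p. compact (C p)" "\<And>p. C p \<subseteq> img (c p)" "\<And>p. open (U p)"
    "\<And>p. p \<in> U p" "\<And>p. U p \<subseteq> dom (c p)" "\<And>p. snd (c p) ` U p \<subseteq> C p" by metis
  have "UNIV \<subseteq> (\<Union>p\<in>UNIV. U p)" using *(5) by blast
  then obtain D where D: "finite D" "UNIV \<subseteq> (\<Union>p\<in>D. U p)"
    using compactE_image[OF compact_M, of UNIV U] *(4) by metis
  show ?thesis
  proof (intro exI[of _ "(\<lambda>p. (c p, C p)) ` D"] conjI)
    show "finite ((\<lambda>p. (c p, C p)) ` D)" using D by simp
    show "\<forall>z\<in>(\<lambda>p. (c p, C p)) ` D. fst z \<in> \<M> \<and> compact (snd z) \<and> snd z \<subseteq> img (fst z)" using *(1-3) by simp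
    show "\<forall>p. \<exists>z\<in>(\<lambda>p. (c p, C p)) ` D. p \<in> dom (fst z) \<and> snd (fst z) p \<in> snd z"
    proof
      fix p
      obtain q where q: "q \<in> D" "p \<in> U q" using D(2) by blast
      then have "p \<in> dom (c q)" "snd (c q) p \<in> C q" using *(6,7) by blast+
      then show "\<exists>z\<in>(\<lambda>p. (c p, C p)) ` D. p \<in> dom (fst z) \<and> snd (fst z) p \<in> snd z"
        using q by (intro bexI[of _ "(c q, C q)"]) auto
    qed
  qed
qed

text \<open>The seminorms of order zero over a finite compact cover force the local matrix of
  \<open>L\<close> at each point to be within \<open>\<delta>\<close> of \<open>mat 1\<close> in
  some chart, and there it is invertible.\<close>

lemma invertible_near_id:
  "\<exists>W. openin (Cinf_topology \<M>) W \<and> id_field \<M> \<in> W \<and> (\<forall>L\<in>W. invertible_field \<M> L)"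
proof -
  obtain \<delta> where \<delta>: "\<delta> > 0" "\<And>A :: real^'d^'d. norm (A - mat 1) < \<delta> \<Longrightarrow> invertible A"
    using invertible_near_mat_1[where 'd='d] by blast
  obtain \<F> where F: "finite \<F>" "\<forall>z\<in>\<F>. fst z \<in> \<M> \<and> compact (snd z) \<and> snd z \<subseteq> img (fst z)"
    "\<forall>p. \<exists>z\<in>\<F>. p \<in> dom (fst z) \<and> snd (fst z) p \<in> snd z"
    using finite_compact_cover by (elim exE conjE) (rule that)
  define Q where "Q = (\<lambda>z. sn (fst z) (snd z) []) ` \<F>"
  define W where "W = {L \<in> SF. \<forall>p\<in>Q. p (L - id_field \<M>) < \<delta>}"
  have Q: "finite Q" "Q \<subseteq> seminorms"
    using F(1,2) unfolding Q_def seminorms_def by blast+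
  have "openin (Cinf_topology \<M>) W"
    using Cinf.openin_ball[OF Q, of "id_field \<M>" \<delta>] SF_id by (simp add: Cinf_topspace W_def)
  moreover have "id_field \<M> \<in> W"
  proof -
    have "p (id_field \<M> - id_field \<M>) < \<delta>" if "p \<in> Q" for p
      using Cinf.sn_zero[OF subsetD[OF Q(2) that]] \<delta>(1) by simp
    then show ?thesis unfolding W_def using SF_id by blast
  qed
  moreover have "invertible_field \<M> L" if L: "L \<in> W" for L
  proof (rule invertible_field_pointwise)
    show LS: "L \<in> SF" using L by (simp add: W_def)
    fix p
    obtain z where z: "z \<in> \<F>" "p \<in> dom (fst z) \<and> snd (fst z) p \<in> snd z"
      using F(3) by (elim allE[of _ p] bexE)
    define c where "c = fst z"
    define C where "C = snd z"
    have c: "p \<in> dom c" "snd c p \<in> C" and cC: "c \<in> \<M>" "compact C" "C \<subseteq> img c"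
      using z(2) bspec[OF F(2) z(1)] by (simp_all add: c_def C_def)
    have "sn c C [] \<in> Q" unfolding Q_def c_def C_def using z(1) by (rule imageI)
    then have "sn c C [] (L - id_field \<M>) < \<delta>" using L by (simp add: W_def)
    then have "norm (lm c (L - id_field \<M>) (snd c p)) < \<delta>"
      using sn_less_iff[OF cC subspace_diff[OF subspace_SF LS SF_id] \<delta>(1), of "[]"] c(2) by simp
    then have "norm (lm c L (snd c p) - mat 1) < \<delta>"
      using lm_diff[OF cC(1) _ LS SF_id, of "snd c p"] lm_id[OF cC(1), of "snd c p"] c(1) by simp
    then show "\<exists>c\<in>\<M>. p \<in> dom c \<and> invertible (lm c L (snd c p))" using \<delta>(2) cC(1) c(1) by blast
  qed
  ultimately show ?thesis by blast
qed

lemma inverse_fieldsI: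
  "\<lbrakk>K \<in> SF; L \<in> SF; K \<odot> L = id_field \<M>; L \<odot> K = id_field \<M>\<rbrakk> \<Longrightarrow> invertible_field \<M> K"
  unfolding invertible_field_def inverse_fields_def by blast

text \<open>Composition with an inverse \<open>N\<close> of \<open>K\<close> moves \<open>K\<close>
  to the identity, so a neighbourhood of the identity pulls back to one of \<open>K\<close>.\<close>

lemma open_invertible: "openin (Cinf_topology \<M>) (Collect (invertible_field \<M>))"
proof (subst openin_subopen, intro ballI)
  fix K assume "K \<in> Collect (invertible_field \<M>)"
  then obtain N where N: "K \<in> SF" "N \<in> SF" "K \<odot> N = id_field \<M>" "N \<odot> K = id_field \<M>"
    by (auto simp: invertible_field_def inverse_fields_def)
  obtain W where W: "openin (Cinf_topology \<M>) W" "id_field \<M> \<in> W" "\<And>L. L \<in> W \<Longrightarrow> invertible_field \<M> L"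
    using invertible_near_id by blast
  have "continuous_map (Cinf_topology \<M>) (Cinf_topology \<M>) (\<lambda>L. N \<odot> L)"
    unfolding continuous_map_atin
  proof
    fix L assume L: "L \<in> topspace (Cinf_topology \<M>)"
    show "limitin (Cinf_topology \<M>) (\<lambda>L. N \<odot> L) (N \<odot> L) (atin (Cinf_topology \<M>) L)"
      by (rule Cinf_limit_comp) (use N L limitin_continuous_map[OF continuous_map_id L refl] in \<open>auto simp: Cinf_topspace id_def\<close>)
  qed
  then have op: "openin (Cinf_topology \<M>) {L \<in> topspace (Cinf_topology \<M>). N \<odot> L \<in> W}"
    using W(1) by (rule openin_continuous_map_preimage)
  show "\<exists>T. openin (Cinf_topology \<M>) T \<and> K \<in> T \<and> T \<subseteq> Collect (invertible_field \<M>)"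
  proof (intro exI conjI subsetI)
    show "K \<in> {L \<in> topspace (Cinf_topology \<M>). N \<odot> L \<in> W}" using N W by (simp add: Cinf_topspace)
    fix L assume "L \<in> {L \<in> topspace (Cinf_topology \<M>). N \<odot> L \<in> W}"
    then have L: "L \<in> SF" and "invertible_field \<M> (N \<odot> L)" using W(3) by (auto simp: Cinf_topspace)
    then obtain R where R: "R \<in> SF" "N \<odot> L \<odot> R = id_field \<M>" "R \<odot> (N \<odot> L) = id_field \<M>"
      by (auto simp: invertible_field_def inverse_fields_def)
    \<comment> \<open>If \<open>R\<close> inverts \<open>N \<odot> L\<close>, then
      \<open>R \<odot> N\<close> is a left inverse of \<open>L\<close> by associativity; this
      computation shows that it is also a right inverse.\<close>
    have "L \<odot> (R \<odot> N) = (K \<odot> N) \<odot> L \<odot> (R \<odot> N)" using N(3) comp_id(2)[OF SF_endo[OF L]] by simp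
    also have "\<dots> = K \<odot> (N \<odot> L \<odot> R) \<odot> N" by (simp only: comp_assoc)
    also have "\<dots> = id_field \<M>" using R(2) N(3) comp_id(1)[OF SF_endo[OF N(1)]] by simp
    finally have "invertible_field \<M> L"
      using R N L by (intro inverse_fieldsI[OF L SF_comp[OF R(1) N(2)]]) (simp_all add: comp_assoc)
    then show "L \<in> Collect (invertible_field \<M>)" by simp
  qed (rule op)
qed

end

sublocale closed_manifold \<subseteq> Cinf: continuous_inverse_algebra "Cinf_topology \<M>" seminorms "(\<odot>)" "id_field \<M>"
  "field_inv \<M>" "Collect (invertible_field \<M>)"
proof (unfold_locales, unfold Cinf_topspace)
  show "openin (Cinf_topology \<M>) (Collect (invertible_field \<M>))" by (rule open_invertible)
  show "continuous_map (prod_topology (Cinf_topology \<M>) (Cinf_topology \<M>)) (Cinf_topology \<M>) (\<lambda>(x, y). x \<odot> y)"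
    unfolding continuous_map_atin case_prod_unfold
  proof
    let ?Z = "prod_topology (Cinf_topology \<M>) (Cinf_topology \<M>)"
    fix z assume z: "z \<in> topspace ?Z"
    show "limitin (Cinf_topology \<M>) (\<lambda>z. fst z \<odot> snd z) (fst z \<odot> snd z) (atin ?Z z)"
      by (intro Cinf_limit_comp limitin_continuous_map[OF continuous_map_fst z refl]
          limitin_continuous_map[OF continuous_map_snd z refl])
  qed
  show "continuous_map (subtopology (Cinf_topology \<M>) (Collect (invertible_field \<M>))) (Cinf_topology \<M>) (field_inv \<M>)"
    unfolding continuous_map_atin
  proof
    let ?Z = "subtopology (Cinf_topology \<M>) (Collect (invertible_field \<M>))"
    fix K assume K: "K \<in> topspace ?Z"
    have "limitin ?Z (\<lambda>L. L) K (atin ?Z K)"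
      using limitin_continuous_map[OF continuous_map_id K refl] by (simp add: id_def)
    then have "limitin (Cinf_topology \<M>) (\<lambda>L. L) K (atin ?Z K)" "\<forall>\<^sub>F L in atin ?Z K. invertible_field \<M> L"
      by (simp_all add: limitin_subtopology)
    then show "limitin (Cinf_topology \<M>) (field_inv \<M>) (field_inv \<M> K) (atin ?Z K)"
      using K Cinf_limit_inv[of "\<lambda>L. L"] by simp
  qed
  show "x \<odot> y \<odot> z = x \<odot> (y \<odot> z)" for x y z by (rule comp_assoc)
  show "(x + y) \<odot> z = x \<odot> z + y \<odot> z" for x y z by (simp add: field_comp_def fun_eq_iff)
  \<comment> \<open>Unlike the other distributive law, this one rests on the linearity of
    \<open>z\<close> on tangent spaces, as does homogeneity in the second factor.\<close>
  show "z \<odot> (x + y) = z \<odot> x + z \<odot> y" if "x \<in> SF" "y \<in> SF" "z \<in> SF" for x y z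
  proof (intro ext)
    fix p v d
    have "z p (x p v + y p v) = z p (x p v) + z p (y p v)"
      by (rule endo_add[OF SF_endo[OF that(3)] endo_mem[OF SF_endo[OF that(1)]] endo_mem[OF SF_endo[OF that(2)]]])
    moreover have "(x + y) p v = x p v + y p v" by (simp only: plus_fun_apply)
    ultimately show "(z \<odot> (x + y)) p v d = (z \<odot> x + z \<odot> y) p v d"
      by (simp only: field_comp_def o_apply plus_fun_apply)
  qed
  show "(r *\<^sub>R x) \<odot> y = r *\<^sub>R (x \<odot> y)" for r x y by (simp add: field_comp_def fun_eq_iff scaleR_fun_def)
  show "x \<odot> (r *\<^sub>R y) = r *\<^sub>R (x \<odot> y)" if "x \<in> SF" "y \<in> SF" for r x y
  proof (intro ext)
    fix p v d
    have "x p (r *\<^sub>R y p v) = r *\<^sub>R x p (y p v)"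
      by (rule endo_scale[OF SF_endo[OF that(1)] endo_mem[OF SF_endo[OF that(2)]]])
    moreover have "(r *\<^sub>R y) p v = r *\<^sub>R y p v" by (simp only: scaleR_fun_def)
    ultimately have "(x \<odot> (r *\<^sub>R y)) p v = r *\<^sub>R (x \<odot> y) p v" by (simp only: field_comp_def o_apply)
    then show "(x \<odot> (r *\<^sub>R y)) p v d = (r *\<^sub>R (x \<odot> y)) p v d" by (simp only: scaleR_fun_def)
  qed
  show "field_inv \<M> x \<in> SF" "field_inv \<M> x \<odot> x = id_field \<M>" "x \<odot> field_inv \<M> x = id_field \<M>"
    if "x \<in> Collect (invertible_field \<M>)" for x
    using field_inv_works[of x] that by (simp_all add: inverse_fields_def)
  show "x \<in> Collect (invertible_field \<M>)" if "x \<in> SF" "y \<in> SF" "x \<odot> y = id_field \<M>" "y \<odot> x = id_field \<M>" for x y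
    using inverse_fieldsI[OF that] by simp
qed (simp_all add: SF_comp SF_id comp_id SF_endo)

theorem theorem1:
  fixes \<M> :: "('m::t2_space, 'd::finite) chart set" and n :: nat
  assumes "closed_oriented_manifold \<M>" and "CARD('d) = 2 * n"
  defines "\<T> \<equiv> Cinf_topology \<M>" and "\<A> \<equiv> acs_space \<M>"
  shows "integrable_acs \<T> \<A> (End_anti \<M>) acs_J \<and>
    (\<forall>J0\<in>\<A>. bij_betw (acs_Phi \<M> J0) (acs_U \<M> J0) (acs_V \<M> J0)) \<and>
    complex_atlas \<T> \<A> (Phi_atlas \<M>) \<and>
    (\<forall>\<C>. complex_structure \<T> \<A> \<C> \<and> induces \<T> (End_anti \<M>) \<C> acs_J \<longleftrightarrow>
      \<C> = complex_structure_of \<T> \<A> (Phi_atlas \<M>))"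
proof -
  interpret closed_manifold \<M> by standard (rule assms(1))
  \<comment> \<open>The notions of the abstract algebra unfold to the concrete ones because the
    underlying space of the topology is \<open>smooth_fields \<M>\<close>.\<close>
  have A: "Cinf.acs = acs_space \<M>" by (simp add: Cinf.acs_def acs_space_def Cinf_topspace)
  have E: "Cinf.anti = End_anti \<M>" by (rule ext) (simp add: Cinf.anti_def End_anti_def Cinf_topspace)
  have J: "(\<lambda>J A. A \<odot> J) = acs_J" by (intro ext) (simp add: acs_J_def)
  have Phi: "Cinf.cayley = acs_Phi \<M>" by (intro ext) (simp add: Cinf.cayley_def acs_Phi_def)
  have U: "Cinf.cayley_dom = acs_U \<M>" by (rule ext) (simp add: Cinf.cayley_dom_def acs_U_def A)
  have V: "Cinf.cayley_img = acs_V \<M>" by (rule ext) (simp add: Cinf.cayley_img_def acs_V_def E)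
  have "Cinf.cayley_chart ` acs_space \<M> = Phi_atlas \<M>"
    unfolding Phi_atlas_def Cinf.cayley_chart_def Phi U E by blast
  then show ?thesis
    using Cinf.integrable_cayley Cinf.bij_betw_cayley
    unfolding A E J Phi U V \<T>_def \<A>_def by simp
qed

end
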